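(* Let $R:\mathbb{R}^n\to\mathbb{Z}^n$ be a quantizer, let $L\in\mathbb{R}^{n\times n}$ be nonsingular, and let $\widetilde{T}=\widetilde{R}\circ L^{-1}$ be the transition operator of the compensating system of the quantized linear $(R,L)$-system. Suppose the matrix $L$ is iteratively nonresonant. Then: (a) the quantization errors $\widetilde{E}_k$, $k\in\mathbb{N}$, of the compensating system are mutually independent, uniformly distributed on the cell $\widetilde{R}^{-1}(0)$ and measurable with respect to the backward algebra $\mathcal{Q}^-$. More precisely, for any $N\in\mathbb{N}$, the map $$\widetilde{\mathcal{E}}_N=\begin{bmatrix}\widetilde{E}_1\\ \vdots\\ \widetilde{E}_N\end{bmatrix}:\mathbb{Z}^n\to(\widetilde{R}^{-1}(0))^N$$ is $\mathrm{mes}_{Nn}$-distributed, and the algebra $\mathcal{S}_{\widetilde{\mathcal{E}}_N}$ generated by this map coincides with the algebra $\mathcal{Q}_N^-$; (b) the algebras generated by the quantization errors of the compensating system are representable as $\mathcal{S}_{\widetilde{E}_k}=\widetilde{T}^{-(k-1)}(\mathcal{Q}_1^-)\subset\mathcal{Q}_k^-$ for all $k\in\mathbb{N}$, and are mutually independent.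
   Context: Frequency. For $a\in\mathbb{Z}^n$ and $\ell\in\mathbb{N}^n$ let $P_{a,\ell}=\{x\in\mathbb{Z}^n:\ a_k\le x_k<a_k+\ell_k \text{ for all }1\le k\le n\}$, and for $N\in\mathbb{N}$ let $\mathcal{P}_N=\{P_{a,\ell}:\ a\in\mathbb{Z}^n,\ \ell\in\mathbb{N}^n,\ \min_k\ell_k\ge N\}$. For $A\subset\mathbb{Z}^n$ put $\mathbf{F}_*(A)=\sup_{N\ge1}\inf_{P\in\mathcal{P}_N}\frac{\#(A\cap P)}{\#P}$ and $\mathbf{F}^*(A)=\inf_{N\ge1}\sup_{P\in\mathcal{P}_N}\frac{\#(A\cap P)}{\#P}$. The set $A$ is frequency measurable if $\mathbf{F}_*(A)=\mathbf{F}^*(A)$; the common value is the frequency $\mathbf{F}(A)$. Algebras $\mathcal{S}_1,\mathcal{S}_2,\ldots$ of frequency measurable sets are mutually independent if $\mathbf{F}(\bigcap_{k=1}^NA_k)=\prod_{k=1}^N\mathbf{F}(A_k)$ for all $N\in\mathbb{N}$ and all $A_k\in\mathcal{S}_k$. Distributed maps. Let $X$ be a metric space with Borel $\sigma$-algebra $\mathcal{B}$ and $D$ a countably additive probability measure on $(X,\mathcal{B})$. A map $h:\mathbb{Z}^n\to X$ is $D$-distributed if for every $B\in\mathcal{B}$ with $D(\partial B)=0$ the preimage $h^{-1}(B)$ is frequency measurable and $\mathbf{F}(h^{-1}(B))=D(B)$. In this case the algebra generated by $h$ is $\mathcal{S}_h=\{h^{-1}(B):\ B\in\mathcal{B},\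 D(\partial B)=0\}$. "$\mathrm{mes}_{Nn}$-distributed" for a map with values in $X=(\widetilde{R}^{-1}(0))^N$ refers to $D$ being the restriction of the $Nn$-dimensional Lebesgue measure to $X$ (a probability measure, since $\mathrm{mes}_n\widetilde{R}^{-1}(0)=1$). System. A quantizer is a map $R:\mathbb{R}^n\to\mathbb{Z}^n$ such that $R(u+z)=R(u)+z$ for all $u\in\mathbb{R}^n$, $z\in\mathbb{Z}^n$, and the set $R^{-1}(0)$ is Jordan measurable (bounded with boundary of zero Lebesgue measure). Let $\mu=\int_{R^{-1}(0)}u\,\mathrm{d}u$. The compensating system has the transition operator $\widetilde{T}=\widetilde{R}\circ L^{-1}:\mathbb{Z}^n\to\mathbb{Z}^n$, where $\widetilde{R}(u)=R(u+(I_n+L^{-1})\mu)$ is a quantizer with $\widetilde{R}^{-1}(0)=R^{-1}(0)-(I_n+L^{-1})\mu$. Its quantization errors are $\widetilde{E}_k=\widetilde{E}\circ\widetilde{T}^{k-1}:\mathbb{Z}^n\to\widetilde{R}^{-1}(0)$, $k\in\mathbb{N}$, where $\widetilde{E}(x)=L^{-1}x-\widetilde{T}(x)$. For a class $\mathcal{C}$ of subsets of $\mathbb{Z}^n$, $\widetilde{T}^{-j}(\mathcal{C})$ is the class of preimages of elements of $\mathcal{C}$ under the $j$-th iterate of $\widetilde{T}$. Algebras. For $m\in\mathbb{N}$, $G\subset\mathbb{R}^m$ and $\Lambda\in\mathbb{R}^{m\times n}$ let $Q_m(G,\Lambda)=\{x\in\mathbb{Z}^n:\ \Lambda x\in G+\mathbb{Z}^m\}$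 and $\mathcal{Q}_m(\Lambda)=\{Q_m(G,\Lambda):\ G\subset[0,1)^m\text{ Jordan measurable}\}$. For $N\in\mathbb{N}$, $\mathcal{Q}_N^-=\mathcal{Q}_{Nn}(\mathcal{L}_N^-)$, where $\mathcal{L}_N^-\in\mathbb{R}^{Nn\times n}$ is obtained by stacking $L^{-N},\ldots,L^{-1}$; the backward algebra is $\mathcal{Q}^-=\bigcup_{N\ge1}\mathcal{Q}_N^-$. Nonresonance. $\Lambda\in\mathbb{R}^{m\times n}$ is nonresonant if the rows of $\begin{bmatrix}I_n\\ \Lambda\end{bmatrix}$ are linearly independent over the rationals. A nonsingular $L$ is iteratively nonresonant if every finite submatrix (formed from finitely many rows with distinct indices) of the infinite matrix obtained by stacking all nonzero integer powers $L^k$, $k\in\mathbb{Z}\setminus\{0\}$, is nonresonant. *)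

theory Defs
  imports "HOL-Analysis.Analysis" "HOL-Probability.Probability_Measure"
begin

section \<open>Frequency of subsets of the integer lattice\<close>

definition box_Z :: "int^'n \<Rightarrow> nat^'n \<Rightarrow> (int^'n) set" where
  "box_Z a l = {x. \<forall>k. a $ k \<le> x $ k \<and> x $ k < a $ k + int (l $ k)}"

definition boxes_Z :: "nat \<Rightarrow> (int^'n) set set" where
  "boxes_Z N = {box_Z a l | a l. \<forall>k. N \<le> l $ k}"

definition lower_freq :: "(int^'n) set \<Rightarrow> real" where
  "lower_freq A = (SUP N\<in>{1..}. INF P\<in>boxes_Z N. real (card (A \<inter> P)) / real (card P))"

definition upper_freq :: "(int^'n) set \<Rightarrow> real" where
  "upper_freq A = (INF N\<in>{1..}. SUP P\<in>boxes_Z N. real (card (A \<inter> P)) / real (card P))"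

definition freq_measurable :: "(int^'n) set \<Rightarrow> bool" where
  "freq_measurable A \<longleftrightarrow> lower_freq A = upper_freq A"

text \<open>Only meaningful on frequency measurable sets, where it is the common value of the lower and
  the upper frequency.\<close>

definition freq :: "(int^'n) set \<Rightarrow> real" where
  "freq A = lower_freq A"

text \<open>The sequence of algebras is indexed from 1; its value at 0 is irrelevant.\<close>

definition mutually_independent :: "(nat \<Rightarrow> (int^'n) set set) \<Rightarrow> bool" where
  "mutually_independent S \<longleftrightarrow>
     (\<forall>k\<ge>1. algebra UNIV (S k) \<and> (\<forall>A\<in>S k. freq_measurable A)) \<and>
     (\<forall>N\<ge>1. \<forall>A. (\<forall>k\<in>{1..N}. A k \<in> S k) \<longrightarrow>
        freq_measurable (\<Inter>k\<in>{1..N}. A k) \<and>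
        freq (\<Inter>k\<in>{1..N}. A k) = (\<Prod>k=1..N. freq (A k)))"

section \<open>Distributed maps\<close>

text \<open>The metric of the target space enters only through the Borel sets and the boundaries, so the
  target is given as a metrizable topology on an explicit carrier. This is needed because the
  carriers below are sets of vectors whose dimension varies; boundaries are relative to the
  carrier.\<close>

definition borel_sets_of :: "'a topology \<Rightarrow> 'a set set" where
  "borel_sets_of X = sigma_sets (topspace X) {U. openin X U}"

definition distributed_map :: "'a topology \<Rightarrow> 'a measure \<Rightarrow> (int^'n \<Rightarrow> 'a) \<Rightarrow> bool" where
  "distributed_map X D h \<longleftrightarrow>
     metrizable_space X \<and>
     prob_space D \<and> space D = topspace X \<and> sets D = borel_sets_of X \<and>
     range h \<subseteq> topspace X \<and>
     (\<forall>B\<in>borel_sets_of X. measure D (X frontier_of B) = 0 \<longrightarrow>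
        freq_measurable (h -` B) \<and> freq (h -` B) = measure D B)"

definition generated_algebra :: "'a topology \<Rightarrow> 'a measure \<Rightarrow> (int^'n \<Rightarrow> 'a) \<Rightarrow> (int^'n) set set" where
  "generated_algebra X D h = {h -` B | B. B \<in> borel_sets_of X \<and> measure D (X frontier_of B) = 0}"

text \<open>The set function of \<open>M\<close> on the Borel sets of \<open>X\<close>. The carrier of \<open>X\<close> itself need not be
  Borel in the ambient space (Jordan measurable sets need not be), so \<open>M\<close> is always a completed
  Lebesgue measure below.\<close>

definition borel_restriction :: "'a topology \<Rightarrow> 'a measure \<Rightarrow> 'a measure" where
  "borel_restriction X M = measure_of (topspace X) (borel_sets_of X) (emeasure M)"

section \<open>Real vectors over a finite index set\<close>

text \<open>Spaces whose dimension varies are represented by the extensional functions on a finite index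
  set \<open>I\<close>, with the product topology and Lebesgue measure.\<close>

definition vec_space :: "'i set \<Rightarrow> ('i \<Rightarrow> real) topology" where
  "vec_space I = product_topology (\<lambda>_. euclideanreal) I"

definition mes :: "'i set \<Rightarrow> ('i \<Rightarrow> real) measure" where
  "mes I = completion (PiM I (\<lambda>_. lborel))"

definition jordan_measurable_on :: "'i set \<Rightarrow> ('i \<Rightarrow> real) set \<Rightarrow> bool" where
  "jordan_measurable_on I G \<longleftrightarrow>
     G \<subseteq> topspace (vec_space I) \<and>
     (\<exists>r. \<forall>g\<in>G. \<forall>i\<in>I. \<bar>g i\<bar> \<le> r) \<and>
     vec_space I frontier_of G \<in> null_sets (mes I)"

definition jordan_measurable :: "'a::euclidean_space set \<Rightarrow> bool" where
  "jordan_measurable G \<longleftrightarrow> bounded G \<and> frontier G \<in> null_sets lebesgue"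

section \<open>Quantizers and the compensating system\<close>

definition real_vec :: "int^'n \<Rightarrow> real^'n" where
  "real_vec z = (\<chi> i. real_of_int (z $ i))"

definition quantizer :: "(real^'n \<Rightarrow> int^'n) \<Rightarrow> bool" where
  "quantizer R \<longleftrightarrow> (\<forall>u z. R (u + real_vec z) = R u + z) \<and> jordan_measurable (R -` {0})"

definition cell_mean :: "(real^'n \<Rightarrow> int^'n) \<Rightarrow> real^'n" where
  "cell_mean R = integral (R -` {0}) (\<lambda>u. u)"

definition comp_quantizer :: "(real^'n \<Rightarrow> int^'n) \<Rightarrow> real^'n^'n \<Rightarrow> real^'n \<Rightarrow> int^'n" where
  "comp_quantizer R L u = R (u + (mat 1 + matrix_inv L) *v cell_mean R)"

definition comp_cell :: "(real^'n \<Rightarrow> int^'n) \<Rightarrow> real^'n^'n \<Rightarrow> (real^'n) set" where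
  "comp_cell R L = comp_quantizer R L -` {0}"

definition comp_trans :: "(real^'n \<Rightarrow> int^'n) \<Rightarrow> real^'n^'n \<Rightarrow> int^'n \<Rightarrow> int^'n" where
  "comp_trans R L x = comp_quantizer R L (matrix_inv L *v real_vec x)"

definition comp_err1 :: "(real^'n \<Rightarrow> int^'n) \<Rightarrow> real^'n^'n \<Rightarrow> int^'n \<Rightarrow> real^'n" where
  "comp_err1 R L x = matrix_inv L *v real_vec x - real_vec (comp_trans R L x)"

text \<open>The \<open>k\<close>-th quantization error, for \<open>k \<ge> 1\<close>.\<close>

definition comp_err :: "(real^'n \<Rightarrow> int^'n) \<Rightarrow> real^'n^'n \<Rightarrow> nat \<Rightarrow> int^'n \<Rightarrow> real^'n" where
  "comp_err R L k = comp_err1 R L \<circ> (comp_trans R L ^^ (k - 1))"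

text \<open>Stacked vectors of \<open>N\<close> blocks of size \<open>n\<close>: the index \<open>(k, i)\<close> is the \<open>i\<close>-th entry of the
  \<open>k\<close>-th block.\<close>

definition stack_index :: "nat \<Rightarrow> (nat \<times> 'n) set" where
  "stack_index N = {1..N} \<times> UNIV"

definition comp_err_stack ::
    "(real^'n \<Rightarrow> int^'n) \<Rightarrow> real^'n^'n \<Rightarrow> nat \<Rightarrow> int^'n \<Rightarrow> nat \<times> 'n \<Rightarrow> real" where
  "comp_err_stack R L N x = (\<lambda>(k, i)\<in>stack_index N. comp_err R L k x $ i)"

definition set_power :: "(real^'n) set \<Rightarrow> nat \<Rightarrow> (nat \<times> 'n \<Rightarrow> real) set" where
  "set_power C N =
     {v \<in> topspace (vec_space (stack_index N)). \<forall>k\<in>{1..N}. (\<chi> i. v (k, i)) \<in> C}"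

definition cell_top :: "(real^'n) set \<Rightarrow> (real^'n) topology" where
  "cell_top C = top_of_set C"

definition cell_mes :: "(real^'n) set \<Rightarrow> (real^'n) measure" where
  "cell_mes C = borel_restriction (cell_top C) lebesgue"

definition cell_power_top :: "(real^'n) set \<Rightarrow> nat \<Rightarrow> (nat \<times> 'n \<Rightarrow> real) topology" where
  "cell_power_top C N = subtopology (vec_space (stack_index N)) (set_power C N)"

definition cell_power_mes :: "(real^'n) set \<Rightarrow> nat \<Rightarrow> (nat \<times> 'n \<Rightarrow> real) measure" where
  "cell_power_mes C N = borel_restriction (cell_power_top C N) (mes (stack_index N))"

definition err_algebra :: "(real^'n \<Rightarrow> int^'n) \<Rightarrow> real^'n^'n \<Rightarrow> nat \<Rightarrow> (int^'n) set set" where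
  "err_algebra R L k =
     generated_algebra (cell_top (comp_cell R L)) (cell_mes (comp_cell R L)) (comp_err R L k)"

definition err_stack_algebra :: "(real^'n \<Rightarrow> int^'n) \<Rightarrow> real^'n^'n \<Rightarrow> nat \<Rightarrow> (int^'n) set set" where
  "err_stack_algebra R L N =
     generated_algebra (cell_power_top (comp_cell R L) N) (cell_power_mes (comp_cell R L) N)
       (comp_err_stack R L N)"

section \<open>Quasiperiodic sets and the backward algebra\<close>

text \<open>A real matrix with \<open>n\<close> columns is given by its family of rows over a finite index set.\<close>

definition Q_set :: "'i set \<Rightarrow> ('i \<Rightarrow> real) set \<Rightarrow> ('i \<Rightarrow> real^'n) \<Rightarrow> (int^'n) set" where
  "Q_set I G \<Lambda> =
     {x. \<exists>g\<in>G. \<exists>z :: 'i \<Rightarrow> int. \<forall>i\<in>I. \<Lambda> i \<bullet> real_vec x = g i + real_of_int (z i)}"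

definition Q_class :: "'i set \<Rightarrow> ('i \<Rightarrow> real^'n) \<Rightarrow> (int^'n) set set" where
  "Q_class I \<Lambda> =
     {Q_set I G \<Lambda> | G. G \<subseteq> (\<Pi>\<^sub>E i\<in>I. {0..<1}) \<and> jordan_measurable_on I G}"

text \<open>Integer powers with respect to the matrix product (the library's \<open>*\<close>, \<open>1\<close> and \<open>^\<close> on
  vectors are componentwise).\<close>

definition matrix_powi :: "real^'n^'n \<Rightarrow> int \<Rightarrow> real^'n^'n" where
  "matrix_powi A k =
     (if 0 \<le> k then ((**) A ^^ nat k) (mat 1) else ((**) (matrix_inv A) ^^ nat (- k)) (mat 1))"

text \<open>The rows of the stack of \<open>L\<close> to the powers \<open>-N, \<dots>, -1\<close>, from top to bottom.\<close>

definition backward_rows :: "real^'n^'n \<Rightarrow> nat \<Rightarrow> nat \<times> 'n \<Rightarrow> real^'n" where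
  "backward_rows L N = (\<lambda>(j, i). row i (matrix_powi L (int j - int N - 1)))"

definition backward_class :: "real^'n^'n \<Rightarrow> nat \<Rightarrow> (int^'n) set set" where
  "backward_class L N = Q_class (stack_index N) (backward_rows L N)"

definition backward_algebra :: "real^'n^'n \<Rightarrow> (int^'n) set set" where
  "backward_algebra L = (\<Union>N\<in>{1..}. backward_class L N)"

definition preimages :: "('a \<Rightarrow> 'a) \<Rightarrow> nat \<Rightarrow> 'a set set \<Rightarrow> 'a set set" where
  "preimages T j C = {(T ^^ j) -` A | A. A \<in> C}"

section \<open>Nonresonance\<close>

text \<open>Linear independence over the rationals of an indexed family: repeated vectors make the family
  dependent.\<close>

definition rat_independent :: "'i set \<Rightarrow> ('i \<Rightarrow> real^'n) \<Rightarrow> bool" where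
  "rat_independent I v \<longleftrightarrow>
     (\<forall>c :: 'i \<Rightarrow> rat. (\<Sum>i\<in>I. of_rat (c i) *\<^sub>R v i) = 0 \<longrightarrow> (\<forall>i\<in>I. c i = 0))"

definition nonresonant :: "'i set \<Rightarrow> ('i \<Rightarrow> real^'n) \<Rightarrow> bool" where
  "nonresonant I \<Lambda> \<longleftrightarrow>
     rat_independent ((UNIV :: 'n set) <+> I) (case_sum (\<lambda>i. row i (mat 1)) \<Lambda>)"

definition iteratively_nonresonant :: "real^'n^'n \<Rightarrow> bool" where
  "iteratively_nonresonant L \<longleftrightarrow>
     (\<forall>J \<subseteq> (- {0}) \<times> (UNIV :: 'n set). finite J \<longrightarrow>
        nonresonant J (\<lambda>(k, i). row i (matrix_powi L k)))"

end

theory Submission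
  imports Defs
begin

text \<open>Write \<open>L\<^sup>-\<^sup>1, \<dots>, L\<^sup>-\<^sup>N\<close> of a lattice point \<open>x\<close> as a point of a torus of dimension \<open>N n\<close>. By
  nonresonance and Weyl's criterion these points equidistribute, uniformly over large boxes, so the
  number of integer translates of the point lying in a Jordan measurable set has mean equal to the
  volume of the set. Since \<open>E\<^sub>k = L\<^sup>-\<^sup>1 T\<^sup>k\<^sup>-\<^sup>1 x - T\<^sup>k x\<close>, putting \<open>u\<^sub>k = L\<^sup>-\<^sup>k x - T\<^sup>k x\<close> gives
  \<open>E\<^sub>k = u\<^sub>k - L\<^sup>-\<^sup>1 u\<^sub>k\<^sub>-\<^sub>1\<close>: the error vector is a unimodular triangular image of the torus point,
  translated by the only integer vector that brings the image into the product of the cells. Hence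
  error events correspond to Jordan measurable subsets of the torus of the same volume.\<close>

text \<open>The triangular map is unimodular but not integral, so it does not descend to the torus.
  The argument therefore stays in Euclidean space and works with \<open>lattice_count\<close>, a
  periodised indicator that needs no fundamental domain. Only upper bounds for means are obtained by
  approximation: they are monotone and subadditive, so covers by small cubes suffice. Lower bounds
  follow by complementation, since the count for a half-open cube with integer corners is constant.
  That the cell has volume 1 comes out of the same machinery: exactly one translate decodes into the
  product of cells, so the count is constantly 1 and its mean must be the volume. A set with null
  boundary need not be Borel, hence the completed measures and the notion
  \<open>continuity_set\<close>; the passage back to Borel sets uses that a map on the lattice has
  countable range.\<close>

lemma box_Z_image:
  "box_Z a l = vec_lambda ` (\<Pi>\<^sub>E k\<in>UNIV. {a $ k..<a $ k + int (l $ k)})"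
proof -
  have "x \<in> vec_lambda ` (\<Pi>\<^sub>E k\<in>UNIV. {a $ k..<a $ k + int (l $ k)})" if "x \<in> box_Z a l" for x
    by (rule image_eqI[of _ _ "vec_nth x"]) (use that in \<open>auto simp: box_Z_def\<close>)
  thus ?thesis by (auto simp: box_Z_def)
qed

lemma finite_box_Z [simp]: "finite (box_Z a l)"
  unfolding box_Z_image by (intro finite_imageI finite_PiE) auto

text \<open>Distributivity over the product structure of a box. It factors character sums into
  one-dimensional geometric sums, and with all factors equal to 1 it yields
  \<open>card_box_Z\<close>.\<close>

lemma sum_box_Z_prod:
  fixes g :: "'n::finite \<Rightarrow> int \<Rightarrow> 'a::comm_semiring_1"
  shows "(\<Sum>x\<in>box_Z a l. \<Prod>k\<in>UNIV. g k (x $ k))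
       = (\<Prod>k\<in>UNIV. \<Sum>t\<in>{a $ k..<a $ k + int (l $ k)}. g k t)"
proof -
  have inj: "inj_on vec_lambda S" for S :: "('n \<Rightarrow> int) set"
    by (auto simp: inj_on_def vec_eq_iff)
  show ?thesis
    unfolding box_Z_image
    by (subst sum.reindex[OF inj], subst prod_sum_PiE) simp_all
qed

lemma card_box_Z: "card (box_Z a l) = (\<Prod>k\<in>UNIV. l $ k)"
  using sum_box_Z_prod[of "\<lambda>_ _. 1 :: nat" a l] by simp

lemma boxes_Z_antimono: "M \<le> N \<Longrightarrow> boxes_Z N \<subseteq> boxes_Z M"
  unfolding boxes_Z_def by (force intro: order_trans)

lemma boxes_Z_nonempty: "boxes_Z N \<noteq> {}"
proof -
  have "box_Z (\<chi> k. 0) (\<chi> k. N) \<in> boxes_Z N" unfolding boxes_Z_def by force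
  thus ?thesis by auto
qed

lemma boxes_Z_card_pos:
  assumes "P \<in> boxes_Z N" "N \<ge> 1"
  shows "card P > 0"
proof -
  obtain a l where P: "P = box_Z a l" "\<And>k. N \<le> l $ k"
    using assms(1) unfolding boxes_Z_def by blast
  have "0 < l $ k" for k using P(2)[of k] assms(2) by linarith
  thus ?thesis unfolding P(1) card_box_Z by (intro prod_pos) auto
qed

lemma boxes_Z_finite: "P \<in> boxes_Z N \<Longrightarrow> finite P"
  by (auto simp: boxes_Z_def)

section \<open>Means that are uniform over all large boxes\<close>

text \<open>The threshold \<open>N\<close> is uniform in the position and shape of the box, as in
  \<open>upper_freq\<close>. One-sided bounds survive pointwise domination and finite covers; a
  lower bound for the mean of \<open>f\<close> is expressed as an upper bound for
  \<open>- f\<close>.\<close>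

definition upper_mean_le :: "(int^'n \<Rightarrow> real) \<Rightarrow> real \<Rightarrow> bool" where
  "upper_mean_le f c \<longleftrightarrow>
     (\<forall>e>0. \<exists>N\<ge>1. \<forall>P\<in>boxes_Z N. (\<Sum>x\<in>P. f x) \<le> (c + e) * real (card P))"

text \<open>The two-sided complex variant: characters cannot be compared by order, but this notion
  is linear, which is all that trigonometric polynomials need.\<close>

definition has_mean :: "(int^'n \<Rightarrow> complex) \<Rightarrow> complex \<Rightarrow> bool" where
  "has_mean f c \<longleftrightarrow>
     (\<forall>e>0. \<exists>N\<ge>1. \<forall>P\<in>boxes_Z N. norm ((\<Sum>x\<in>P. f x) - c * of_nat (card P)) \<le> e * real (card P))"

lemma upper_mean_le_add:
  fixes f g :: "int^'n \<Rightarrow> real"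
  assumes "upper_mean_le f c" "upper_mean_le g d"
  shows "upper_mean_le (\<lambda>x. f x + g x) (c + d)"
  unfolding upper_mean_le_def
proof (intro allI impI)
  fix e :: real assume e: "e > 0"
  obtain M where M: "M \<ge> 1" "\<And>P. P \<in> boxes_Z M \<Longrightarrow> (\<Sum>x\<in>P. f x) \<le> (c + e/2) * real (card P)"
    using assms(1) e unfolding upper_mean_le_def by (metis half_gt_zero)
  obtain N where N: "N \<ge> 1" "\<And>P. P \<in> boxes_Z N \<Longrightarrow> (\<Sum>x\<in>P. g x) \<le> (d + e/2) * real (card P)"
    using assms(2) e unfolding upper_mean_le_def by (metis half_gt_zero)
  show "\<exists>N\<ge>1. \<forall>P\<in>boxes_Z N. (\<Sum>x\<in>P. f x + g x) \<le> (c + d + e) * real (card P)"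
  proof (intro exI[of _ "max M N"] conjI ballI)
    fix P :: "(int^'n) set" assume P: "P \<in> boxes_Z (max M N)"
    hence "P \<in> boxes_Z M" "P \<in> boxes_Z N"
      using boxes_Z_antimono by (meson in_mono max.cobounded1 max.cobounded2)+
    hence "(\<Sum>x\<in>P. f x + g x) \<le> (c + e/2) * real (card P) + (d + e/2) * real (card P)"
      unfolding sum.distrib using M N by (intro add_mono) auto
    thus "(\<Sum>x\<in>P. f x + g x) \<le> (c + d + e) * real (card P)" by (simp add: algebra_simps)
  qed (use M in auto)
qed

lemma upper_mean_le_mono:
  assumes "upper_mean_le f c" "\<And>x. g x \<le> f x" "c \<le> d"
  shows "upper_mean_le g d"
  unfolding upper_mean_le_def
proof (intro allI impI)
  fix e :: real assume "e > 0"
  then obtain M where M: "M \<ge> 1" "\<And>P. P \<in> boxes_Z M \<Longrightarrow> (\<Sum>x\<in>P. f x) \<le> (c + e) * real (card P)"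
    using assms(1) unfolding upper_mean_le_def by metis
  have "(\<Sum>x\<in>P. g x) \<le> (d + e) * real (card P)" if "P \<in> boxes_Z M" for P
  proof -
    have "(\<Sum>x\<in>P. g x) \<le> (\<Sum>x\<in>P. f x)" by (intro sum_mono assms)
    also have "\<dots> \<le> (c + e) * real (card P)" using M that by auto
    also have "\<dots> \<le> (d + e) * real (card P)" using assms by (intro mult_right_mono) auto
    finally show ?thesis .
  qed
  thus "\<exists>N\<ge>1. \<forall>P\<in>boxes_Z N. sum g P \<le> (d + e) * real (card P)" using M(1) by blast
qed

lemma upper_mean_le_const: "c \<le> d \<Longrightarrow> upper_mean_le (\<lambda>_. c) d"
  unfolding upper_mean_le_def
  by (intro allI impI exI[of _ 1] conjI ballI) (auto simp: mult.commute[of "real _"] intro!: mult_right_mono)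

lemma upper_mean_le_sum:
  assumes "finite A" "\<And>a. a \<in> A \<Longrightarrow> upper_mean_le (f a) (c a)"
  shows "upper_mean_le (\<lambda>x. \<Sum>a\<in>A. f a x) (\<Sum>a\<in>A. c a)"
  using assms by (induction) (auto intro: upper_mean_le_const upper_mean_le_add)

lemma upper_mean_le_lim:
  assumes "\<And>e. e > 0 \<Longrightarrow> upper_mean_le f (c + e)"
  shows "upper_mean_le f c"
  unfolding upper_mean_le_def
proof (intro allI impI)
  fix e :: real assume "e > 0"
  hence "upper_mean_le f (c + e/2)" "e/2 > 0" using assms by auto
  hence "\<exists>N\<ge>1. \<forall>P\<in>boxes_Z N. sum f P \<le> (c + e/2 + e/2) * real (card P)"
    unfolding upper_mean_le_def by blast
  thus "\<exists>N\<ge>1. \<forall>P\<in>boxes_Z N. sum f P \<le> (c + e) * real (card P)"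
    unfolding add.assoc field_sum_of_halves .
qed

text \<open>Turns a bound on the mean of a constant into an inequality between numbers;
  \<open>emeasure_power\<close> uses it to find the volume of the cell product.\<close>

lemma upper_mean_le_const_iff:
  "upper_mean_le (\<lambda>_ :: int^'n. c) d \<longleftrightarrow> c \<le> d"
proof
  assume *: "upper_mean_le (\<lambda>_ :: int^'n. c) d"
  show "c \<le> d"
  proof (rule field_le_epsilon)
    fix e :: real assume "e > 0"
    then obtain N where N: "N \<ge> 1" "\<And>P :: (int^'n) set. P \<in> boxes_Z N \<Longrightarrow> (\<Sum>x\<in>P. c) \<le> (d + e) * real (card P)"
      using * unfolding upper_mean_le_def by metis
    obtain P :: "(int^'n) set" where P: "P \<in> boxes_Z N" using boxes_Z_nonempty by blast
    have "real (card P) > 0" using boxes_Z_card_pos[OF P N(1)] by simp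
    moreover have "real (card P) * c \<le> real (card P) * (d + e)" using N(2)[OF P] by (simp add: mult.commute)
    ultimately show "c \<le> d + e" by simp
  qed
qed (rule upper_mean_le_const)

lemma card_ratio_bounds: "0 \<le> real (card (A \<inter> P)) / real (card P) \<and> real (card (A \<inter> P)) / real (card P) \<le> 1"
  if "finite P"
proof -
  have "card (A \<inter> P) \<le> card P" using that by (intro card_mono) auto
  thus ?thesis by (auto simp: divide_le_eq_1)
qed

text \<open>Dividing the two bounds by the positive cardinality of a box puts the upper frequency at
  or below \<open>c\<close> and the lower one at or above \<open>c\<close>; the general inequality
  between lower and upper frequency then forces equality.\<close>

lemma freq_eqI:
  fixes A :: "(int^'n) set"
  assumes up: "upper_mean_le (indicator A) c" and lo: "upper_mean_le (\<lambda>x. - indicator A x) (- c)"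
  shows "freq_measurable A \<and> freq A = c"
proof -
  define r where "r P = real (card (A \<inter> P)) / real (card P)" for P :: "(int^'n) set"
  have r: "0 \<le> r P" "r P \<le> 1" if "P \<in> boxes_Z N" for P N
    using card_ratio_bounds[OF boxes_Z_finite[OF that]] by (auto simp: r_def)
  have bdd: "bdd_above (r ` boxes_Z N)" "bdd_below (r ` boxes_Z N)" for N
    unfolding bdd_above_def bdd_below_def using r by blast+
  define s i where "s N = (SUP P\<in>boxes_Z N. r P)" and "i N = (INF P\<in>boxes_Z N. r P)" for N
  \<comment> \<open>A box with sides at least \<open>max M N\<close> lies in both families, so every
    infimum is below every supremum. This also bounds the families \<open>i\<close> and
    \<open>s\<close>, as the outer \<open>SUP\<close> and \<open>INF\<close> over the reals
    require.\<close>
  have ils: "i M \<le> s N" for M N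
  proof -
    obtain P :: "(int^'n) set" where P: "P \<in> boxes_Z (max M N)" using boxes_Z_nonempty by blast
    hence "P \<in> boxes_Z M" "P \<in> boxes_Z N"
      using boxes_Z_antimono by (meson in_mono max.cobounded1 max.cobounded2)+
    hence "i M \<le> r P" "r P \<le> s N" unfolding i_def s_def
      using bdd by (auto intro: cINF_lower cSUP_upper)
    thus ?thesis by simp
  qed
  have low: "lower_freq A = (SUP N\<in>{1..}. i N)" and upp: "upper_freq A = (INF N\<in>{1..}. s N)"
    unfolding lower_freq_def upper_freq_def i_def s_def r_def by simp_all
  have bi: "bdd_above (i ` {1..})" and bs: "bdd_below (s ` {1..})"
    unfolding bdd_above_def bdd_below_def using ils by blast+
  have sum_ind: "(\<Sum>x\<in>P. indicator A x :: real) = r P * real (card P)" if "P \<in> boxes_Z N" "N \<ge> 1" for P N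
    using boxes_Z_finite[OF that(1)] boxes_Z_card_pos[OF that]
    by (simp add: r_def indicator_def sum.If_cases Int_commute)
  have 1: "upper_freq A \<le> c"
  proof (rule field_le_epsilon)
    fix e :: real assume "e > 0"
    then obtain N where N: "N \<ge> 1" "\<And>P. P \<in> boxes_Z N \<Longrightarrow> (\<Sum>x\<in>P. indicator A x) \<le> (c + e) * real (card P)"
      using up unfolding upper_mean_le_def by metis
    have "s N \<le> c + e" unfolding s_def
    proof (rule cSUP_least[OF boxes_Z_nonempty])
      fix P :: "(int^'n) set" assume P: "P \<in> boxes_Z N"
      show "r P \<le> c + e"
        using N(2)[OF P] sum_ind[OF P N(1)] boxes_Z_card_pos[OF P N(1)] by simp
    qed
    moreover have "upper_freq A \<le> s N" unfolding upp using bs N by (intro cINF_lower) auto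
    ultimately show "upper_freq A \<le> c + e" by simp
  qed
  have 2: "c \<le> lower_freq A"
  proof (rule field_le_epsilon)
    fix e :: real assume "e > 0"
    then obtain N where N: "N \<ge> 1" "\<And>P. P \<in> boxes_Z N \<Longrightarrow> (\<Sum>x\<in>P. - indicator A x) \<le> (- c + e) * real (card P)"
      using lo unfolding upper_mean_le_def by metis
    have "c - e \<le> i N" unfolding i_def
    proof (rule cINF_greatest[OF boxes_Z_nonempty])
      fix P :: "(int^'n) set" assume P: "P \<in> boxes_Z N"
      have "- (r P * real (card P)) \<le> (- c + e) * real (card P)"
        using N(2)[OF P] sum_ind[OF P N(1)] by (simp add: sum_negf)
      hence "(c - e) * real (card P) \<le> r P * real (card P)" by (simp add: algebra_simps)
      thus "c - e \<le> r P" using boxes_Z_card_pos[OF P N(1)] by simp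
    qed
    moreover have "i N \<le> lower_freq A" unfolding low using bi N by (intro cSUP_upper) auto
    ultimately show "c \<le> lower_freq A + e" by simp
  qed
  have 3: "lower_freq A \<le> upper_freq A"
    unfolding low upp using ils by (intro cSUP_least cINF_greatest) auto
  show ?thesis using 1 2 3 unfolding freq_measurable_def freq_def by linarith
qed

section \<open>Weyl sums over boxes\<close>

lemma cis_2pi_eq_1: "cis (2 * pi * t) = 1 \<longleftrightarrow> t \<in> \<int>"
proof
  assume "cis (2 * pi * t) = 1"
  hence "cos (2 * pi * t) = 1" by (metis cis.simps(1) one_complex.simps(1))
  then obtain k :: int where "2 * pi * t = of_int k * (2 * pi)"
    using cos_one_2pi_int by (auto simp: mult_ac)
  hence "t = of_int k" by simp
  thus "t \<in> \<int>" by simp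
next
  assume "t \<in> \<int>"
  then obtain k :: int where "t = of_int k" by (auto elim: Ints_cases)
  thus "cis (2 * pi * t) = 1" by (simp add: cis_multiple_2pi)
qed

text \<open>Multiplication by \<open>cis (2 * pi * t) - 1\<close> telescopes the sum. The bound
  depends on neither \<open>a\<close> nor \<open>l\<close>; this is the source of uniformity over
  boxes.\<close>

lemma geometric_cis_bound:
  assumes "t \<notin> \<int>"
  shows "norm (\<Sum>k\<in>{a..<a + int l}. cis (2 * pi * (t * of_int k))) \<le> 2 / norm (cis (2 * pi * t) - 1)"
proof -
  let ?w = "cis (2 * pi * t)"
  have w: "?w \<noteq> 1" using assms cis_2pi_eq_1 by blast
  have "(?w - 1) * (\<Sum>k\<in>{a..<a + int l}. cis (2 * pi * (t * of_int k)))
      = cis (2 * pi * (t * of_int (a + int l))) - cis (2 * pi * (t * of_int a))"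
  proof (induction l)
    case (Suc l)
    have "{a..<a + int (Suc l)} = insert (a + int l) {a..<a + int l}" by auto
    thus ?case using Suc by (simp add: algebra_simps cis_mult flip: cis_mult)
  qed simp
  hence "norm (?w - 1) * norm (\<Sum>k\<in>{a..<a + int l}. cis (2 * pi * (t * of_int k)))
      = norm (cis (2 * pi * (t * of_int (a + int l))) - cis (2 * pi * (t * of_int a)))"
    by (metis norm_mult)
  also have "\<dots> \<le> 2"
    by (rule order_trans[OF norm_triangle_ineq4]) simp
  finally show ?thesis using w by (simp add: pos_le_divide_eq mult.commute)
qed

lemma cis_sum: "finite A \<Longrightarrow> cis (\<Sum>i\<in>A. f i) = (\<Prod>i\<in>A. cis (f i))"
  by (induction rule: finite_induct) (simp_all flip: cis_mult)

text \<open>One non-integral coordinate is enough: its geometric sum stays below \<open>C\<close>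
  while the box has side at least \<open>N\<close> in that direction; the other factors are bounded
  trivially by their lengths.\<close>

lemma has_mean_character:
  fixes \<theta> :: "real^'n"
  assumes "\<theta> $ j \<notin> \<int>"
  shows "has_mean (\<lambda>x. cis (2 * pi * (\<theta> \<bullet> real_vec x))) 0"
  unfolding has_mean_def
proof (intro allI impI)
  fix e :: real assume e: "e > 0"
  define C where "C = 2 / norm (cis (2 * pi * \<theta> $ j) - 1)"
  obtain N :: nat where N: "C / e < real N" using reals_Archimedean2 by blast
  have C: "C \<ge> 0" unfolding C_def by simp
  have N1: "C \<le> e * real N" using N e by (simp add: field_simps)
  have N0: "N \<ge> 1" using N e C by (cases N) (auto simp: divide_less_eq)
  have "norm (\<Sum>x\<in>P. cis (2 * pi * (\<theta> \<bullet> real_vec x))) \<le> e * real (card P)"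
    if PN: "P \<in> boxes_Z N" for P
  proof -
    obtain a l where P: "P = box_Z a l" and l: "\<And>k. N \<le> l $ k"
      using PN unfolding boxes_Z_def by blast
    have *: "cis (2 * pi * (\<theta> \<bullet> real_vec x)) = (\<Prod>k\<in>UNIV. cis (2 * pi * (\<theta> $ k * of_int (x $ k))))" for x
      by (simp add: inner_vec_def real_vec_def sum_distrib_left flip: cis_sum)
    have "(\<Sum>x\<in>P. cis (2 * pi * (\<theta> \<bullet> real_vec x)))
        = (\<Prod>k\<in>UNIV. \<Sum>t\<in>{a $ k..<a $ k + int (l $ k)}. cis (2 * pi * (\<theta> $ k * of_int t)))"
      unfolding * P by (rule sum_box_Z_prod)
    hence "norm (\<Sum>x\<in>P. cis (2 * pi * (\<theta> \<bullet> real_vec x)))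
        = (\<Prod>k\<in>UNIV. norm (\<Sum>t\<in>{a $ k..<a $ k + int (l $ k)}. cis (2 * pi * (\<theta> $ k * of_int t))))"
      by (simp add: prod_norm)
    also have "\<dots> \<le> (\<Prod>k\<in>UNIV. if k = j then C else real (l $ k))"
    proof (rule prod_mono, safe)
      fix k
      have "norm (\<Sum>t\<in>{a $ k..<a $ k + int (l $ k)}. cis (2 * pi * (\<theta> $ k * of_int t))) \<le> real (l $ k)"
        by (rule order_trans[OF norm_sum]) simp
      thus "norm (\<Sum>t\<in>{a $ k..<a $ k + int (l $ k)}. cis (2 * pi * (\<theta> $ k * of_int t)))
              \<le> (if k = j then C else real (l $ k))"
        using geometric_cis_bound[OF assms] unfolding C_def by auto
    qed auto
    also have "\<dots> = C * (\<Prod>k\<in>UNIV - {j}. real (l $ k))"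
      by (subst prod.remove[of _ j]) (auto intro!: prod.cong)
    also have "\<dots> \<le> (e * real (l $ j)) * (\<Prod>k\<in>UNIV - {j}. real (l $ k))"
    proof (rule mult_right_mono)
      show "C \<le> e * real (l $ j)"
        using N1 l[of j] e by (meson mult_left_mono of_nat_le_iff order_trans less_imp_le)
    qed (auto intro!: prod_nonneg)
    also have "\<dots> = e * real (card P)"
      unfolding P card_box_Z of_nat_prod by (subst prod.remove[of UNIV j]) auto
    finally show ?thesis .
  qed
  thus "\<exists>N\<ge>1. \<forall>P\<in>boxes_Z N. norm ((\<Sum>x\<in>P. cis (2 * pi * (\<theta> \<bullet> real_vec x))) - 0 * of_nat (card P))
          \<le> e * real (card P)"
    using N0 by auto
qed

lemma has_mean_const: "has_mean (\<lambda>_. c) c"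
  unfolding has_mean_def by (auto intro!: exI[of _ 1])

lemma has_mean_add:
  fixes f g :: "int^'n \<Rightarrow> complex"
  assumes "has_mean f c" "has_mean g d"
  shows "has_mean (\<lambda>x. f x + g x) (c + d)"
  unfolding has_mean_def
proof (intro allI impI)
  fix e :: real assume e: "e > 0"
  obtain M where M: "M \<ge> 1" "\<And>P. P \<in> boxes_Z M \<Longrightarrow> norm ((\<Sum>x\<in>P. f x) - c * of_nat (card P)) \<le> e/2 * real (card P)"
    using assms(1) e unfolding has_mean_def by (metis half_gt_zero)
  obtain N where N: "N \<ge> 1" "\<And>P. P \<in> boxes_Z N \<Longrightarrow> norm ((\<Sum>x\<in>P. g x) - d * of_nat (card P)) \<le> e/2 * real (card P)"
    using assms(2) e unfolding has_mean_def by (metis half_gt_zero)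
  show "\<exists>N\<ge>1. \<forall>P\<in>boxes_Z N. norm ((\<Sum>x\<in>P. f x + g x) - (c + d) * of_nat (card P)) \<le> e * real (card P)"
  proof (intro exI[of _ "max M N"] conjI ballI)
    fix P :: "(int^'n) set" assume P: "P \<in> boxes_Z (max M N)"
    hence "P \<in> boxes_Z M" "P \<in> boxes_Z N"
      using boxes_Z_antimono by (meson in_mono max.cobounded1 max.cobounded2)+
    hence "norm (((\<Sum>x\<in>P. f x) - c * of_nat (card P)) + ((\<Sum>x\<in>P. g x) - d * of_nat (card P)))
        \<le> e/2 * real (card P) + e/2 * real (card P)"
      using M N by (intro norm_triangle_mono) auto
    thus "norm ((\<Sum>x\<in>P. f x + g x) - (c + d) * of_nat (card P)) \<le> e * real (card P)"
      by (simp add: algebra_simps sum.distrib)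
  qed (use M in auto)
qed

lemma has_mean_cmult:
  assumes "has_mean f c"
  shows "has_mean (\<lambda>x. a * f x) (a * c)"
  unfolding has_mean_def
proof (intro allI impI)
  fix e :: real assume e: "e > 0"
  \<comment> \<open>The summand 1 covers the case \<open>a = 0\<close>.\<close>
  hence "e / (norm a + 1) > 0" by (simp add: add_nonneg_pos)
  then obtain M where M: "M \<ge> 1"
      "\<And>P. P \<in> boxes_Z M \<Longrightarrow> norm ((\<Sum>x\<in>P. f x) - c * of_nat (card P)) \<le> e / (norm a + 1) * real (card P)"
    using assms e unfolding has_mean_def by metis
  have "norm ((\<Sum>x\<in>P. a * f x) - a * c * of_nat (card P)) \<le> e * real (card P)" if "P \<in> boxes_Z M" for P
  proof -
    have "(\<Sum>x\<in>P. a * f x) - a * c * of_nat (card P) = a * ((\<Sum>x\<in>P. f x) - c * of_nat (card P))"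
      by (simp add: algebra_simps sum_distrib_left)
    hence "norm ((\<Sum>x\<in>P. a * f x) - a * c * of_nat (card P)) = norm a * norm ((\<Sum>x\<in>P. f x) - c * of_nat (card P))"
      by (simp add: norm_mult)
    also have "\<dots> \<le> (norm a + 1) * (e / (norm a + 1) * real (card P))"
      using M(2)[OF that] by (intro mult_mono) auto
    also have "\<dots> = e * real (card P)" by (simp add: add_nonneg_eq_0_iff)
    finally show ?thesis .
  qed
  thus "\<exists>N\<ge>1. \<forall>P\<in>boxes_Z N. norm ((\<Sum>x\<in>P. a * f x) - a * c * of_nat (card P)) \<le> e * real (card P)"
    using M(1) by blast
qed

lemma has_mean_imp_upper_mean_le:
  assumes "has_mean (\<lambda>x. of_real (f x)) (of_real c)"
  shows "upper_mean_le f c"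
  unfolding upper_mean_le_def
proof (intro allI impI)
  fix e :: real assume e: "e > 0"
  obtain M where M: "M \<ge> 1" "\<And>P. P \<in> boxes_Z M \<Longrightarrow>
      norm ((\<Sum>x\<in>P. of_real (f x)) - of_real c * of_nat (card P) :: complex) \<le> e * real (card P)"
    using assms e unfolding has_mean_def by metis
  have "sum f P \<le> (c + e) * real (card P)" if "P \<in> boxes_Z M" for P
  proof -
    have "(\<Sum>x\<in>P. of_real (f x)) - of_real c * of_nat (card P) = (of_real (sum f P - c * real (card P)) :: complex)"
      by simp
    hence "\<bar>sum f P - c * real (card P)\<bar> \<le> e * real (card P)"
      using M(2)[OF that] by (metis norm_of_real)
    thus ?thesis by (simp add: algebra_simps)
  qed
  thus "\<exists>N\<ge>1. \<forall>P\<in>boxes_Z N. sum f P \<le> (c + e) * real (card P)" using M(1) by blast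
qed

section \<open>Trigonometric polynomials\<close>

text \<open>The last argument is the mean over the torus, that is the coefficient of the trivial
  character. Carrying it in the relation lets it be computed alongside the function, without
  integrals in several variables.\<close>

inductive trig_poly :: "'i set \<Rightarrow> (('i \<Rightarrow> real) \<Rightarrow> complex) \<Rightarrow> complex \<Rightarrow> bool" for I where
  character: "trig_poly I (\<lambda>y. a * cis (2 * pi * (\<Sum>i\<in>I. of_int (m i) * y i)))
                (if \<forall>i\<in>I. m i = 0 then a else 0)"
| add: "trig_poly I f c \<Longrightarrow> trig_poly I g d \<Longrightarrow> trig_poly I (\<lambda>y. f y + g y) (c + d)"

text \<open>If all entries were integers \<open>k j\<close>, the coefficients \<open>- k j\<close>
  on the rows of the identity and \<open>m i\<close> on the rows of \<open>\<Lambda>\<close> would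
  form a nontrivial rational relation.\<close>

lemma nonresonant_character:
  fixes \<Lambda> :: "'i \<Rightarrow> real^'n" and m :: "'i \<Rightarrow> int"
  assumes I: "finite I" and nr: "nonresonant I \<Lambda>" and i: "i \<in> I" "m i \<noteq> 0"
  shows "\<exists>j. (\<Sum>i\<in>I. of_int (m i) *\<^sub>R \<Lambda> i) $ j \<notin> \<int>"
proof (rule ccontr)
  assume "\<not> ?thesis"
  hence "\<forall>j. \<exists>k :: int. (\<Sum>i\<in>I. of_int (m i) *\<^sub>R \<Lambda> i) $ j = of_int k"
    by (metis Ints_cases)
  then obtain k :: "'n \<Rightarrow> int" where k: "\<And>j. (\<Sum>i\<in>I. of_int (m i) *\<^sub>R \<Lambda> i) $ j = of_int (k j)"
    by metis
  define c :: "'n + 'i \<Rightarrow> rat" where "c = case_sum (\<lambda>j. - of_int (k j)) (\<lambda>i. of_int (m i))"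
  have fin: "finite (UNIV :: 'n set)" by simp
  have "(\<Sum>s\<in>UNIV <+> I. of_rat (c s) *\<^sub>R case_sum (\<lambda>i. row i (mat 1)) \<Lambda> s)
      = (\<Sum>j\<in>UNIV. of_rat (c (Inl j)) *\<^sub>R row j (mat 1)) + (\<Sum>i\<in>I. of_rat (c (Inr i)) *\<^sub>R \<Lambda> i)"
    by (subst sum.Plus[OF fin I]) simp
  also have "\<dots> = 0"
    unfolding vec_eq_iff
  proof
    fix l
    have "(\<Sum>j\<in>UNIV. of_rat (c (Inl j)) *\<^sub>R row j (mat 1 :: real^'n^'n)) $ l
        = (\<Sum>j\<in>UNIV. if j = l then - real_of_int (k l) else 0)"
      unfolding sum_component
      by (rule sum.cong) (auto simp: c_def row_def mat_def of_rat_minus)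
    also have "\<dots> = - of_int (k l)" by simp
    finally show "((\<Sum>j\<in>UNIV. of_rat (c (Inl j)) *\<^sub>R row j (mat 1 :: real^'n^'n))
        + (\<Sum>i\<in>I. of_rat (c (Inr i)) *\<^sub>R \<Lambda> i)) $ l = 0 $ l"
      using k[of l] by (simp add: c_def)
  qed
  finally have "\<forall>s\<in>UNIV <+> I. c s = 0"
    using nr unfolding nonresonant_def rat_independent_def by blast
  hence "c (Inr i) = 0" using i by auto
  thus False using i by (simp add: c_def)
qed

text \<open>Along \<open>\<Lambda> x\<close> the character with frequency \<open>m\<close> becomes a
  character of the lattice, whose vector has a non-integral entry unless \<open>m\<close> vanishes
  on \<open>I\<close>. So every nontrivial character averages to 0.\<close>

lemma trig_poly_has_mean:
  fixes \<Lambda> :: "'i \<Rightarrow> real^'n"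
  assumes "trig_poly I f c" "finite I" "nonresonant I \<Lambda>"
  shows "has_mean (\<lambda>x. f (\<lambda>i. \<Lambda> i \<bullet> real_vec x)) c"
  using assms(1)
proof induction
  case (character a m)
  have *: "(\<Sum>i\<in>I. of_int (m i) * (\<Lambda> i \<bullet> real_vec x)) = (\<Sum>i\<in>I. of_int (m i) *\<^sub>R \<Lambda> i) \<bullet> real_vec x" for x :: "int^'n"
    by (simp add: inner_sum_left)
  show ?case
  proof (cases "\<forall>i\<in>I. m i = 0")
    case True
    thus ?thesis using has_mean_const[of a] by simp
  next
    case False
    then obtain i where i: "i \<in> I" "m i \<noteq> 0" by auto
    obtain j where "(\<Sum>i\<in>I. of_int (m i) *\<^sub>R \<Lambda> i) $ j \<notin> \<int>"
      using nonresonant_character[where m=m, OF assms(2,3) i] by blast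
    from has_mean_cmult[OF has_mean_character[OF this], of a] False
    show ?thesis unfolding * by (auto simp: False)
  qed
next
  case (add f c g d)
  thus ?case using has_mean_add by fast
qed

text \<open>In disjoint variables frequencies are juxtaposed, and the joint frequency vanishes
  exactly when both do; hence means multiply.\<close>

lemma trig_poly_mult_disjoint:
  assumes "trig_poly I f c" "trig_poly J g d" "finite I" "finite J" "I \<inter> J = {}"
  shows "trig_poly (I \<union> J) (\<lambda>y. f y * g y) (c * d)"
  using assms(1)
proof induction
  case (character a m)
  show ?case using assms(2)
  proof induction
    case (character b k)
    let ?q = "\<lambda>i. if i \<in> I then m i else k i"
    have "trig_poly (I \<union> J) (\<lambda>y. (a * b) * cis (2 * pi * (\<Sum>i\<in>I \<union> J. of_int (?q i) * y i)))
            (if \<forall>i\<in>I \<union> J. ?q i = 0 then a * b else 0)"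
      by (rule trig_poly.character)
    moreover have "(\<Sum>i\<in>I \<union> J. of_int (?q i) * y i)
        = (\<Sum>i\<in>I. of_int (m i) * y i) + (\<Sum>i\<in>J. of_int (k i) * y i)" for y :: "'a \<Rightarrow> real"
      using assms(3-5) by (subst sum.union_disjoint) (auto intro!: sum.cong arg_cong2[where f="(+)"])
    moreover have "(if \<forall>i\<in>I \<union> J. ?q i = 0 then a * b else 0)
        = (if \<forall>i\<in>I. m i = 0 then a else 0) * (if \<forall>i\<in>J. k i = 0 then b else 0)"
      using assms(5) by auto
    ultimately show ?case by (simp add: ring_distribs mult_ac flip: cis_mult)
  next
    case (add f c g d)
    from trig_poly.add[OF add.IH] show ?case by (simp add: algebra_simps)
  qed
next
  case (add f c g' d')
  from trig_poly.add[OF add.IH] show ?case by (simp add: algebra_simps)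
qed

text \<open>In shared variables opposite frequencies may cancel, so \<open>c\<close> and
  \<open>d\<close> do not determine the mean and only its existence is stated. In one variable it is
  recovered by integration.\<close>

lemma trig_poly_mult:
  assumes "trig_poly I f c" "trig_poly I g d"
  shows "\<exists>e. trig_poly I (\<lambda>y. f y * g y) e"
  using assms(1)
proof induction
  case (character a m)
  show ?case using assms(2)
  proof induction
    case (character b k)
    have "trig_poly I (\<lambda>y. (a * b) * cis (2 * pi * (\<Sum>i\<in>I. of_int (m i + k i) * y i)))
            (if \<forall>i\<in>I. m i + k i = 0 then a * b else 0)"
      by (rule trig_poly.character)
    thus ?case by (auto simp add: ring_distribs sum.distrib mult_ac simp flip: cis_mult)
  next
    case (add f c g d)
    then obtain u v where "trig_poly I (\<lambda>y. a * cis (2 * pi * (\<Sum>i\<in>I. of_int (m i) * y i)) * f y) u"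
      "trig_poly I (\<lambda>y. a * cis (2 * pi * (\<Sum>i\<in>I. of_int (m i) * y i)) * g y) v" by blast
    from trig_poly.add[OF this] show ?case by (auto simp add: algebra_simps)
  qed
next
  case (add f c g' d')
  then obtain u v where "trig_poly I (\<lambda>y. f y * g y) u" "trig_poly I (\<lambda>y. g' y * g y) v" by blast
  from trig_poly.add[OF this] show ?case by (auto simp add: algebra_simps)
qed

lemma trig_poly_const:
  shows "trig_poly I (\<lambda>y. a) a"
  using trig_poly.character[of I a "\<lambda>_. 0"] by simp

lemma trig_poly_prod:
  assumes "finite I" "\<And>i. i \<in> I \<Longrightarrow> trig_poly {i} (f i) (c i)"
  shows "trig_poly I (\<lambda>y. \<Prod>i\<in>I. f i y) (\<Prod>i\<in>I. c i)"
  using assms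
proof (induction rule: finite_induct)
  case (insert i J)
  have "trig_poly ({i} \<union> J) (\<lambda>y. f i y * (\<Prod>i\<in>J. f i y)) (c i * (\<Prod>i\<in>J. c i))"
    using insert by (intro trig_poly_mult_disjoint) auto
  thus ?case using insert by simp
qed (simp add: trig_poly_const)

text \<open>On the unit circle a real linear form is a combination of \<open>cis t\<close> and
  \<open>cis (- t)\<close>; sums and products then stay in the class.\<close>

lemma trig_poly_polynomial:
  assumes "real_polynomial_function q"
  shows "\<exists>c. trig_poly {i} (\<lambda>y. of_real (q (cis (2 * pi * y i)))) c"
  using assms
proof induction
  case (linear q)
  interpret bounded_linear q by fact
  \<comment> \<open>Euler's formulas applied to \<open>cos t * q 1 + sin t * q \<i>\<close>.\<close>
  define A B where "A = (of_real (q 1) - \<i> * of_real (q \<i>)) / 2"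
    and "B = (of_real (q 1) + \<i> * of_real (q \<i>)) / 2"
  have "q (cis t) = cos t * q 1 + sin t * q \<i>" for t
  proof -
    have "cis t = cos t *\<^sub>R 1 + sin t *\<^sub>R \<i>" by (simp add: complex_eq_iff)
    thus ?thesis by (metis add real_scaleR_def scaleR)
  qed
  hence "of_real (q (cis t)) = A * cis t + B * cis (- t)" for t
    by (simp add: A_def B_def complex_eq_iff field_simps)
  moreover have "\<exists>c. trig_poly {i} (\<lambda>y. A * cis (2 * pi * (\<Sum>j\<in>{i}. of_int 1 * y j))
     + B * cis (2 * pi * (\<Sum>j\<in>{i}. of_int (-1) * y j))) c"
    by (rule exI, rule trig_poly.add[OF trig_poly.character[of _ _ "\<lambda>_. 1"] trig_poly.character[of _ _ "\<lambda>_. -1"]])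
  ultimately show ?case by simp
next
  case (const c)
  show ?case using trig_poly_const by blast
next
  case (add f g)
  thus ?case using trig_poly.add by fastforce
next
  case (mult f g)
  thus ?case using trig_poly_mult by fastforce
qed

text \<open>Identifies the recorded mean with an integral over one period. The starting point is
  free so that the period can be aligned with the arc in \<open>arc_majorant\<close>.\<close>

lemma trig_poly_has_integral:
  assumes "trig_poly {i} f c"
  shows "((\<lambda>t. f (\<lambda>_. t)) has_integral c) {a..a + 1}"
  using assms
proof induction
  case (character b m)
  show ?case
  proof (cases "m i = 0")
    case True
    thus ?thesis using has_integral_const_real[of b a "a + 1"] by simp
  next
    case False
    define k where "k = 2 * pi * of_int (m i)"
    have k: "k \<noteq> 0" using False by (simp add: k_def)
    have "((\<lambda>t. b * cis (k * t)) has_integral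
        (b * cis (k * (a + 1)) / (\<i> * k) - b * cis (k * a) / (\<i> * k))) {a..a + 1}"
    proof (rule fundamental_theorem_of_calculus)
      fix t
      have "((\<lambda>t. b * exp (\<i> * of_real k * of_real t) / (\<i> * k)) has_vector_derivative
         b * exp (\<i> * of_real k * of_real t)) (at t within {a..a + 1})"
        by (rule has_vector_derivative_real_field) (rule derivative_eq_intros refl | simp add: k)+
      thus "((\<lambda>t. b * cis (k * t) / (\<i> * k)) has_vector_derivative b * cis (k * t)) (at t within {a..a + 1})"
        by (simp add: cis_conv_exp mult_ac)
    qed simp
    moreover have "cis (k * (a + 1)) = cis (k * a)"
    proof -
      have "cis (k * (a + 1)) = cis (k * a) * cis (2 * pi * of_int (m i))"
        by (simp add: k_def ring_distribs flip: cis_mult)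
      thus ?thesis by (simp add: cis_multiple_2pi)
    qed
    ultimately show ?thesis using False by (simp add: k_def mult_ac)
  qed
next
  case (add f c g d)
  thus ?case by (intro has_integral_add)
qed

text \<open>Tent functions around the arc decrease to its indicator on the circle, so their
  integrals tend to its length; a Stone-Weierstrass polynomial is then shifted above a suitable
  tent. Majorants suffice because lower bounds will come from complements.\<close>

lemma arc_majorant:
  fixes a b e :: real
  assumes ab: "a \<le> b" "b \<le> a + 1" and e: "e > 0"
  obtains f c where "trig_poly {i} (\<lambda>y. of_real (f (y i))) (of_real c)" "\<And>t. 0 \<le> f t"
    "\<And>t (z :: int). a \<le> t + of_int z \<Longrightarrow> t + of_int z \<le> b \<Longrightarrow> 1 \<le> f t" "0 \<le> c" "c \<le> b - a + e"
proof -
  define K where "K = (\<lambda>t. cis (2 * pi * t)) ` {a..b}"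
  have K: "compact K" unfolding K_def
    by (intro compact_continuous_image continuous_intros) auto
  have K0: "K \<noteq> {}" using ab by (auto simp: K_def)
  define g :: "nat \<Rightarrow> complex \<Rightarrow> real" where "g n w = max 0 (1 - real n * infdist w K)" for n w
  have g: "continuous_on S (g n)" for n S unfolding g_def by (intro continuous_intros)
  define h where "h n t = g n (cis (2 * pi * t))" for n t
  define \<psi> :: "real \<Rightarrow> real" where "\<psi> t = (if cis (2 * pi * t) \<in> K then 1 else 0)" for t
  have h01: "0 \<le> h n t" "h n t \<le> 1" for n t
    by (auto simp: h_def g_def infdist_nonneg)
  have hint: "h n integrable_on {a..a + 1}" for n
    unfolding h_def
    by (intro integrable_continuous_real continuous_on_compose2[OF g[of UNIV n]] continuous_intros) auto
  have lim: "(\<lambda>n. h n t) \<longlonglongrightarrow> \<psi> t" for t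
  proof (cases "cis (2 * pi * t) \<in> K")
    case True
    thus ?thesis by (simp add: h_def g_def \<psi>_def)
  next
    case False
    define d where "d = infdist (cis (2 * pi * t)) K"
    have d: "d > 0" unfolding d_def
      using False K K0 by (simp add: compact_imp_closed infdist_pos_not_in_closed)
    have "eventually (\<lambda>n. h n t = 0) sequentially"
      using eventually_ge_at_top[of "nat \<lceil>1 / d\<rceil>"]
    proof eventually_elim
      case (elim n)
      hence "1 / d \<le> real n" by linarith
      hence "1 \<le> real n * d" using d by (simp add: field_simps)
      thus ?case by (simp add: h_def g_def d_def)
    qed
    thus ?thesis using False by (simp add: \<psi>_def tendsto_eventually)
  qed
  have "((\<lambda>t. if t \<in> {a..b} then 1 else 0) has_integral (b - a)) {a..a + 1}"
    using ab has_integral_const_real[of "1::real" a b] by (subst has_integral_restrict) auto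
  \<comment> \<open>The parametrisation of the circle is injective on the half-open period, so
    \<open>\<psi>\<close> is the indicator of the interval from \<open>a\<close> to \<open>b\<close>
    there; only the endpoint \<open>a + 1\<close>, which wraps around to \<open>a\<close>, is
    discarded.\<close>
  hence "(\<psi> has_integral (b - a)) {a..a + 1}"
  proof (rule has_integral_spike_finite[of "{a + 1}", rotated 2])
    fix t assume t: "t \<in> {a..a + 1} - {a + 1}"
    have "t \<in> {a..b}" if "s \<in> {a..b}" "cis (2 * pi * t) = cis (2 * pi * s)" for s
    proof -
      have "cis (2 * pi * (t - s)) = cis (2 * pi * t) * cis (- (2 * pi * s))"
        by (simp only: cis_mult) (simp add: algebra_simps)
      also have "\<dots> = 1" unfolding that(2) by (simp add: cis_mult)
      finally obtain k :: int where k: "t - s = of_int k" using cis_2pi_eq_1 Ints_cases by metis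
      hence "-1 \<le> real_of_int k" "real_of_int k < 1" using that t ab by auto
      hence "k = -1 \<or> k = 0" by linarith
      thus ?thesis using k that t ab by auto
    qed
    thus "\<psi> t = (if t \<in> {a..b} then 1 else 0)" by (auto simp: \<psi>_def K_def)
  qed auto
  hence "integral {a..a + 1} \<psi> = b - a" by blast
  moreover have "(\<lambda>n. integral {a..a + 1} (h n)) \<longlonglongrightarrow> integral {a..a + 1} \<psi>"
    by (rule dominated_convergence(2)[where h = "\<lambda>_. 1"]) (use hint lim h01 in \<open>auto simp: abs_le_iff intro: order_trans[of _ 0]\<close>)
  ultimately have "eventually (\<lambda>n. integral {a..a + 1} (h n) < b - a + e / 3) sequentially"
    using e by (intro order_tendstoD) auto
  then obtain n where n: "integral {a..a + 1} (h n) < b - a + e / 3"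
    by (auto simp: eventually_sequentially)
  obtain q where q: "real_polynomial_function q" "\<And>w. w \<in> sphere 0 1 \<Longrightarrow> \<bar>g n w - q w\<bar> < e / 3"
    using Stone_Weierstrass_real_polynomial_function[OF compact_sphere g, of "e/3" 0 1 n] e
    by (metis divide_pos_pos zero_less_numeral)
  \<comment> \<open>The approximation error is below \<open>e / 3\<close>; adding
    \<open>e / 3\<close> puts \<open>f\<close> above the tent and at most \<open>2 * e / 3\<close>
    higher, which together with the \<open>e / 3\<close> lost in the integral makes
    \<open>e\<close>.\<close>
  define f where "f t = q (cis (2 * pi * t)) + e / 3" for t
  have hf: "h n t \<le> f t" "f t \<le> h n t + 2 * e / 3" for t
  proof -
    have "\<bar>g n (cis (2 * pi * t)) - q (cis (2 * pi * t))\<bar> < e / 3" by (rule q(2)) simp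
    thus "h n t \<le> f t" "f t \<le> h n t + 2 * e / 3" unfolding f_def h_def by linarith+
  qed
  obtain c' where "trig_poly {i} (\<lambda>y. of_real (q (cis (2 * pi * y i)))) c'"
    using trig_poly_polynomial[OF q(1), of i] ..
  from trig_poly.add[OF this trig_poly_const[of "{i}" "of_real (e/3)"]]
  have "trig_poly {i} (\<lambda>y. of_real (f (y i))) (c' + of_real (e/3))"
    unfolding f_def of_real_add .
  then obtain c where c: "trig_poly {i} (\<lambda>y. of_real (f (y i))) c" ..
  from trig_poly_has_integral[OF this]
  have ci: "((\<lambda>t. complex_of_real (f t)) has_integral c) {a..a + 1}" .
  from has_integral_linear[OF this bounded_linear_Re]
  have fi: "(f has_integral Re c) {a..a + 1}" by (simp add: o_def)
  from has_integral_linear[OF this bounded_linear_of_real]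
  have "((\<lambda>t. complex_of_real (f t)) has_integral of_real (Re c)) {a..a + 1}" by (simp add: o_def)
  \<comment> \<open>The integrand is real, so the mean recorded by \<open>trig_poly\<close> is real
    too.\<close>
  hence c_eq: "c = of_real (Re c)" using ci has_integral_unique by blast
  show ?thesis
  proof (rule that[of f "Re c"])
    show "trig_poly {i} (\<lambda>y. of_real (f (y i))) (of_real (Re c))" using c c_eq by simp
    show f0: "0 \<le> f t" for t using hf h01 order_trans by blast
    show "1 \<le> f t" if "a \<le> t + of_int z" "t + of_int z \<le> b" for t and z :: int
    proof -
      have "cis (2 * pi * t) = cis (2 * pi * (t + of_int z))"
        using cis_multiple_2pi[of "of_int z"] by (simp add: ring_distribs flip: cis_mult)
      hence "cis (2 * pi * t) \<in> K" using that unfolding K_def by (metis atLeastAtMost_iff image_eqI)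
      hence "h n t = 1" by (simp add: h_def g_def)
      thus ?thesis using hf[of t] by simp
    qed
    show "0 \<le> Re c" using fi f0 by (rule has_integral_nonneg)
    have "((\<lambda>t. h n t + 2 * e / 3) has_integral (integral {a..a + 1} (h n) + 2 * e / 3)) {a..a + 1}"
      using has_integral_add[OF integrable_integral[OF hint] has_integral_const_real[of "2 * e / 3" a "a + 1"]]
      by simp
    from has_integral_le[OF fi this] hf n show "Re c \<le> b - a + e" by auto
  qed
qed

section \<open>Counting translates\<close>

text \<open>The periodised indicator of \<open>G\<close> at \<open>y\<close>, with multiplicity, so
  \<open>G\<close> may be larger than a unit cube. Shifts are extensional on \<open>I\<close> so
  that each is counted once.\<close>

definition lattice_count :: "'i set \<Rightarrow> ('i \<Rightarrow> real) set \<Rightarrow> ('i \<Rightarrow> real) \<Rightarrow> nat" where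
  "lattice_count I G y = card {z \<in> I \<rightarrow>\<^sub>E (UNIV :: int set). (\<lambda>i\<in>I. y i + of_int (z i)) \<in> G}"

text \<open>\<open>card\<close> is 0 on infinite sets, so monotonicity and additivity of
  \<open>lattice_count\<close> rest on this finiteness and thereby on boundedness.\<close>

lemma finite_lattice_translates:
  fixes G :: "('i \<Rightarrow> real) set"
  assumes "finite I" "\<forall>g\<in>G. \<forall>i\<in>I. \<bar>g i\<bar> \<le> r"
  shows "finite {z \<in> I \<rightarrow>\<^sub>E (UNIV :: int set). (\<lambda>i\<in>I. y i + of_int (z i)) \<in> G}"
proof (rule finite_subset)
  show "{z \<in> I \<rightarrow>\<^sub>E UNIV. (\<lambda>i\<in>I. y i + of_int (z i)) \<in> G} \<subseteq> (\<Pi>\<^sub>E i\<in>I. {\<lfloor>- r - y i\<rfloor>..\<lceil>r - y i\<rceil>})"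
  proof safe
    fix z i assume "(\<lambda>i\<in>I. y i + of_int (z i)) \<in> G" "i \<in> I"
    hence "\<bar>y i + of_int (z i)\<bar> \<le> r" using assms(2) by fastforce
    hence "- r - y i \<le> of_int (z i)" "of_int (z i) \<le> r - y i" by linarith+
    thus "z i \<in> {\<lfloor>- r - y i\<rfloor>..\<lceil>r - y i\<rceil>}" by (auto simp: floor_le_iff le_ceiling_iff)
  qed auto
qed (use assms in \<open>auto intro!: finite_PiE\<close>)

lemma lattice_count_mono:
  assumes "finite I" "\<forall>g\<in>H. \<forall>i\<in>I. \<bar>g i\<bar> \<le> r" "G \<subseteq> H"
  shows "lattice_count I G y \<le> lattice_count I H y"
  unfolding lattice_count_def
  using assms(3) by (intro card_mono finite_lattice_translates[OF assms(1,2)]) auto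

lemma lattice_count_UN_le:
  assumes "finite A"
  shows "lattice_count I (\<Union>a\<in>A. G a) y \<le> (\<Sum>a\<in>A. lattice_count I (G a) y)"
proof -
  have "{z \<in> I \<rightarrow>\<^sub>E UNIV. (\<lambda>i\<in>I. y i + of_int (z i)) \<in> (\<Union>a\<in>A. G a)}
      = (\<Union>a\<in>A. {z \<in> I \<rightarrow>\<^sub>E UNIV. (\<lambda>i\<in>I. y i + of_int (z i)) \<in> G a})" by auto
  thus ?thesis unfolding lattice_count_def by (simp only: card_UN_le[OF assms])
qed

lemma lattice_count_diff:
  assumes "finite I" "\<forall>g\<in>H. \<forall>i\<in>I. \<bar>g i\<bar> \<le> r" "G \<subseteq> H"
  shows "lattice_count I H y = lattice_count I G y + lattice_count I (H - G) y"
proof -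
  have "{z \<in> I \<rightarrow>\<^sub>E UNIV. (\<lambda>i\<in>I. y i + of_int (z i)) \<in> H}
      = {z \<in> I \<rightarrow>\<^sub>E UNIV. (\<lambda>i\<in>I. y i + of_int (z i)) \<in> G}
      \<union> {z \<in> I \<rightarrow>\<^sub>E UNIV. (\<lambda>i\<in>I. y i + of_int (z i)) \<in> H - G}" using assms(3) by auto
  moreover have "finite {z \<in> I \<rightarrow>\<^sub>E (UNIV::int set). (\<lambda>i\<in>I. y i + of_int (z i)) \<in> G}"
    "finite {z \<in> I \<rightarrow>\<^sub>E (UNIV::int set). (\<lambda>i\<in>I. y i + of_int (z i)) \<in> H - G}"
    by (rule finite_lattice_translates[where r = r]; use assms in auto)+
  ultimately show ?thesis
    unfolding lattice_count_def by (subst card_Un_disjoint[symmetric]) auto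
qed

lemma lattice_count_PiE:
  assumes "finite I"
  shows "lattice_count I (Pi\<^sub>E I A) y = (\<Prod>i\<in>I. card {k :: int. y i + of_int k \<in> A i})"
proof -
  have "{z \<in> I \<rightarrow>\<^sub>E UNIV. (\<lambda>i\<in>I. y i + of_int (z i)) \<in> Pi\<^sub>E I A} = (\<Pi>\<^sub>E i\<in>I. {k :: int. y i + of_int k \<in> A i})"
    by (auto simp: PiE_iff extensional_def)
  thus ?thesis unfolding lattice_count_def using card_PiE[OF assms] by simp
qed

lemma card_int_translates:
  fixes y :: real
  shows "card {k :: int. y + of_int k \<in> {- real r..<real r}} = 2 * r"
proof -
  have "{k :: int. y + of_int k \<in> {- real r..<real r}} = {\<lceil>- y\<rceil> - int r..<\<lceil>- y\<rceil> + int r}"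
    by (auto; linarith)
  thus ?thesis by simp
qed

text \<open>A half-open integer cube is a disjoint union of fundamental domains, so its periodised
  indicator is constant. This converts upper bounds for a complement into lower bounds for a
  set.\<close>

lemma lattice_count_int_cube:
  assumes "finite I"
  shows "lattice_count I (\<Pi>\<^sub>E i\<in>I. {- real r..<real r}) y = (2 * r) ^ card I"
  using lattice_count_PiE[OF assms, of "\<lambda>_. {- real r..<real r}" y] unfolding card_int_translates by simp

lemma card_int_translates_le_1:
  fixes y :: real
  assumes "s \<le> 1"
  shows "card {k :: int. y + of_int k \<in> {a..<a + s}} \<le> 1"
proof -
  have "{k :: int. y + of_int k \<in> {a..<a + s}} \<subseteq> {\<lceil>a - y\<rceil>}" using assms by (auto; linarith)
  from card_mono[OF _ this] show ?thesis by simp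
qed

text \<open>A half-open side of length at most 1 contains at most one translate, so the count is
  dominated by a product of arc majorants in separate variables, and the mean of that product is the
  product of the means.\<close>

lemma upper_mean_cube:
  fixes \<Lambda> :: "'i \<Rightarrow> real^'n"
  assumes I: "finite I" and nr: "nonresonant I \<Lambda>" and s: "0 \<le> s" "s \<le> 1"
  shows "upper_mean_le (\<lambda>x. real (lattice_count I (\<Pi>\<^sub>E i\<in>I. {a i..<a i + s}) (\<lambda>i. \<Lambda> i \<bullet> real_vec x))) (s ^ card I)"
proof (rule upper_mean_le_lim)
  fix e :: real assume e: "e > 0"
  \<comment> \<open>Provides a slack \<open>d\<close> such that enlarging every side by
    \<open>d\<close> adds less than \<open>e\<close> to the volume.\<close>
  have "((\<lambda>d. (s + d) ^ card I) \<longlongrightarrow> (s + 0) ^ card I) (at_right 0)"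
    by (intro tendsto_intros)
  hence "eventually (\<lambda>d. (s + d) ^ card I < s ^ card I + e) (at_right 0)"
    using e by (intro order_tendstoD) auto
  moreover have "eventually (\<lambda>d::real. d > 0) (at_right 0)" by (rule eventually_at_right_less)
  ultimately have "eventually (\<lambda>d. d > 0 \<and> (s + d) ^ card I < s ^ card I + e) (at_right 0)"
    by eventually_elim simp
  then obtain d where d: "d > 0" "(s + d) ^ card I < s ^ card I + e"
    using eventually_happens' trivial_limit_at_right_real by blast
  have "\<exists>f c. trig_poly {i} (\<lambda>y. of_real (f (y i))) (of_real c) \<and> (\<forall>t. 0 \<le> f t)
    \<and> (\<forall>t. \<forall>z::int. a i \<le> t + of_int z \<longrightarrow> t + of_int z \<le> a i + s \<longrightarrow> 1 \<le> f t) \<and> 0 \<le> c \<and> c \<le> s + d" for i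
    by (rule arc_majorant[of "a i" "a i + s" d i]) (use s d in auto)
  then obtain f c where fc: "\<And>i. trig_poly {i} (\<lambda>y. of_real (f i (y i))) (of_real (c i))"
    "\<And>i t. 0 \<le> f i t" "\<And>i t (z :: int). a i \<le> t + of_int z \<Longrightarrow> t + of_int z \<le> a i + s \<Longrightarrow> 1 \<le> f i t"
    "\<And>i. 0 \<le> c i" "\<And>i. c i \<le> s + d"
    by metis
  have "trig_poly I (\<lambda>y. \<Prod>i\<in>I. of_real (f i (y i))) (\<Prod>i\<in>I. of_real (c i))"
    by (intro trig_poly_prod I fc)
  hence "trig_poly I (\<lambda>y. of_real (\<Prod>i\<in>I. f i (y i))) (of_real (\<Prod>i\<in>I. c i))"
    by simp
  from trig_poly_has_mean[OF this I nr]
  have "upper_mean_le (\<lambda>x. \<Prod>i\<in>I. f i (\<Lambda> i \<bullet> real_vec x)) (\<Prod>i\<in>I. c i)"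
    by (rule has_mean_imp_upper_mean_le)
  thus "upper_mean_le (\<lambda>x. real (lattice_count I (\<Pi>\<^sub>E i\<in>I. {a i..<a i + s}) (\<lambda>i. \<Lambda> i \<bullet> real_vec x))) (s ^ card I + e)"
  proof (rule upper_mean_le_mono)
    have "(\<Prod>i\<in>I. c i) \<le> (\<Prod>i\<in>I. s + d)" using fc by (intro prod_mono) auto
    thus "(\<Prod>i\<in>I. c i) \<le> s ^ card I + e" using d by simp
    fix x :: "int^'n"
    have "real (card {k :: int. y + of_int k \<in> {a i..<a i + s}}) \<le> f i y" for y i
    proof (cases "\<exists>k :: int. y + of_int k \<in> {a i..<a i + s}")
      case True
      hence "1 \<le> f i y" using fc(3)[of i y] by auto
      thus ?thesis using card_int_translates_le_1[OF s(2), of y "a i"] by linarith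
    next
      case False
      hence "{k :: int. y + of_int k \<in> {a i..<a i + s}} = {}" by blast
      thus ?thesis using fc(2) by (simp only: card.empty) simp
    qed
    thus "real (lattice_count I (\<Pi>\<^sub>E i\<in>I. {a i..<a i + s}) (\<lambda>i. \<Lambda> i \<bullet> real_vec x))
        \<le> (\<Prod>i\<in>I. f i (\<Lambda> i \<bullet> real_vec x))"
      unfolding lattice_count_PiE[OF I] of_nat_prod by (intro prod_mono) auto
  qed
qed

section \<open>Jordan measurable sets\<close>

lemma topspace_vec_space [simp]: "topspace (vec_space I) = extensional I"
  by (auto simp: vec_space_def PiE_UNIV_domain PiE_def)

text \<open>On a finite index set the product topology is the topology of the maximum
  distance.\<close>

lemma openin_vec_space:
  assumes I: "finite I"
  shows "openin (vec_space I) U \<longleftrightarrow>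
    U \<subseteq> extensional I \<and> (\<forall>v\<in>U. \<exists>e>0. \<forall>w\<in>extensional I. (\<forall>i\<in>I. \<bar>w i - v i\<bar> < e) \<longrightarrow> w \<in> U)"
proof safe
  assume U: "openin (vec_space I) U"
  show "v \<in> extensional I" if "v \<in> U" for v
    using openin_subset[OF U] that by auto
  fix v assume v: "v \<in> U"
  obtain B where B: "\<And>i. i \<in> I \<Longrightarrow> open (B i)" "v \<in> Pi\<^sub>E I B" "Pi\<^sub>E I B \<subseteq> U"
    using U v unfolding vec_space_def openin_product_topology_alt by (metis open_openin)
  have "\<exists>e>0. \<forall>t. \<bar>t - v i\<bar> < e \<longrightarrow> t \<in> B i" if "i \<in> I" for i
    using B(1)[OF that] B(2) that by (auto simp: open_dist dist_real_def PiE_iff)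
  then obtain e where e: "\<And>i. i \<in> I \<Longrightarrow> e i > 0" "\<And>i t. i \<in> I \<Longrightarrow> \<bar>t - v i\<bar> < e i \<Longrightarrow> t \<in> B i"
    by metis
  \<comment> \<open>The extra 1 keeps the minimum meaningful for empty \<open>I\<close>.\<close>
  define d where "d = Min (insert 1 (e ` I))"
  have d: "d > 0" "\<And>i. i \<in> I \<Longrightarrow> d \<le> e i" using I e by (auto simp: d_def)
  show "\<exists>e>0. \<forall>w\<in>extensional I. (\<forall>i\<in>I. \<bar>w i - v i\<bar> < e) \<longrightarrow> w \<in> U"
  proof (intro exI[of _ d] conjI ballI impI d)
    fix w assume "w \<in> extensional I" "\<forall>i\<in>I. \<bar>w i - v i\<bar> < d"
    hence "w \<in> Pi\<^sub>E I B" using e(2) d(2) by (force simp: PiE_iff)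
    thus "w \<in> U" using B by blast
  qed
next
  assume U: "U \<subseteq> extensional I" "\<forall>v\<in>U. \<exists>e>0. \<forall>w\<in>extensional I. (\<forall>i\<in>I. \<bar>w i - v i\<bar> < e) \<longrightarrow> w \<in> U"
  show "openin (vec_space I) U"
    unfolding vec_space_def openin_product_topology_alt
  proof
    fix v assume v: "v \<in> U"
    then obtain e where e: "e > 0" "\<And>w. w \<in> extensional I \<Longrightarrow> (\<forall>i\<in>I. \<bar>w i - v i\<bar> < e) \<Longrightarrow> w \<in> U"
      using U(2) by meson
    have "v \<in> (\<Pi>\<^sub>E i\<in>I. ball (v i) e)" using U(1) v e(1) by (auto simp: PiE_iff)
    moreover have "(\<Pi>\<^sub>E i\<in>I. ball (v i) e) \<subseteq> U"
      using e(2) by (auto simp: PiE_iff dist_real_def abs_minus_commute)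
    ultimately show "\<exists>B. finite {i \<in> I. B i \<noteq> topspace euclideanreal} \<and> (\<forall>i\<in>I. openin euclideanreal (B i))
        \<and> v \<in> Pi\<^sub>E I B \<and> Pi\<^sub>E I B \<subseteq> U"
      using I by (intro exI[of _ "\<lambda>i. ball (v i) e"]) auto
  qed
qed

section \<open>Dyadic cubes and approximation of closed sets from outside\<close>

abbreviation dyadic_cell :: "'i set \<Rightarrow> nat \<Rightarrow> ('i \<Rightarrow> int) \<Rightarrow> ('i \<Rightarrow> real) set" where
  "dyadic_cell I k a \<equiv> (\<Pi>\<^sub>E i\<in>I. {of_int (a i) / 2 ^ k..<of_int (a i) / 2 ^ k + 1 / 2 ^ k})"

text \<open>With floors, disjointness and nesting of cubes reduce to equality of integers.\<close>

lemma mem_dyadic_cell: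
  "v \<in> dyadic_cell I k a \<longleftrightarrow> v \<in> extensional I \<and> (\<forall>i\<in>I. \<lfloor>v i * 2 ^ k\<rfloor> = a i)"
proof -
  have "t \<in> {of_int m / 2 ^ k..<of_int m / 2 ^ k + 1 / 2 ^ k} \<longleftrightarrow> \<lfloor>t * 2 ^ k\<rfloor> = m" for t :: real and m
    by (auto simp: floor_eq_iff field_simps)
  thus ?thesis by (auto simp: PiE_iff)
qed

lemma product_sigma_finite_lborel: "product_sigma_finite (\<lambda>_. lborel)"
  by (simp add: product_sigma_finite_def sigma_finite_lborel)

lemma dyadic_cell_measurable: "finite I \<Longrightarrow> dyadic_cell I k a \<in> sets (PiM I (\<lambda>_. lborel))"
  by (intro sets_PiM_I_finite) auto

lemma emeasure_dyadic_cell: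
  assumes "finite I"
  shows "emeasure (PiM I (\<lambda>_. lborel)) (dyadic_cell I k a) = ennreal ((1 / 2 ^ k) ^ card I)"
  by (subst product_sigma_finite.emeasure_PiM[OF product_sigma_finite_lborel assms])
     (auto simp flip: ennreal_power)

text \<open>The union of the level \<open>k\<close> cubes that meet \<open>K\<close>. Restricting
  the floors to \<open>I\<close> lists every such cube once, so that volumes add up.\<close>

definition dyadic_hull :: "'i set \<Rightarrow> nat \<Rightarrow> ('i \<Rightarrow> real) set \<Rightarrow> ('i \<Rightarrow> real) set" where
  "dyadic_hull I k K = (\<Union>a\<in>(\<lambda>w. \<lambda>i\<in>I. \<lfloor>w i * 2 ^ k\<rfloor>) ` K. dyadic_cell I k a)"

lemma mem_dyadic_hull:
  "v \<in> dyadic_hull I k K \<longleftrightarrow> v \<in> extensional I \<and> (\<exists>w\<in>K. \<forall>i\<in>I. \<lfloor>v i * 2 ^ k\<rfloor> = \<lfloor>w i * 2 ^ k\<rfloor>)"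
  unfolding dyadic_hull_def UN_iff mem_dyadic_cell by auto

lemma dyadic_hull_superset: "K \<subseteq> extensional I \<Longrightarrow> K \<subseteq> dyadic_hull I k K"
  by (auto simp: mem_dyadic_hull)

text \<open>The floor at level \<open>k\<close> is the floor at level \<open>k + 1\<close> divided
  by 2 and rounded down, so points sharing a fine cube share the coarse one.\<close>

lemma dyadic_hull_decseq: "decseq (\<lambda>k. dyadic_hull I k K)"
proof (rule decseq_SucI, rule subsetI)
  fix k v assume v: "v \<in> dyadic_hull I (Suc k) K"
  have *: "\<lfloor>t * 2 ^ k\<rfloor> = \<lfloor>t * 2 ^ Suc k\<rfloor> div 2" for t :: real
    using floor_divide_real_eq_div[of 2 "t * 2 ^ Suc k"] by simp
  show "v \<in> dyadic_hull I k K" using v unfolding mem_dyadic_hull * by metis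
qed

text \<open>Points of a common level \<open>k\<close> cube differ by less than
  \<open>(1 / 2) ^ k\<close> in each coordinate, whereas a point outside the closed set
  \<open>K\<close> has a whole neighbourhood outside it.\<close>

lemma INT_dyadic_hull:
  assumes I: "finite I" and K: "closedin (vec_space I) K"
  shows "(\<Inter>k. dyadic_hull I k K) = K"
proof
  have Ke: "K \<subseteq> extensional I" using closedin_subset[OF K] by simp
  show "K \<subseteq> (\<Inter>k. dyadic_hull I k K)" using dyadic_hull_superset[OF Ke] by blast
  show "(\<Inter>k. dyadic_hull I k K) \<subseteq> K"
  proof (rule subsetI, rule ccontr)
    fix v assume v: "v \<in> (\<Inter>k. dyadic_hull I k K)" "v \<notin> K"
    have "openin (vec_space I) (extensional I - K)" using K by (simp add: closedin_def)
    moreover have "v \<in> extensional I - K" using v by (auto simp: mem_dyadic_hull)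
    ultimately obtain e where e: "e > 0" "\<And>w. w \<in> extensional I \<Longrightarrow> (\<forall>i\<in>I. \<bar>w i - v i\<bar> < e) \<Longrightarrow> w \<notin> K"
      unfolding openin_vec_space[OF I] by blast
    obtain k where k: "(1 / 2) ^ k < e" using real_arch_pow_inv[OF e(1), of "1/2"] by auto
    obtain w where w: "w \<in> K" "\<And>i. i \<in> I \<Longrightarrow> \<lfloor>v i * 2 ^ k\<rfloor> = \<lfloor>w i * 2 ^ k\<rfloor>"
      using v(1) unfolding mem_dyadic_hull INT_iff by blast
    have "\<bar>w i - v i\<bar> < e" if "i \<in> I" for i
    proof -
      have "\<bar>w i * 2 ^ k - v i * 2 ^ k\<bar> < 1" using w(2)[OF that] by linarith
      hence "\<bar>(w i - v i) * 2 ^ k\<bar> < 1" by (simp add: algebra_simps)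
      hence "\<bar>w i - v i\<bar> * 2 ^ k < 1" by (simp add: abs_mult)
      hence "\<bar>w i - v i\<bar> < (1/2) ^ k" by (simp add: field_simps power_one_over)
      thus ?thesis using k by simp
    qed
    thus False using e(2)[of w] w(1) Ke by blast
  qed
qed

lemma finite_dyadic_indices:
  fixes K :: "('i \<Rightarrow> real) set"
  assumes "finite I" "\<forall>g\<in>K. \<forall>i\<in>I. \<bar>g i\<bar> \<le> r"
  shows "finite ((\<lambda>w. \<lambda>i\<in>I. \<lfloor>w i * 2 ^ k\<rfloor>) ` K)"
proof (rule finite_subset)
  show "(\<lambda>w. \<lambda>i\<in>I. \<lfloor>w i * 2 ^ k\<rfloor>) ` K \<subseteq> (\<Pi>\<^sub>E i\<in>I. {\<lfloor>- r * 2 ^ k\<rfloor>..\<lfloor>r * 2 ^ k\<rfloor>})"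
  proof (safe, unfold restrict_apply)
    fix w i assume "w \<in> K" "i \<in> I"
    hence "- r \<le> w i" "w i \<le> r" using assms(2) by (fastforce simp: abs_le_iff)+
    thus "(if i \<in> I then \<lfloor>w i * 2 ^ k\<rfloor> else undefined) \<in> {\<lfloor>- r * 2 ^ k\<rfloor>..\<lfloor>r * 2 ^ k\<rfloor>}"
      using \<open>i \<in> I\<close> mult_right_mono[of "- r" "w i" "2 ^ k"] mult_right_mono[of "w i" r "2 ^ k"]
      by (auto intro!: floor_mono)
  qed auto
qed (use assms in \<open>auto intro!: finite_PiE\<close>)

lemma dyadic_hull_measure:
  assumes I: "finite I" and K: "\<forall>g\<in>K. \<forall>i\<in>I. \<bar>g i\<bar> \<le> r"
  shows "dyadic_hull I k K \<in> sets (PiM I (\<lambda>_. lborel))"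
    and "emeasure (PiM I (\<lambda>_. lborel)) (dyadic_hull I k K)
       = ennreal (real (card ((\<lambda>w. \<lambda>i\<in>I. \<lfloor>w i * 2 ^ k\<rfloor>) ` K)) * (1 / 2 ^ k) ^ card I)"
proof -
  let ?A = "(\<lambda>w. \<lambda>i\<in>I. \<lfloor>w i * 2 ^ k\<rfloor>) ` K"
  have fin: "finite ?A" by (rule finite_dyadic_indices[OF I K])
  show "dyadic_hull I k K \<in> sets (PiM I (\<lambda>_. lborel))"
    unfolding dyadic_hull_def using dyadic_cell_measurable[OF I] fin by (intro sets.finite_UN) auto
  have "disjoint_family_on (dyadic_cell I k) ?A"
    unfolding disjoint_family_on_def
  proof (intro ballI impI)
    fix a b assume ab: "a \<in> ?A" "b \<in> ?A" "a \<noteq> b"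
    then obtain i where "i \<in> I" "a i \<noteq> b i" by (auto simp: restrict_def fun_eq_iff split: if_splits)
    thus "dyadic_cell I k a \<inter> dyadic_cell I k b = {}" unfolding disjoint_iff mem_dyadic_cell by metis
  qed
  hence "(\<Sum>a\<in>?A. emeasure (PiM I (\<lambda>_. lborel)) (dyadic_cell I k a))
      = emeasure (PiM I (\<lambda>_. lborel)) (\<Union>a\<in>?A. dyadic_cell I k a)"
    by (intro sum_emeasure[OF _ _ fin] image_subsetI dyadic_cell_measurable[OF I])
  hence "emeasure (PiM I (\<lambda>_. lborel)) (dyadic_hull I k K)
      = (\<Sum>a\<in>?A. emeasure (PiM I (\<lambda>_. lborel)) (dyadic_cell I k a))"
    unfolding dyadic_hull_def by (rule sym)
  also have "\<dots> = (\<Sum>a\<in>?A. ennreal ((1 / 2 ^ k) ^ card I))"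
    by (simp only: emeasure_dyadic_cell[OF I])
  also have "\<dots> = ennreal (real (card ?A) * (1 / 2 ^ k) ^ card I)"
    by (simp add: ennreal_of_nat_eq_real_of_nat ennreal_mult)
  finally show "emeasure (PiM I (\<lambda>_. lborel)) (dyadic_hull I k K) = \<dots>" .
qed

text \<open>The dyadic cubes contained in an open set are countably many and exhaust it.\<close>

lemma openin_vec_space_measurable:
  assumes I: "finite I" and U: "openin (vec_space I) U"
  shows "U \<in> sets (PiM I (\<lambda>_. lborel))"
proof -
  have "U = (\<Union>k. \<Union>a\<in>{a \<in> I \<rightarrow>\<^sub>E UNIV. dyadic_cell I k a \<subseteq> U}. dyadic_cell I k a)" (is "_ = ?V")
  proof
    show "U \<subseteq> ?V"
    proof
      fix v assume v: "v \<in> U"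
      then obtain e where e: "e > 0" "\<And>w. w \<in> extensional I \<Longrightarrow> (\<forall>i\<in>I. \<bar>w i - v i\<bar> < e) \<Longrightarrow> w \<in> U"
        using U unfolding openin_vec_space[OF I] by meson
      have ve: "v \<in> extensional I" using openin_subset[OF U] v by auto
      obtain k where k: "(1 / 2) ^ k < e" using real_arch_pow_inv[OF e(1), of "1/2"] by auto
      let ?a = "\<lambda>i\<in>I. \<lfloor>v i * 2 ^ k\<rfloor>"
      have "dyadic_cell I k ?a \<subseteq> U"
      proof
        fix w assume w: "w \<in> dyadic_cell I k ?a"
        have "\<bar>w i - v i\<bar> < e" if "i \<in> I" for i
        proof -
          have "\<lfloor>w i * 2 ^ k\<rfloor> = \<lfloor>v i * 2 ^ k\<rfloor>" using w that unfolding mem_dyadic_cell by simp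
          hence "\<bar>w i * 2 ^ k - v i * 2 ^ k\<bar> < 1" by linarith
          hence "\<bar>(w i - v i) * 2 ^ k\<bar> < 1" by (simp add: algebra_simps)
          hence "\<bar>w i - v i\<bar> * 2 ^ k < 1" by (simp add: abs_mult)
          hence "\<bar>w i - v i\<bar> < (1/2) ^ k" by (simp add: field_simps power_one_over)
          thus ?thesis using k by simp
        qed
        moreover have "w \<in> extensional I" using w unfolding mem_dyadic_cell by simp
        ultimately show "w \<in> U" using e(2) by blast
      qed
      moreover have "v \<in> dyadic_cell I k ?a" unfolding mem_dyadic_cell using ve by simp
      moreover have "?a \<in> I \<rightarrow>\<^sub>E UNIV" by simp
      ultimately show "v \<in> ?V" by blast
    qed
  qed blast
  moreover have "countable (I \<rightarrow>\<^sub>E (UNIV :: int set))" using I by (intro countable_PiE) auto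
  hence "countable {a \<in> I \<rightarrow>\<^sub>E (UNIV :: int set). dyadic_cell I k a \<subseteq> U}" for k
    by (rule countable_subset[rotated]) auto
  hence "?V \<in> sets (PiM I (\<lambda>_. lborel))"
    by (intro sets.countable_UN sets.countable_UN' image_subsetI) (use dyadic_cell_measurable[OF I] in auto)
  ultimately show ?thesis by simp
qed

text \<open>The hulls decrease to \<open>K\<close>, so by continuity from above some hull exceeds
  \<open>K\<close> in volume by less than \<open>e\<close>. That hull is a finite disjoint union of
  cubes of side at most 1, to which \<open>upper_mean_cube\<close> applies.\<close>

lemma upper_mean_compact:
  fixes \<Lambda> :: "'i \<Rightarrow> real^'n"
  assumes I: "finite I" and nr: "nonresonant I \<Lambda>"
    and K: "closedin (vec_space I) K" "\<forall>g\<in>K. \<forall>i\<in>I. \<bar>g i\<bar> \<le> r"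
  shows "upper_mean_le (\<lambda>x. real (lattice_count I K (\<lambda>i. \<Lambda> i \<bullet> real_vec x))) (measure (PiM I (\<lambda>_. lborel)) K)"
proof (rule upper_mean_le_lim)
  fix e :: real assume e: "e > 0"
  let ?M = "PiM I (\<lambda>_. lborel) :: ('i \<Rightarrow> real) measure"
  have "(\<lambda>k. measure ?M (dyadic_hull I k K)) \<longlonglongrightarrow> measure ?M (\<Inter>k. dyadic_hull I k K)"
    by (rule Lim_measure_decseq) (use dyadic_hull_measure[OF I K(2)] dyadic_hull_decseq in auto)
  hence "eventually (\<lambda>k. measure ?M (dyadic_hull I k K) < measure ?M K + e) sequentially"
    unfolding INT_dyadic_hull[OF I K(1)] using e by (intro order_tendstoD) auto
  then obtain k where k: "measure ?M (dyadic_hull I k K) < measure ?M K + e"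
    by (auto simp: eventually_sequentially)
  let ?A = "(\<lambda>w. \<lambda>i\<in>I. \<lfloor>w i * 2 ^ k\<rfloor>) ` K"
  have fin: "finite ?A" by (rule finite_dyadic_indices[OF I K(2)])
  have "upper_mean_le (\<lambda>x. \<Sum>a\<in>?A. real (lattice_count I (dyadic_cell I k a) (\<lambda>i. \<Lambda> i \<bullet> real_vec x)))
          (\<Sum>a\<in>?A. (1 / 2 ^ k) ^ card I)"
    by (intro upper_mean_le_sum fin upper_mean_cube I nr) auto
  thus "upper_mean_le (\<lambda>x. real (lattice_count I K (\<lambda>i. \<Lambda> i \<bullet> real_vec x))) (measure ?M K + e)"
  proof (rule upper_mean_le_mono)
    have "measure ?M (dyadic_hull I k K) = (\<Sum>a\<in>?A. (1 / 2 ^ k) ^ card I)"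
      unfolding measure_def dyadic_hull_measure(2)[OF I K(2)] by simp
    thus "(\<Sum>a\<in>?A. (1 / 2 ^ k) ^ card I) \<le> measure ?M K + e" using k by simp
    fix x :: "int^'n"
    \<comment> \<open>In each coordinate a point of the hull is within 1 of a point of
      \<open>K\<close>. The resulting bound is what \<open>lattice_count_mono\<close> asks
      for.\<close>
    have "\<bar>g i\<bar> \<le> \<bar>r\<bar> + 2" if g: "g \<in> dyadic_hull I k K" "i \<in> I" for g i
    proof -
      obtain w where w: "w \<in> K" "\<lfloor>g i * 2 ^ k\<rfloor> = \<lfloor>w i * 2 ^ k\<rfloor>"
        using g unfolding mem_dyadic_hull by blast
      hence "\<bar>w i * 2 ^ k - g i * 2 ^ k\<bar> < 1" by linarith
      hence "\<bar>(w i - g i) * 2 ^ k\<bar> < 1" by (simp add: algebra_simps)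
      hence "\<bar>w i - g i\<bar> * 2 ^ k < 1" by (simp add: abs_mult)
      moreover have "\<bar>w i - g i\<bar> * 1 \<le> \<bar>w i - g i\<bar> * 2 ^ k" by (intro mult_left_mono) auto
      ultimately show ?thesis using K(2) w(1) g(2) by fastforce
    qed
    hence "\<forall>g\<in>dyadic_hull I k K. \<forall>i\<in>I. \<bar>g i\<bar> \<le> \<bar>r\<bar> + 2" by blast
    hence "lattice_count I K (\<lambda>i. \<Lambda> i \<bullet> real_vec x) \<le> lattice_count I (dyadic_hull I k K) (\<lambda>i. \<Lambda> i \<bullet> real_vec x)"
      using closedin_subset[OF K(1)] by (intro lattice_count_mono[OF I] dyadic_hull_superset) auto
    also have "\<dots> \<le> (\<Sum>a\<in>?A. lattice_count I (dyadic_cell I k a) (\<lambda>i. \<Lambda> i \<bullet> real_vec x))"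
      unfolding dyadic_hull_def by (rule lattice_count_UN_le[OF fin])
    finally show "real (lattice_count I K (\<lambda>i. \<Lambda> i \<bullet> real_vec x))
        \<le> (\<Sum>a\<in>?A. real (lattice_count I (dyadic_cell I k a) (\<lambda>i. \<Lambda> i \<bullet> real_vec x)))"
      by (simp flip: of_nat_sum)
  qed
qed

section \<open>Continuity sets\<close>

text \<open>Jordan measurability without boundedness, for any topology with a measure; it serves
  both \<open>real^'n\<close> and extensional functions. In the completion every subset of a null
  set is null, which the closure rules below rely on.\<close>

definition continuity_set :: "'a topology \<Rightarrow> 'a measure \<Rightarrow> 'a set \<Rightarrow> bool" where
  "continuity_set X M G \<longleftrightarrow> G \<subseteq> topspace X \<and> X frontier_of G \<in> null_sets (completion M)"

lemma emeasure_completion_sets: "A \<in> sets M \<Longrightarrow> emeasure (completion M) A = emeasure M A"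
  by simp

lemma continuity_set_empty [simp]: "continuity_set X M {}"
  by (simp add: continuity_set_def)

lemma continuity_set_Un: "continuity_set X M A \<Longrightarrow> continuity_set X M B \<Longrightarrow> continuity_set X M (A \<union> B)"
  unfolding continuity_set_def
  using null_sets_completion_subset[OF frontier_of_Un_subset null_sets.Un] by auto

lemma continuity_set_Int: "continuity_set X M A \<Longrightarrow> continuity_set X M B \<Longrightarrow> continuity_set X M (A \<inter> B)"
  unfolding continuity_set_def
  using null_sets_completion_subset[OF frontier_of_Int_subset null_sets.Un] by auto

lemma continuity_set_Diff: "continuity_set X M A \<Longrightarrow> continuity_set X M B \<Longrightarrow> continuity_set X M (A - B)"
proof -
  assume A: "continuity_set X M A" and "continuity_set X M B"
  hence "continuity_set X M (topspace X - B)"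
    by (simp add: continuity_set_def frontier_of_complement)
  from continuity_set_Int[OF A this] show ?thesis
    using A by (metis continuity_set_def Int_Diff Int_absorb2)
qed

lemma continuity_set_UN:
  "finite F \<Longrightarrow> (\<And>i. i \<in> F \<Longrightarrow> continuity_set X M (A i)) \<Longrightarrow> continuity_set X M (\<Union>i\<in>F. A i)"
  by (induction rule: finite_induct) (auto intro: continuity_set_Un)

lemma continuity_set_INT:
  assumes "finite F" "F \<noteq> {}" "\<And>i. i \<in> F \<Longrightarrow> continuity_set X M (A i)"
  shows "continuity_set X M (\<Inter>i\<in>F. A i)"
  using assms by (induction rule: finite_ne_induct) (auto intro: continuity_set_Int)

text \<open>The frontier of a preimage lies in the preimage of the frontier. Frontiers are closed,
  so null preimages are demanded for closed null sets only.\<close>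

lemma continuity_set_vimage:
  assumes f: "continuous_map X Y f" and B: "continuity_set Y N B"
    and null: "\<And>F. closedin Y F \<Longrightarrow> F \<in> null_sets (completion N) \<Longrightarrow> {x \<in> topspace X. f x \<in> F} \<in> null_sets (completion M)"
  shows "continuity_set X M {x \<in> topspace X. f x \<in> B}"
  unfolding continuity_set_def
proof
  have "X frontier_of {x \<in> topspace X. f x \<in> B} \<subseteq> {x \<in> topspace X. f x \<in> Y frontier_of B}"
    by (rule continuous_map_frontier_frontier_preimage_subset[OF f])
  thus "X frontier_of {x \<in> topspace X. f x \<in> B} \<in> null_sets (completion M)"
    by (rule null_sets_completion_subset)
       (use null[OF closedin_frontier_of[of Y B]] B in \<open>auto simp: continuity_set_def\<close>)
qed auto

text \<open>A point of the ambient frontier is either a limit of points outside \<open>S\<close>,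
  hence on the frontier of \<open>S\<close>, or lies in \<open>S\<close> and is a limit of points of
  \<open>S - B\<close>.\<close>

lemma frontier_of_subset_relative:
  assumes "B \<subseteq> S" "S \<subseteq> topspace X"
  shows "X frontier_of B \<subseteq> subtopology X S frontier_of B \<union> X frontier_of S"
proof
  fix p assume p: "p \<in> X frontier_of B"
  have *: "topspace X - B = (S - B) \<union> (topspace X - S)" using assms by auto
  have pB: "p \<in> X closure_of B" and p': "p \<in> X closure_of (S - B) \<or> p \<in> X closure_of (topspace X - S)"
    using p unfolding frontier_of_closures * closure_of_Un by auto
  show "p \<in> subtopology X S frontier_of B \<union> X frontier_of S"
  proof (cases "p \<in> X closure_of (topspace X - S)")
    case True
    thus ?thesis using pB closure_of_mono[OF assms(1)] by (auto simp: frontier_of_closures)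
  next
    case False
    have "p \<in> topspace X" using pB closure_of_subset_topspace[of X B] by blast
    hence "p \<in> S" using False closure_of_subset[of "topspace X - S" X] by auto
    thus ?thesis using False pB p' assms
      by (auto simp: frontier_of_closures closure_of_subtopology Int_absorb1 Int_absorb2)
  qed
qed

section \<open>Topologies with a compatible measure\<close>

locale borel_topology =
  fixes X :: "'a topology" and M :: "'a measure"
  assumes openin_sets: "openin X U \<Longrightarrow> U \<in> sets M"
    and space_eq: "space M = topspace X"
begin

lemma closedin_sets: "closedin X F \<Longrightarrow> F \<in> sets M"
  using openin_sets[of "topspace X - F"] space_eq
  by (metis closedin_def double_diff order_refl sets.compl_sets)

lemma continuity_set_decomp:
  assumes "continuity_set X M G"
  obtains N where "N \<in> null_sets (completion M)" "G = X interior_of G \<union> N"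
proof -
  have "G - X interior_of G \<subseteq> X frontier_of G"
    using assms closure_of_subset[of G X] by (auto simp: continuity_set_def frontier_of_def)
  hence "G - X interior_of G \<in> null_sets (completion M)"
    using assms null_sets_completion_subset by (auto simp: continuity_set_def)
  thus ?thesis using that[of "G - X interior_of G"] interior_of_subset[of X G] by auto
qed

text \<open>\<open>G\<close> differs from its interior and from its closure by a null set. Volumes
  of possibly non-Borel sets are thereby computed from open and closed ones.\<close>

lemma
  assumes G: "continuity_set X M G"
  shows continuity_set_sets: "G \<in> sets (completion M)"
    and emeasure_interior: "emeasure M (X interior_of G) = emeasure (completion M) G"
    and emeasure_closure: "emeasure M (X closure_of G) = emeasure (completion M) G"
proof -
  obtain N where N: "N \<in> null_sets (completion M)" "G = X interior_of G \<union> N"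
    using continuity_set_decomp[OF G] by blast
  have i: "X interior_of G \<in> sets M" by (simp add: openin_sets)
  have c: "X closure_of G \<in> sets M" by (simp add: closedin_sets)
  have "X interior_of G \<union> N \<in> sets (completion M)" using N(1) i by auto
  thus "G \<in> sets (completion M)" using N(2) by metis
  have "emeasure (completion M) (X interior_of G \<union> N) = emeasure (completion M) (X interior_of G)"
    using i N by (intro emeasure_Un_null_set) auto
  thus 1: "emeasure M (X interior_of G) = emeasure (completion M) G"
    using N(2) i emeasure_completion_sets by metis
  have "emeasure (completion M) (X interior_of G \<union> X frontier_of G) = emeasure (completion M) (X interior_of G)"
    using i G by (intro emeasure_Un_null_set) (auto simp: continuity_set_def)
  thus "emeasure M (X closure_of G) = emeasure (completion M) G"
    unfolding interior_of_union_frontier_of emeasure_completion_sets[OF c] emeasure_completion_sets[OF i] 1 .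
qed

lemma measure_interior: "continuity_set X M G \<Longrightarrow> measure M (X interior_of G) = measure (completion M) G"
  and measure_closure: "continuity_set X M G \<Longrightarrow> measure M (X closure_of G) = measure (completion M) G"
  by (simp_all add: measure_def emeasure_interior emeasure_closure)

text \<open>Measure preservation speaks about sets of \<open>N\<close>, to which \<open>B\<close>
  need not belong. The preimage is squeezed between those of the interior and the closure of
  \<open>B\<close>, which have equal measure.\<close>

lemma emeasure_vimage:
  assumes Y: "borel_topology Y N" and f: "continuous_map X Y f" "f \<in> measurable M N" "distr M N f = N"
    and B: "continuity_set Y N B"
  shows "continuity_set X M {x \<in> topspace X. f x \<in> B}"
    and "emeasure (completion M) {x \<in> topspace X. f x \<in> B} = emeasure (completion N) B"
proof -
  interpret Y: borel_topology Y N by (rule Y)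
  have pre: "emeasure M {x \<in> topspace X. f x \<in> A} = emeasure N A" if "A \<in> sets N" for A
  proof -
    have "emeasure (distr M N f) A = emeasure M (f -` A \<inter> space M)"
      using f that by (intro emeasure_distr)
    thus ?thesis using f(3) by (simp add: space_eq vimage_def Int_def conj_commute)
  qed
  have null: "{x \<in> topspace X. f x \<in> F} \<in> null_sets (completion M)"
    if "closedin Y F" "F \<in> null_sets (completion N)" for F
  proof -
    have F: "F \<in> sets N" using that by (simp add: Y.closedin_sets)
    hence "emeasure M {x \<in> topspace X. f x \<in> F} = 0" using pre that by (auto simp: null_sets_def)
    moreover have "{x \<in> topspace X. f x \<in> F} \<in> sets M"
      using that(1) f(1) closedin_continuous_map_preimage closedin_sets by blast
    ultimately show ?thesis by (auto intro: null_sets_completionI)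
  qed
  show P: "continuity_set X M {x \<in> topspace X. f x \<in> B}"
    by (rule continuity_set_vimage[OF f(1) B null]) auto
  let ?P = "{x \<in> topspace X. f x \<in> B}"
  have "emeasure (completion M) ?P \<le> emeasure (completion M) {x \<in> topspace X. f x \<in> Y closure_of B}"
  proof (rule emeasure_mono)
    show "?P \<subseteq> {x \<in> topspace X. f x \<in> Y closure_of B}"
      using closure_of_subset[of B Y] B by (auto simp: continuity_set_def)
    show "{x \<in> topspace X. f x \<in> Y closure_of B} \<in> sets (completion M)"
      using closedin_continuous_map_preimage[OF f(1) closedin_closure_of] closedin_sets by blast
  qed
  also have "\<dots> = emeasure M {x \<in> topspace X. f x \<in> Y closure_of B}"
    using closedin_continuous_map_preimage[OF f(1) closedin_closure_of] closedin_sets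
    by (intro emeasure_completion_sets) blast
  also have "\<dots> = emeasure (completion N) B"
    using Y.emeasure_closure[OF B] by (simp add: pre Y.closedin_sets)
  finally have 1: "emeasure (completion M) ?P \<le> emeasure (completion N) B" .
  have "emeasure (completion N) B = emeasure N (Y interior_of B)" using Y.emeasure_interior[OF B] by simp
  also have "\<dots> = emeasure M {x \<in> topspace X. f x \<in> Y interior_of B}"
    by (simp add: pre Y.openin_sets)
  also have "\<dots> = emeasure (completion M) {x \<in> topspace X. f x \<in> Y interior_of B}"
    using openin_continuous_map_preimage[OF f(1) openin_interior_of] openin_sets
    by (intro emeasure_completion_sets[symmetric]) blast
  also have "\<dots> \<le> emeasure (completion M) ?P"
    using interior_of_subset[of Y B] by (intro emeasure_mono continuity_set_sets[OF P]) auto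
  finally show "emeasure (completion M) ?P = emeasure (completion N) B" using 1 by simp
qed

end

section \<open>Sets of unit mass and the algebras generated by maps into them\<close>

text \<open>Abstracts the single cell in \<open>real^'n\<close> and its powers in block coordinates.
  The separation axiom makes points closed and hence countable sets Borel.\<close>

locale borel_cell = borel_topology +
  fixes S :: "'a set"
  assumes t1: "t1_space X" and cell: "continuity_set X M S" and unit: "emeasure (completion M) S = 1"
begin

abbreviation "S_top \<equiv> subtopology X S"
abbreviation "S_mes \<equiv> borel_restriction S_top (completion M)"

lemma cell_subset: "S \<subseteq> topspace X" using cell by (simp add: continuity_set_def)

lemma topspace_S [simp]: "topspace S_top = S" using cell_subset by auto

text \<open>A relatively open set is the trace on \<open>S\<close> of an open set, and
  \<open>S\<close> is measurable for the completion only; hence \<open>S_mes\<close> restricts the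
  completed measure.\<close>

lemma borel_sets_of_sub:
  assumes "B \<in> borel_sets_of S_top"
  shows "B \<in> sets (completion M) \<and> B \<subseteq> S"
  using assms unfolding borel_sets_of_def topspace_S
proof induction
  case (Basic a)
  thus ?case using openin_sets continuity_set_sets[OF cell]
    by (auto simp: openin_subtopology intro!: sets.Int)
next
  case (Compl a)
  thus ?case using continuity_set_sets[OF cell] by auto
next
  case (Union a)
  thus ?case by blast
qed auto

lemma borel_sets_of_Pow: "borel_sets_of S_top \<subseteq> Pow S"
  using borel_sets_of_sub by blast

lemma sigma_borel: "sigma_sets S (borel_sets_of S_top) = borel_sets_of S_top"
  unfolding borel_sets_of_def topspace_S
  by (rule sigma_sets_sigma_sets_eq) (use openin_subset[of S_top] in \<open>unfold topspace_S, blast\<close>)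

lemma sets_S: "sets S_mes = borel_sets_of S_top"
  unfolding borel_restriction_def topspace_S
  using borel_sets_of_Pow sigma_borel by (simp add: sets_measure_of)

lemma space_S: "space S_mes = S"
  unfolding borel_restriction_def topspace_S using borel_sets_of_Pow by (simp add: space_measure_of)

text \<open>\<open>measure_of\<close> reproduces the given set function only where that is countably
  additive, a property inherited here from the completed measure.\<close>

lemma emeasure_S:
  assumes "B \<in> borel_sets_of S_top"
  shows "emeasure S_mes B = emeasure (completion M) B"
proof (rule emeasure_measure_of[of S_mes "topspace S_top" "borel_sets_of S_top"])
  show "S_mes = measure_of (topspace S_top) (borel_sets_of S_top) (emeasure (completion M))"
    by (simp add: borel_restriction_def)
  show "borel_sets_of S_top \<subseteq> Pow (topspace S_top)" using borel_sets_of_Pow unfolding topspace_S .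
  show "positive (sets S_mes) (emeasure (completion M))" by (simp add: positive_def)
  show "countably_additive (sets S_mes) (emeasure (completion M))"
    unfolding sets_S using borel_sets_of_sub by (intro countably_additiveI suminf_emeasure) auto
  show "B \<in> sets S_mes" using assms sets_S by simp
qed

lemma openin_borel: "openin S_top U \<Longrightarrow> U \<in> borel_sets_of S_top"
  by (auto simp: borel_sets_of_def)

lemma sigma_algebra_S: "sigma_algebra S (borel_sets_of S_top)"
  using sets.sigma_algebra_axioms[of S_mes] unfolding sets_S space_S .

lemma closedin_borel: "closedin S_top U \<Longrightarrow> U \<in> borel_sets_of S_top"
proof -
  interpret sigma_algebra S "borel_sets_of S_top" by (rule sigma_algebra_S)
  assume "closedin S_top U"
  hence U: "openin S_top (S - U)" "U \<subseteq> S" using cell_subset by (auto simp: closedin_def Int_absorb1)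
  have "S - (S - U) \<in> borel_sets_of S_top" by (intro compl_sets openin_borel U)
  with U(2) show ?thesis by (simp add: double_diff)
qed

lemma prob_space_S: "prob_space S_mes"
proof
  have "S \<in> borel_sets_of S_top" using openin_borel[of S] by (metis openin_topspace topspace_S)
  thus "emeasure S_mes (space S_mes) = 1" unfolding space_S using emeasure_S unit by simp
qed

text \<open>For a subset of \<open>S\<close>, relative and ambient frontier differ only inside the
  frontier of \<open>S\<close>, which is null. From here on the boundary condition is read in the
  ambient space.\<close>

lemma measure_frontier_iff:
  assumes B: "B \<in> borel_sets_of S_top"
  shows "measure S_mes (S_top frontier_of B) = 0 \<longleftrightarrow> continuity_set X M B"
proof -
  let ?F = "S_top frontier_of B"
  have F: "?F \<in> borel_sets_of S_top" by (intro closedin_borel closedin_frontier_of)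
  have BS: "B \<subseteq> S" using borel_sets_of_sub[OF B] by simp
  interpret prob_space S_mes by (rule prob_space_S)
  have "measure S_mes ?F = 0 \<longleftrightarrow> emeasure (completion M) ?F = 0"
    unfolding emeasure_S[OF F, symmetric] by (simp add: emeasure_eq_measure)
  also have "\<dots> \<longleftrightarrow> ?F \<in> null_sets (completion M)"
    using borel_sets_of_sub[OF F] by (auto simp: null_sets_def)
  also have "\<dots> \<longleftrightarrow> continuity_set X M B"
  proof
    assume *: "?F \<in> null_sets (completion M)"
    have "?F \<union> X frontier_of S \<in> null_sets (completion M)"
      using * cell by (auto simp: continuity_set_def)
    from null_sets_completion_subset[OF frontier_of_subset_relative[OF BS cell_subset] this]
    show "continuity_set X M B" using BS cell_subset by (auto simp: continuity_set_def)
  next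
    assume *: "continuity_set X M B"
    have "?F \<subseteq> X frontier_of B"
      using frontier_of_subtopology_subset[of S X B] frontier_of_subset_topspace[of S_top B] by auto
    thus "?F \<in> null_sets (completion M)"
      using * null_sets_completion_subset by (auto simp: continuity_set_def)
  qed
  finally show ?thesis .
qed

text \<open>Only the trace of a set on the countable range of \<open>h\<close> matters, so a set with null frontier
  can be replaced by its interior together with countably many points, which is Borel.\<close>

lemma borel_representative:
  fixes h :: "int^'n \<Rightarrow> 'a"
  assumes G: "continuity_set X M G" "G \<subseteq> S"
  obtains B where "B \<in> borel_sets_of S_top" "continuity_set X M B" "h -` B = h -` G"
proof -
  interpret sigma_algebra S "borel_sets_of S_top" by (rule sigma_algebra_S)
  define B where "B = X interior_of G \<union> (G \<inter> range h)"
  have iG: "X interior_of G \<subseteq> G" by (rule interior_of_subset)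
  have "countable (range (vec_nth :: int^'n \<Rightarrow> _))"
    by (rule countable_subset[OF subset_UNIV countableI_type])
  moreover have "inj (vec_nth :: int^'n \<Rightarrow> _)" by (simp add: inj_on_def vec_nth_inject)
  ultimately have "countable (UNIV :: (int^'n) set)" by (rule countable_image_inj_on)
  hence "countable (G \<inter> range h)" by (intro countable_Int2 countable_image)
  moreover have "{g} \<in> borel_sets_of S_top" if "g \<in> G" for g
  proof (rule closedin_borel)
    have "closedin X {g}" using t1 that G cell_subset by (auto simp: t1_space_closedin_singleton)
        thus "closedin S_top {g}" using closedin_subset_topspace[of X "{g}" S] that G by auto
  qed
  ultimately have "(\<Union>g\<in>G \<inter> range h. {g}) \<in> borel_sets_of S_top"
    by (intro countable_UN' ) auto
  moreover have "X interior_of G \<in> borel_sets_of S_top"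
    using iG G openin_subtopology_Int2[OF openin_interior_of[of X G], of S]
    by (intro openin_borel) (auto simp: Int_absorb1)
  ultimately have 1: "B \<in> borel_sets_of S_top" unfolding B_def by auto
  have BG: "B \<subseteq> G" using iG by (auto simp: B_def)
  have "X interior_of G \<subseteq> X interior_of B"
    by (intro interior_of_maximal) (auto simp: B_def)
  hence "X frontier_of B \<subseteq> X frontier_of G"
    using closure_of_mono[OF BG, of X] by (auto simp: frontier_of_def)
  hence 2: "continuity_set X M B"
    using G BG null_sets_completion_subset by (auto simp: continuity_set_def)
  have "h -` B = h -` G" using iG by (auto simp: B_def)
  thus ?thesis using that 1 2 by blast
qed

text \<open>\<open>borel_representative\<close> removes the Borel condition, which makes the algebra
  comparable with classes defined by Jordan measurable sets.\<close>

lemma generated_algebra_eq: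
  "generated_algebra S_top S_mes h = {h -` B | B. B \<subseteq> S \<and> continuity_set X M B}"
proof
  show "generated_algebra S_top S_mes h \<subseteq> {h -` B | B. B \<subseteq> S \<and> continuity_set X M B}"
    unfolding generated_algebra_def using measure_frontier_iff borel_sets_of_sub by blast
  show "{h -` B | B. B \<subseteq> S \<and> continuity_set X M B} \<subseteq> generated_algebra S_top S_mes h"
  proof
    fix A assume "A \<in> {h -` B | B. B \<subseteq> S \<and> continuity_set X M B}"
    then obtain G where G: "A = h -` G" "G \<subseteq> S" "continuity_set X M G" by blast
    obtain B where "B \<in> borel_sets_of S_top" "continuity_set X M B" "h -` B = h -` G"
      using borel_representative[OF G(3,2)] by blast
    thus "A \<in> generated_algebra S_top S_mes h"
      unfolding generated_algebra_def using measure_frontier_iff G by blast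
  qed
qed

lemma distributed_mapI:
  assumes "metrizable_space X" "range h \<subseteq> S"
    and "\<And>B. B \<subseteq> S \<Longrightarrow> continuity_set X M B \<Longrightarrow>
           freq_measurable (h -` B) \<and> freq (h -` B) = measure (completion M) B"
  shows "distributed_map S_top S_mes h"
  unfolding distributed_map_def
proof (intro conjI ballI impI)
  fix B assume B: "B \<in> borel_sets_of S_top" "measure S_mes (S_top frontier_of B) = 0"
  have "freq_measurable (h -` B) \<and> freq (h -` B) = measure (completion M) B"
    using B measure_frontier_iff borel_sets_of_sub assms(3) by blast
  thus "freq_measurable (h -` B)" "freq (h -` B) = measure S_mes B"
    using emeasure_S[OF B(1)] by (auto simp: measure_def)
qed (use assms prob_space_S sets_S space_S metrizable_space_subtopology in \<open>simp_all only: topspace_S\<close>)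

text \<open>Continuity sets are stable under unions and under complement in \<open>S\<close>, and
  preimages under a map into \<open>S\<close> turn the latter into complements in the
  lattice.\<close>

lemma algebra_generated:
  assumes "range h \<subseteq> S"
  shows "algebra UNIV (generated_algebra S_top S_mes h)"
  unfolding generated_algebra_eq
proof (rule algebra_iff_Un[THEN iffD2], intro conjI ballI)
  show "{} \<in> {h -` B | B. B \<subseteq> S \<and> continuity_set X M B}"
    by (rule CollectI, rule exI[of _ "{}"]) simp
  show "UNIV - A \<in> {h -` B | B. B \<subseteq> S \<and> continuity_set X M B}"
    if A: "A \<in> {h -` B | B. B \<subseteq> S \<and> continuity_set X M B}" for A
  proof -
    obtain B where B: "A = h -` B" "B \<subseteq> S" "continuity_set X M B" using A by blast
    have "UNIV - A = h -` (S - B)" using assms unfolding B(1) by auto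
    moreover have "continuity_set X M (S - B)" by (rule continuity_set_Diff[OF cell B(3)])
    ultimately show ?thesis by (intro CollectI exI[of _ "S - B"]) simp
  qed
  show "A \<union> A' \<in> {h -` B | B. B \<subseteq> S \<and> continuity_set X M B}"
    if A: "A \<in> {h -` B | B. B \<subseteq> S \<and> continuity_set X M B}" "A' \<in> {h -` B | B. B \<subseteq> S \<and> continuity_set X M B}" for A A'
  proof -
    obtain B B' where B: "A = h -` B" "B \<subseteq> S" "continuity_set X M B" "A' = h -` B'" "B' \<subseteq> S" "continuity_set X M B'"
      using A by blast
    have "A \<union> A' = h -` (B \<union> B')" unfolding B(1,4) by auto
    thus ?thesis using continuity_set_Un[OF B(3,6)] B(2,5) by (intro CollectI exI[of _ "B \<union> B'"]) simp
  qed
qed auto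

end

section \<open>Jordan measurable sets and the mean of their lattice counts\<close>

lemma borel_topology_vec_space:
  assumes "finite I"
  shows "borel_topology (vec_space I) (PiM I (\<lambda>_. lborel))"
proof
  show "space (PiM I (\<lambda>_. lborel)) = topspace (vec_space I)"
    by (auto simp: space_PiM PiE_def)
qed (rule openin_vec_space_measurable[OF assms])

lemma jordan_measurable_on_iff:
  "jordan_measurable_on I G \<longleftrightarrow>
     continuity_set (vec_space I) (PiM I (\<lambda>_. lborel)) G \<and> (\<exists>r. \<forall>g\<in>G. \<forall>i\<in>I. \<bar>g i\<bar> \<le> r)"
  by (auto simp: jordan_measurable_on_def continuity_set_def mes_def)

lemma closedin_cube: "closedin (vec_space I) (\<Pi>\<^sub>E i\<in>I. {a..b})"
  by (simp add: vec_space_def closedin_product_topology)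

lemma openin_cube: "finite I \<Longrightarrow> openin (vec_space I) (\<Pi>\<^sub>E i\<in>I. {a<..<b})"
  by (simp add: vec_space_def openin_PiE)

lemma emeasure_closed_cube:
  assumes "finite I" "a \<le> b"
  shows "emeasure (PiM I (\<lambda>_. lborel)) (\<Pi>\<^sub>E i\<in>I. {a..b}) = ennreal ((b - a) ^ card I)"
  by (subst product_sigma_finite.emeasure_PiM[OF product_sigma_finite_lborel assms(1)])
     (use assms in \<open>auto simp: ennreal_power\<close>)

lemma emeasure_open_cube:
  assumes "finite I" "a \<le> b"
  shows "emeasure (PiM I (\<lambda>_. lborel)) (\<Pi>\<^sub>E i\<in>I. {a<..<b}) = ennreal ((b - a) ^ card I)"
  by (subst product_sigma_finite.emeasure_PiM[OF product_sigma_finite_lborel assms(1)])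
     (use assms in \<open>auto simp: ennreal_power\<close>)

text \<open>The frontier lies in the difference of the closed and the open cube, which have the same
  volume.\<close>

lemma jordan_measurable_cube:
  assumes I: "finite I" and ab: "a \<le> b"
  shows "jordan_measurable_on I (\<Pi>\<^sub>E i\<in>I. {a..<b})"
  unfolding jordan_measurable_on_iff
proof
  interpret borel_topology "vec_space I" "PiM I (\<lambda>_. lborel)" by (rule borel_topology_vec_space[OF I])
  let ?H = "\<Pi>\<^sub>E i\<in>I. {a..<b}" and ?K = "\<Pi>\<^sub>E i\<in>I. {a..b}" and ?U = "\<Pi>\<^sub>E i\<in>I. {a<..<b}"
  show "\<exists>r. \<forall>g\<in>?H. \<forall>i\<in>I. \<bar>g i\<bar> \<le> r"
    by (rule exI[of _ "\<bar>a\<bar> + \<bar>b\<bar>"]) (fastforce simp: PiE_iff)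
  have "vec_space I closure_of ?H \<subseteq> ?K"
    by (intro closure_of_minimal closedin_cube PiE_mono) auto
  moreover have "?U \<subseteq> vec_space I interior_of ?H"
    by (intro interior_of_maximal openin_cube I PiE_mono) auto
  ultimately have fr: "vec_space I frontier_of ?H \<subseteq> ?K - ?U" by (auto simp: frontier_of_def)
  have KU: "?K \<in> sets (PiM I (\<lambda>_. lborel))" "?U \<in> sets (PiM I (\<lambda>_. lborel))"
    by (intro closedin_sets closedin_cube openin_sets openin_cube I)+
  have "emeasure (PiM I (\<lambda>_. lborel)) (?K - ?U)
      = emeasure (PiM I (\<lambda>_. lborel)) ?K - emeasure (PiM I (\<lambda>_. lborel)) ?U"
    by (intro emeasure_Diff KU PiE_mono) (auto simp: emeasure_open_cube[OF I ab])
  also have "\<dots> = 0" unfolding emeasure_open_cube[OF I ab] emeasure_closed_cube[OF I ab] by simp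
  finally have "?K - ?U \<in> null_sets (PiM I (\<lambda>_. lborel))" using KU by auto
  hence "vec_space I frontier_of ?H \<in> null_sets (completion (PiM I (\<lambda>_. lborel)))"
    using fr by (meson null_sets_completion_subset null_sets_completionI)
  thus "continuity_set (vec_space I) (PiM I (\<lambda>_. lborel)) ?H"
    by (auto simp: continuity_set_def PiE_def)
qed

lemma jordan_measurable_on_subset:
  assumes "continuity_set (vec_space I) (PiM I (\<lambda>_. lborel)) A" "jordan_measurable_on I B" "A \<subseteq> B"
  shows "jordan_measurable_on I A"
  using assms unfolding jordan_measurable_on_iff by blast

text \<open>The closure of \<open>G\<close> is closed, bounded and of the same volume, which gives
  the upper bound. For the lower bound, \<open>G\<close> is complemented in an integer cube of
  constant count, and the complement is covered by a closed set: the closed cube minus the interior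
  of \<open>G\<close>.\<close>

theorem jordan_upper_mean:
  fixes \<Lambda> :: "'i \<Rightarrow> real^'n"
  assumes I: "finite I" and nr: "nonresonant I \<Lambda>" and G: "jordan_measurable_on I G"
  shows "upper_mean_le (\<lambda>x. real (lattice_count I G (\<lambda>i. \<Lambda> i \<bullet> real_vec x))) (measure (mes I) G)"
    and "upper_mean_le (\<lambda>x. - real (lattice_count I G (\<lambda>i. \<Lambda> i \<bullet> real_vec x))) (- measure (mes I) G)"
proof -
  interpret borel_topology "vec_space I" "PiM I (\<lambda>_. lborel)" by (rule borel_topology_vec_space[OF I])
  obtain r where cG: "continuity_set (vec_space I) (PiM I (\<lambda>_. lborel)) G" and r: "\<forall>g\<in>G. \<forall>i\<in>I. \<bar>g i\<bar> \<le> r"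
    using G unfolding jordan_measurable_on_iff by blast
  let ?M = "PiM I (\<lambda>_. lborel) :: ('i \<Rightarrow> real) measure"
  \<comment> \<open>An integer strictly above the bound of \<open>G\<close>, so that
    \<open>G\<close> fits into the half-open cube \<open>?H\<close>.\<close>
  define R where "R = nat \<lceil>\<bar>r\<bar>\<rceil> + 1"
  have R: "r < real R" unfolding R_def by linarith
  let ?H = "\<Pi>\<^sub>E i\<in>I. {- real R..<real R}" and ?K = "\<Pi>\<^sub>E i\<in>I. {- real R..real R}"
  have Ge: "G \<subseteq> extensional I" using cG by (auto simp: continuity_set_def)
  have GH: "G \<subseteq> ?H"
  proof
    fix g assume g: "g \<in> G"
    have "- real R \<le> g i \<and> g i < real R" if "i \<in> I" for i
      using r g that R by (fastforce simp: abs_le_iff)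
    thus "g \<in> ?H" using g Ge by (auto simp: PiE_iff)
  qed
  have HK: "?H \<subseteq> ?K" by (intro PiE_mono) auto
  have bK: "\<forall>g\<in>?K. \<forall>i\<in>I. \<bar>g i\<bar> \<le> real R" by (fastforce simp: PiE_iff abs_le_iff)
  let ?C = "vec_space I closure_of G"
  have CK: "?C \<subseteq> ?K" using GH HK by (intro closure_of_minimal closedin_cube) auto
  have bC: "\<forall>g\<in>?C. \<forall>i\<in>I. \<bar>g i\<bar> \<le> real R" using CK bK by blast
  have "upper_mean_le (\<lambda>x. real (lattice_count I ?C (\<lambda>i. \<Lambda> i \<bullet> real_vec x))) (measure ?M ?C)"
    by (rule upper_mean_compact[OF I nr closedin_closure_of bC])
  thus "upper_mean_le (\<lambda>x. real (lattice_count I G (\<lambda>i. \<Lambda> i \<bullet> real_vec x))) (measure (mes I) G)"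
  proof (rule upper_mean_le_mono)
    show "measure ?M ?C \<le> measure (mes I) G" using measure_closure[OF cG] by (simp add: mes_def)
    show "real (lattice_count I G (\<lambda>i. \<Lambda> i \<bullet> real_vec x)) \<le> real (lattice_count I ?C (\<lambda>i. \<Lambda> i \<bullet> real_vec x))" for x
      unfolding of_nat_le_iff using closure_of_subset[of G "vec_space I"] Ge
      by (intro lattice_count_mono[OF I bC]) auto
  qed
  let ?D = "?K - vec_space I interior_of G"
  have cD: "closedin (vec_space I) ?D" by (intro closedin_diff closedin_cube openin_interior_of)
  have bD: "\<forall>g\<in>?D. \<forall>i\<in>I. \<bar>g i\<bar> \<le> real R" using bK by blast
  \<comment> \<open>The subtracted number is at once the constant count of \<open>?H\<close> and the
    volume of \<open>?K\<close>.\<close>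
  have "upper_mean_le (\<lambda>x. real (lattice_count I ?D (\<lambda>i. \<Lambda> i \<bullet> real_vec x)) + - ((2 * real R) ^ card I))
          (measure ?M ?D + - ((2 * real R) ^ card I))"
    by (intro upper_mean_le_add upper_mean_le_const upper_mean_compact[OF I nr cD bD]) auto
  thus "upper_mean_le (\<lambda>x. - real (lattice_count I G (\<lambda>i. \<Lambda> i \<bullet> real_vec x))) (- measure (mes I) G)"
  proof (rule upper_mean_le_mono)
    have Kf: "emeasure ?M ?K = ennreal ((2 * real R) ^ card I)"
      by (subst emeasure_closed_cube[OF I]) auto
    have "measure ?M ?D = measure ?M ?K - measure ?M (vec_space I interior_of G)"
      using interior_of_subset[of "vec_space I" G] GH HK Kf
      by (intro measure_Diff closedin_sets closedin_cube openin_sets openin_interior_of) auto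
    moreover have "measure ?M ?K = (2 * real R) ^ card I" using Kf by (simp add: measure_def)
    ultimately show "measure ?M ?D + - ((2 * real R) ^ card I) \<le> - measure (mes I) G"
      using measure_interior[OF cG] by (simp add: mes_def)
    fix x :: "int^'n"
    let ?y = "\<lambda>i. \<Lambda> i \<bullet> real_vec x"
    have bH: "\<forall>g\<in>?H. \<forall>i\<in>I. \<bar>g i\<bar> \<le> real R" using bK HK by blast
    have "(2 * R) ^ card I = lattice_count I G ?y + lattice_count I (?H - G) ?y"
      using lattice_count_diff[OF I bH GH, of ?y] lattice_count_int_cube[OF I, of R ?y] by simp
    also have "lattice_count I (?H - G) ?y \<le> lattice_count I ?D ?y"
      using interior_of_subset[of "vec_space I" G] HK by (intro lattice_count_mono[OF I bD]) auto
    finally have "(2 * R) ^ card I \<le> lattice_count I G ?y + lattice_count I ?D ?y" by simp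
    hence "real ((2 * R) ^ card I) \<le> real (lattice_count I G ?y + lattice_count I ?D ?y)"
      unfolding of_nat_le_iff .
    thus "- real (lattice_count I G ?y) \<le> real (lattice_count I ?D ?y) + - ((2 * real R) ^ card I)"
      by simp
  qed
qed

section \<open>Volume preserving maps\<close>

text \<open>Continuity is included because frontiers have to be transported along with
  volumes.\<close>

definition volume_preserving :: "'i set \<Rightarrow> (('i \<Rightarrow> real) \<Rightarrow> ('i \<Rightarrow> real)) \<Rightarrow> bool" where
  "volume_preserving I T \<longleftrightarrow> continuous_map (vec_space I) (vec_space I) T
     \<and> T \<in> measurable (PiM I (\<lambda>_. lborel)) (PiM I (\<lambda>_. lborel))
     \<and> distr (PiM I (\<lambda>_. lborel)) (PiM I (\<lambda>_. lborel)) T = PiM I (\<lambda>_. lborel)"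

lemma volume_preserving_comp:
  assumes "volume_preserving I S" "volume_preserving I T"
  shows "volume_preserving I (S \<circ> T)"
  using assms continuous_map_compose[of "vec_space I" "vec_space I" T "vec_space I" S]
    distr_distr[of S "PiM I (\<lambda>_. lborel)" "PiM I (\<lambda>_. lborel)" T "PiM I (\<lambda>_. lborel)"]
  by (auto simp: volume_preserving_def intro: measurable_comp)

lemma volume_preserving_vimage:
  assumes "finite I" "volume_preserving I T" "continuity_set (vec_space I) (PiM I (\<lambda>_. lborel)) B"
  shows "continuity_set (vec_space I) (PiM I (\<lambda>_. lborel)) {v \<in> extensional I. T v \<in> B}"
    and "measure (mes I) {v \<in> extensional I. T v \<in> B} = measure (mes I) B"
  using borel_topology.emeasure_vimage[OF borel_topology_vec_space borel_topology_vec_space, OF assms(1,1) _ _ _ assms(3), of T]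
    assms(2) unfolding volume_preserving_def mes_def measure_def by auto

lemma continuous_map_vec_space:
  "continuous_map X (vec_space I) f \<longleftrightarrow>
     f \<in> topspace X \<rightarrow> extensional I \<and> (\<forall>i\<in>I. continuous_map X euclideanreal (\<lambda>x. f x i))"
  unfolding vec_space_def continuous_map_componentwise by auto

lemma continuous_map_coordinate: "i \<in> I \<Longrightarrow> continuous_map (vec_space I) euclideanreal (\<lambda>v. v i)"
  unfolding vec_space_def by (rule continuous_map_product_projection)

lemma continuous_map_borel:
  assumes "finite I" "continuous_map (vec_space I) euclideanreal g"
  shows "g \<in> borel_measurable (PiM I (\<lambda>_. lborel))"
proof (rule borel_measurableI)
  fix U :: "real set" assume "open U"
  hence "openin (vec_space I) {x \<in> topspace (vec_space I). g x \<in> U}"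
    using assms(2) by (intro openin_continuous_map_preimage[of _ euclideanreal]) auto
  hence "{x \<in> extensional I. g x \<in> U} \<in> sets (PiM I (\<lambda>_. lborel))"
    using openin_vec_space_measurable[OF assms(1)] by simp
  moreover have "g -` U \<inter> space (PiM I (\<lambda>_. lborel)) = {x \<in> extensional I. g x \<in> U}"
    by (auto simp: space_PiM PiE_def)
  ultimately show "g -` U \<inter> space (PiM I (\<lambda>_. lborel)) \<in> sets (PiM I (\<lambda>_. lborel))" by simp
qed

text \<open>Fubini with coordinate \<open>c\<close> as the inner variable: when the others are
  fixed, the map translates \<open>c\<close> by a constant.\<close>

lemma distr_shear:
  fixes g :: "('i \<Rightarrow> real) \<Rightarrow> real"
  assumes I: "finite I" "c \<in> I" and g [measurable]: "g \<in> borel_measurable (PiM I (\<lambda>_. lborel))"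
    and indep: "\<And>v t. v \<in> extensional I \<Longrightarrow> g (v(c := t)) = g v"
  shows "(\<lambda>v. v(c := v c + g v)) \<in> measurable (PiM I (\<lambda>_. lborel)) (PiM I (\<lambda>_. lborel))"
    and "distr (PiM I (\<lambda>_. lborel)) (PiM I (\<lambda>_. lborel)) (\<lambda>v. v(c := v c + g v)) = PiM I (\<lambda>_. lborel)"
proof -
  let ?M = "PiM I (\<lambda>_. lborel) :: ('i \<Rightarrow> real) measure"
  let ?T = "\<lambda>v. v(c := v c + g v)"
  have [measurable]: "(\<lambda>v. v c) \<in> borel_measurable ?M"
    using measurable_component_singleton[OF I(2), of "\<lambda>_. lborel :: real measure"] by simp
  show T [measurable]: "?T \<in> measurable ?M ?M"
    using I by (intro measurable_fun_upd[where J = I]) auto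
  define J where "J = I - {c}"
  have J: "finite J" "c \<notin> J" "I = insert c J" using I by (auto simp: J_def)
  interpret product_sigma_finite "\<lambda>_ :: 'i. lborel :: real measure" by (rule product_sigma_finite_lborel)
  show "distr ?M ?M ?T = ?M"
  proof (rule measure_eqI)
    fix A assume "A \<in> sets (distr ?M ?M ?T)"
    hence A [measurable]: "A \<in> sets ?M" by simp
    have "emeasure (distr ?M ?M ?T) A = (\<integral>\<^sup>+ v. indicator A v \<partial>distr ?M ?M ?T)" by simp
    also have "\<dots> = (\<integral>\<^sup>+ v. indicator A (?T v) \<partial>?M)" by (rule nn_integral_distr[OF T]) simp
    also have "\<dots> = (\<integral>\<^sup>+ x. (\<integral>\<^sup>+ y. indicator A (?T (x(c := y))) \<partial>lborel) \<partial>PiM J (\<lambda>_. lborel))"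
      unfolding J(3) using A T unfolding J(3) by (intro product_nn_integral_insert J measurable_compose[OF T[unfolded J(3)]]) auto
    also have "\<dots> = (\<integral>\<^sup>+ x. (\<integral>\<^sup>+ y. indicator A (x(c := y)) \<partial>lborel) \<partial>PiM J (\<lambda>_. lborel))"
    proof (rule nn_integral_cong)
      fix x assume "x \<in> space (PiM J (\<lambda>_. lborel :: real measure))"
      hence x: "x \<in> extensional J" by (auto simp: space_PiM PiE_def)
      have x0: "x(c := 0) \<in> extensional I" using x by (auto simp: J extensional_def)
      \<comment> \<open>The value 0 in slot \<open>c\<close> is a dummy, since \<open>g\<close> does
        not see that coordinate.\<close>
      define d where "d = g (x(c := 0))"
      have "g (x(c := y)) = d" for y using indep[OF x0, of y] by (simp add: d_def)
      hence "(\<integral>\<^sup>+ y. indicator A (?T (x(c := y))) \<partial>lborel) = (\<integral>\<^sup>+ y. indicator A (x(c := d + 1 * y)) \<partial>lborel)"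
        by (simp add: add.commute)
      also have "\<dots> = (\<integral>\<^sup>+ y. indicator A (x(c := y)) \<partial>lborel)"
      proof -
        have "(\<lambda>y. x(c := y)) \<in> measurable lborel ?M" unfolding J(3)
          using x J(2) by (intro measurable_component_update) (auto simp: space_PiM PiE_def)
        from measurable_compose[OF this borel_measurable_indicator[OF A]]
        have "(\<lambda>y. indicator A (x(c := y)) :: ennreal) \<in> borel_measurable borel"
          unfolding measurable_lborel2 .
        from nn_integral_real_affine[OF this, of 1 d] show ?thesis by simp
      qed
      finally show "(\<integral>\<^sup>+ y. indicator A (?T (x(c := y))) \<partial>lborel) = (\<integral>\<^sup>+ y. indicator A (x(c := y)) \<partial>lborel)" .
    qed
    also have "\<dots> = (\<integral>\<^sup>+ v. indicator A v \<partial>?M)"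
      unfolding J(3) using A unfolding J(3) by (intro product_nn_integral_insert[symmetric] J) auto
    also have "\<dots> = emeasure ?M A" by simp
    finally show "emeasure (distr ?M ?M ?T) A = emeasure ?M A" .
  qed simp
qed

text \<open>The map is a composition of shears, one for each coordinate.\<close>

lemma volume_preserving_triangular:
  fixes g :: "'i \<Rightarrow> ('i \<Rightarrow> real) \<Rightarrow> real" and rank :: "'i \<Rightarrow> nat"
  assumes I: "finite I" and g: "\<And>c. c \<in> I \<Longrightarrow> continuous_map (vec_space I) euclideanreal (g c)"
    and dep: "\<And>c v w. c \<in> I \<Longrightarrow> v \<in> extensional I \<Longrightarrow> w \<in> extensional I \<Longrightarrow>
                (\<And>d. d \<in> I \<Longrightarrow> rank d < rank c \<Longrightarrow> v d = w d) \<Longrightarrow> g c v = g c w"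
  shows "volume_preserving I (\<lambda>v. \<lambda>c\<in>I. v c + g c v)"
proof -
  let ?M = "PiM I (\<lambda>_. lborel) :: ('i \<Rightarrow> real) measure"
  have space: "space ?M = extensional I" by (auto simp: space_PiM PiE_def)
  define T where "T J v = (\<lambda>c\<in>I. if c \<in> J then v c + g c v else v c)" for J v
  have Te: "T J v \<in> extensional I" for J v by (simp add: T_def)
  have g_meas: "g c \<in> borel_measurable ?M" if "c \<in> I" for c by (rule continuous_map_borel[OF I g[OF that]])
  have "J \<subseteq> I \<longrightarrow> T J \<in> measurable ?M ?M \<and> distr ?M ?M (T J) = ?M" if "finite J" for J
    using that
  \<comment> \<open>The negative sign treats coordinates by decreasing rank: when \<open>c\<close>
    is reached, the coordinates of smaller rank on which \<open>g c\<close> depends are still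
    unchanged.\<close>
  proof (induction J rule: finite_ranking_induct[where f = "\<lambda>c. - int (rank c)"])
    case empty
    have *: "T {} v = v" if "v \<in> space ?M" for v
      using that unfolding space T_def by (auto simp: extensional_def)
    have "T {} \<in> measurable ?M ?M" using measurable_cong[of ?M "T {}" "\<lambda>v. v" ?M] * by simp
    moreover have "distr ?M ?M (T {}) = distr ?M ?M (\<lambda>v. v)" by (rule distr_cong) (simp_all add: *)
    ultimately show ?case by simp
  next
    case (insert c J)
    show ?case
    proof (cases "c \<in> J")
      case True
      thus ?thesis using insert by (simp add: insert_absorb)
    next
      case cJ: False
      show ?thesis
      proof
        assume cI: "insert c J \<subseteq> I"
        hence c: "c \<in> I" and TJ: "T J \<in> measurable ?M ?M" "distr ?M ?M (T J) = ?M"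
          using insert.IH by auto
        let ?S = "\<lambda>v. v(c := v c + g c v)"
        have S: "?S \<in> measurable ?M ?M" "distr ?M ?M ?S = ?M"
        proof -
          have "g c (v(c := t)) = g c v" if "v \<in> extensional I" for v t
            using that c by (intro dep) (auto simp: extensional_def)
          thus "?S \<in> measurable ?M ?M" "distr ?M ?M ?S = ?M"
            using distr_shear[OF I c g_meas[OF c]] by blast+
        qed
        have eq: "T (insert c J) v = (?S \<circ> T J) v" if v: "v \<in> space ?M" for v
        proof -
          have "g c (T J v) = g c v"
          proof (rule dep[OF c Te])
            show "v \<in> extensional I" using v space by simp
            fix d assume d: "d \<in> I" "rank d < rank c"
            hence "d \<notin> J" using insert.hyps(2)[of d] by auto
            thus "T J v d = v d" using d by (simp add: T_def)
          qed
          thus ?thesis using c cJ by (auto simp: T_def fun_eq_iff)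
        qed
        have "?S \<circ> T J \<in> measurable ?M ?M" using S(1) TJ(1) by (rule measurable_comp[rotated])
        moreover have "distr ?M ?M (?S \<circ> T J) = ?M"
          using distr_distr[OF S(1) TJ(1)] S(2) TJ(2) by simp
        ultimately show "T (insert c J) \<in> measurable ?M ?M \<and> distr ?M ?M (T (insert c J)) = ?M"
          using measurable_cong[of ?M "T (insert c J)" "?S \<circ> T J" ?M] eq
            distr_cong[of ?M ?M ?M ?M "T (insert c J)" "?S \<circ> T J"] by simp
      qed
    qed
  qed
  from this[OF I] have "T I \<in> measurable ?M ?M \<and> distr ?M ?M (T I) = ?M" by simp
  moreover have "T I = (\<lambda>v. \<lambda>c\<in>I. v c + g c v)" by (auto simp: T_def fun_eq_iff)
  moreover have "continuous_map (vec_space I) (vec_space I) (\<lambda>v. \<lambda>c\<in>I. v c + g c v)"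
    unfolding continuous_map_vec_space
    using g by (auto intro!: continuous_map_add continuous_map_coordinate)
  ultimately show ?thesis unfolding volume_preserving_def by simp
qed

text \<open>It suffices to compare the measures on rectangles, where the factors of a product are
  merely permuted.\<close>

lemma volume_preserving_permute:
  assumes I: "finite I" and p: "bij_betw p I I"
  shows "volume_preserving I (\<lambda>v. \<lambda>c\<in>I. v (p c))"
proof -
  let ?M = "PiM I (\<lambda>_. lborel) :: ('a \<Rightarrow> real) measure"
  let ?T = "\<lambda>v :: 'a \<Rightarrow> real. \<lambda>c\<in>I. v (p c)"
  interpret product_sigma_finite "\<lambda>_ :: 'a. lborel :: real measure" by (rule product_sigma_finite_lborel)
  have pI: "p c \<in> I" if "c \<in> I" for c using p that by (auto simp: bij_betw_def)
  have T: "?T \<in> measurable ?M ?M"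
    by (intro measurable_restrict measurable_component_singleton pI)
  have "?M = distr ?M ?M ?T"
  proof (rule PiM_eqI[OF I, symmetric])
    fix A assume A: "\<And>i. i \<in> I \<Longrightarrow> A i \<in> sets (lborel :: real measure)"
    define q where "q = the_inv_into I p"
    have q: "q (p c) = c" "q c \<in> I" "p (q c) = c" if "c \<in> I" for c
      using p that by (auto simp: q_def bij_betw_def the_inv_into_f_f f_the_inv_into_f intro: the_inv_into_into)
    have "emeasure (distr ?M ?M ?T) (Pi\<^sub>E I A) = emeasure ?M (?T -` Pi\<^sub>E I A \<inter> space ?M)"
      using A I by (intro emeasure_distr T sets_PiM_I_finite) auto
    also have "?T -` Pi\<^sub>E I A \<inter> space ?M = Pi\<^sub>E I (A \<circ> q)"
    proof (intro equalityI subsetI)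
      fix v assume v: "v \<in> ?T -` Pi\<^sub>E I A \<inter> space ?M"
      have "v c \<in> A (q c)" if "c \<in> I" for c
      proof -
        have "?T v (q c) \<in> A (q c)" using v q(2)[OF that] by (metis IntD1 PiE_mem vimageD)
        thus ?thesis using q[OF that] by simp
      qed
      thus "v \<in> Pi\<^sub>E I (A \<circ> q)" using v by (auto simp: space_PiM PiE_iff)
    next
      fix v assume v: "v \<in> Pi\<^sub>E I (A \<circ> q)"
      have "v (p c) \<in> A c" if "c \<in> I" for c using PiE_mem[OF v pI[OF that]] q(1)[OF that] by simp
      thus "v \<in> ?T -` Pi\<^sub>E I A \<inter> space ?M" using v by (auto simp: space_PiM PiE_iff)
    qed
    also have "emeasure ?M \<dots> = (\<Prod>c\<in>I. emeasure lborel ((A \<circ> q) c))"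
      using A q by (intro emeasure_PiM I) auto
    also have "\<dots> = (\<Prod>c\<in>I. emeasure lborel (A c))"
      using prod.reindex_bij_betw[OF p, of "\<lambda>c. emeasure lborel (A (q c))"] q by (simp cong: prod.cong)
    finally show "emeasure (distr ?M ?M ?T) (Pi\<^sub>E I A) = (\<Prod>c\<in>I. emeasure lborel (A c))" .
  qed simp
  moreover have "continuous_map (vec_space I) (vec_space I) ?T"
    unfolding continuous_map_vec_space
    using pI by (auto intro!: continuous_map_coordinate)
  ultimately show ?thesis unfolding volume_preserving_def using T by simp
qed

text \<open>Of two bounded sets, only finitely many integer translates of one meet the other, so
  this is a finite union. It moves Jordan sets between two fundamental domains: the unit cube and
  the preimage of the cell product under \<open>decode\<close>.\<close>

lemma jordan_measurable_translates:
  fixes G H :: "('i \<Rightarrow> real) set"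
  assumes I: "finite I" and H: "jordan_measurable_on I H" and G: "jordan_measurable_on I G"
  shows "jordan_measurable_on I {h \<in> H. \<exists>z :: 'i \<Rightarrow> int. (\<lambda>i\<in>I. h i + of_int (z i)) \<in> G}"
proof -
  obtain r where r: "\<forall>h\<in>H. \<forall>i\<in>I. \<bar>h i\<bar> \<le> r" using H unfolding jordan_measurable_on_iff by blast
  obtain s where s: "\<forall>g\<in>G. \<forall>i\<in>I. \<bar>g i\<bar> \<le> s" using G unfolding jordan_measurable_on_iff by blast
  \<comment> \<open>A relevant \<open>z i\<close> is the difference of a coordinate bounded by
    \<open>s\<close> and one bounded by \<open>r\<close>.\<close>
  define F where "F = (\<Pi>\<^sub>E i\<in>I. {- \<lceil>r + s\<rceil>..\<lceil>r + s\<rceil>})"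
  have F: "finite F" unfolding F_def using I by (intro finite_PiE) auto
  have "{h \<in> H. \<exists>z :: 'i \<Rightarrow> int. (\<lambda>i\<in>I. h i + of_int (z i)) \<in> G}
      = (\<Union>z\<in>F. H \<inter> {v \<in> extensional I. (\<lambda>i\<in>I. v i + real_of_int (z i)) \<in> G})" (is "?L = ?R")
  proof
    show "?R \<subseteq> ?L" by blast
    show "?L \<subseteq> ?R"
    proof
      fix h assume "h \<in> ?L"
      then obtain z :: "'i \<Rightarrow> int" where h: "h \<in> H" and z: "(\<lambda>i\<in>I. h i + of_int (z i)) \<in> G" by blast
      have "- \<lceil>r + s\<rceil> \<le> z i \<and> z i \<le> \<lceil>r + s\<rceil>" if "i \<in> I" for i
      proof -
        have "\<bar>h i\<bar> \<le> r" "\<bar>h i + of_int (z i)\<bar> \<le> s" using r h s z that by fastforce+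
        thus ?thesis by linarith
      qed
      hence "restrict z I \<in> F" by (auto simp: F_def)
      moreover have "(\<lambda>i\<in>I. h i + real_of_int (restrict z I i)) = (\<lambda>i\<in>I. h i + of_int (z i))" by auto
      moreover have "h \<in> extensional I" using H h by (auto simp: jordan_measurable_on_def)
      ultimately have "h \<in> H \<inter> {v \<in> extensional I. (\<lambda>i\<in>I. v i + real_of_int (restrict z I i)) \<in> G}"
        using h z by simp
      thus "h \<in> ?R" using \<open>restrict z I \<in> F\<close> by blast
    qed
  qed
  moreover have "continuity_set (vec_space I) (PiM I (\<lambda>_. lborel)) ?R"
  proof (intro continuity_set_UN F continuity_set_Int)
    fix z :: "'i \<Rightarrow> int"
    have "volume_preserving I (\<lambda>v. \<lambda>i\<in>I. v i + real_of_int (z i))"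
      by (rule volume_preserving_triangular[OF I, where rank = "\<lambda>_. 0"]) auto
    from volume_preserving_vimage(1)[OF I this]
    show "continuity_set (vec_space I) (PiM I (\<lambda>_. lborel)) {v \<in> extensional I. (\<lambda>i\<in>I. v i + real_of_int (z i)) \<in> G}"
      using G unfolding jordan_measurable_on_iff by blast
  qed (use H in \<open>auto simp: jordan_measurable_on_iff\<close>)
  ultimately show ?thesis using jordan_measurable_on_subset[OF _ H] by auto
qed

section \<open>Blocks of stacked vectors\<close>

lemma borel_topology_euclidean: "borel_topology euclidean (lborel :: 'a::euclidean_space measure)"
  by unfold_locales auto

lemma emeasure_lborel_vec_box:
  fixes A :: "'n::finite \<Rightarrow> real set"
  assumes A: "\<And>i. A i \<in> sets borel"
  shows "emeasure lborel {x :: real^'n. \<forall>i. x $ i \<in> A i} = (\<Prod>i\<in>UNIV. emeasure lborel (A i))"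
proof -
  \<comment> \<open>Inverts the enumeration of the standard basis, so that products over
    \<open>Basis\<close> become products over indices.\<close>
  define j where "j b = (THE i. b = axis i (1::real))" for b :: "real^'n"
  have j: "j (axis i 1) = i" for i unfolding j_def by (rule the_equality) (auto simp: axis_eq_axis)
  have B: "(Basis :: (real^'n) set) = range (\<lambda>i. axis i 1)" by (auto simp: Basis_vec_def)
  have inj: "inj (\<lambda>i :: 'n. axis i (1::real))" by (auto simp: inj_def axis_eq_axis)
  have "{x :: real^'n. \<forall>i. x $ i \<in> A i} = (\<Inter>i\<in>UNIV. (\<lambda>x. x $ i) -` A i \<inter> space borel)" by auto
  also have "\<dots> \<in> sets borel"
    by (intro sets.finite_INT measurable_sets[of _ borel borel] borel_measurable_continuous_onI A
        continuous_intros) auto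
  finally have meas: "{x :: real^'n. \<forall>i. x $ i \<in> A i} \<in> sets borel" .
  have "(\<integral>\<^sup>+ x. (\<Prod>b\<in>Basis. indicator (A (j b)) (x \<bullet> b)) \<partial>(lborel :: (real^'n) measure))
      = (\<Prod>b\<in>Basis. \<integral>\<^sup>+ t. indicator (A (j b)) t \<partial>lborel)"
    using A by (intro nn_integral_lborel_prod) auto
  also have "\<dots> = (\<Prod>b\<in>Basis. emeasure lborel (A (j b)))" using A by simp
  also have "\<dots> = (\<Prod>i\<in>UNIV. emeasure lborel (A i))"
    unfolding B by (subst prod.reindex[OF inj]) (simp add: j)
  also have "(\<lambda>x :: real^'n. \<Prod>b\<in>Basis. indicator (A (j b)) (x \<bullet> b) :: ennreal)
      = indicator {x. \<forall>i. x $ i \<in> A i}"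
  proof
    fix x :: "real^'n"
    have "(\<Prod>b\<in>Basis. indicator (A (j b)) (x \<bullet> b) :: ennreal) = (\<Prod>i\<in>UNIV. indicator (A i) (x $ i))"
      unfolding B by (subst prod.reindex[OF inj]) (simp add: j inner_axis)
    also have "\<dots> = indicator {x. \<forall>i. x $ i \<in> A i} x"
      by (auto simp: indicator_def prod.If_cases intro!: prod.neutral prod_zero)
    finally show "(\<Prod>b\<in>Basis. indicator (A (j b)) (x \<bullet> b) :: ennreal) = indicator {x. \<forall>i. x $ i \<in> A i} x" .
  qed
  finally show ?thesis using meas by simp
qed

lemma finite_stack_index [simp]: "finite (stack_index N :: (nat \<times> 'n::finite) set)"
  by (simp add: stack_index_def)

lemma mem_stack_index [simp]: "(k, i) \<in> stack_index N \<longleftrightarrow> 1 \<le> k \<and> k \<le> N"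
  by (auto simp: stack_index_def)

definition block_product :: "nat \<Rightarrow> (nat \<Rightarrow> (real^'n) set) \<Rightarrow> (nat \<times> 'n \<Rightarrow> real) set" where
  "block_product N B = {v \<in> extensional (stack_index N). \<forall>k\<in>{1..N}. (\<chi> i. v (k, i)) \<in> B k}"

lemma set_power_eq: "set_power C N = block_product N (\<lambda>_. C)"
  by (simp add: set_power_def block_product_def)

text \<open>Flattening \<open>N\<close> vectors into one family of coordinates carries product
  measure to product measure, as boxes show. Measurability is assumed because it will be supplied by
  openness or closedness.\<close>

lemma emeasure_block_product:
  fixes B :: "nat \<Rightarrow> (real^'n) set"
  assumes B: "\<And>k. k \<in> {1..N} \<Longrightarrow> B k \<in> sets borel"
    and meas: "block_product N B \<in> sets (PiM (stack_index N) (\<lambda>_. lborel))"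
  shows "emeasure (PiM (stack_index N) (\<lambda>_. lborel)) (block_product N B) = (\<Prod>k=1..N. emeasure lborel (B k))"
proof -
  let ?I = "stack_index N :: (nat \<times> 'n) set"
  let ?P = "PiM {1..N} (\<lambda>_. lborel) :: (nat \<Rightarrow> real^'n) measure"
  let ?M = "PiM ?I (\<lambda>_. lborel) :: (nat \<times> 'n \<Rightarrow> real) measure"
  let ?f = "\<lambda>w :: nat \<Rightarrow> real^'n. \<lambda>c\<in>?I. w (fst c) $ snd c"
  interpret V: product_sigma_finite "\<lambda>_ :: nat. lborel :: (real^'n) measure" by (rule product_sigma_finite_lborel)
  interpret R: product_sigma_finite "\<lambda>_ :: nat \<times> 'n. lborel :: real measure" by (rule product_sigma_finite_lborel)
  have f: "?f \<in> measurable ?P ?M"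
  proof (rule measurable_restrict)
    fix c assume "c \<in> ?I"
    hence "(\<lambda>w. w (fst c)) \<in> measurable ?P (lborel :: (real^'n) measure)"
      by (intro measurable_component_singleton) (auto simp: stack_index_def)
    moreover have "(\<lambda>x :: real^'n. x $ snd c) \<in> measurable lborel lborel"
      by (simp add: borel_measurable_continuous_onI continuous_intros)
    ultimately show "(\<lambda>w. w (fst c) $ snd c) \<in> measurable ?P (lborel :: real measure)"
      by (rule measurable_compose)
  qed
  have "distr ?P ?M ?f = ?M"
  proof (rule R.PiM_eqI[OF finite_stack_index])
    fix A assume A: "\<And>i. i \<in> ?I \<Longrightarrow> A i \<in> sets (lborel :: real measure)"
    have "?f -` Pi\<^sub>E ?I A \<inter> space ?P = (\<Pi>\<^sub>E k\<in>{1..N}. {x. \<forall>i. x $ i \<in> A (k, i)})"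
      by (auto simp: space_PiM PiE_iff stack_index_def)
    moreover have "emeasure (distr ?P ?M ?f) (Pi\<^sub>E ?I A) = emeasure ?P (?f -` Pi\<^sub>E ?I A \<inter> space ?P)"
      using A by (intro emeasure_distr f sets_PiM_I_finite) auto
    moreover have "{x :: real^'n. \<forall>i. x $ i \<in> A (k, i)} \<in> sets lborel" if "k \<in> {1..N}" for k
    proof -
      have "{x :: real^'n. \<forall>i. x $ i \<in> A (k, i)} = (\<Inter>i\<in>UNIV. (\<lambda>x. x $ i) -` A (k, i) \<inter> space borel)" by auto
      also have "\<dots> \<in> sets borel"
      proof (intro sets.finite_INT measurable_sets[of _ borel borel] borel_measurable_continuous_onI continuous_intros)
        show "A (k, i) \<in> sets borel" for i using A[of "(k, i)"] that by simp
      qed auto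
      finally show ?thesis by simp
    qed
    hence "emeasure ?P (\<Pi>\<^sub>E k\<in>{1..N}. {x. \<forall>i. x $ i \<in> A (k, i)})
        = (\<Prod>k=1..N. emeasure lborel {x :: real^'n. \<forall>i. x $ i \<in> A (k, i)})"
      by (intro V.emeasure_PiM) auto
    ultimately have "emeasure (distr ?P ?M ?f) (Pi\<^sub>E ?I A)
        = (\<Prod>k=1..N. emeasure lborel {x :: real^'n. \<forall>i. x $ i \<in> A (k, i)})"
      by (simp only:)
    also have "\<dots> = (\<Prod>k=1..N. \<Prod>i\<in>UNIV. emeasure lborel (A (k, i)))"
      using A by (intro prod.cong refl emeasure_lborel_vec_box) auto
    also have "\<dots> = (\<Prod>c\<in>?I. emeasure lborel (A c))"
      unfolding stack_index_def by (simp add: prod.cartesian_product)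
    finally show "emeasure (distr ?P ?M ?f) (Pi\<^sub>E ?I A) = (\<Prod>c\<in>?I. emeasure lborel (A c))" .
  qed simp
  moreover have "emeasure (distr ?P ?M ?f) (block_product N B) = emeasure ?P (?f -` block_product N B \<inter> space ?P)"
    using meas f by (intro emeasure_distr) auto
  moreover have "?f -` block_product N B \<inter> space ?P = Pi\<^sub>E {1..N} B"
    by (auto simp: block_product_def space_PiM PiE_iff vec_lambda_eta)
  moreover have "emeasure ?P (Pi\<^sub>E {1..N} B) = (\<Prod>k=1..N. emeasure lborel (B k))"
    using B by (intro V.emeasure_PiM) auto
  ultimately show ?thesis by simp
qed

lemma continuous_map_block:
  assumes "k \<in> {1..N}"
  shows "continuous_map (vec_space (stack_index N)) euclidean (\<lambda>v. \<chi> i :: 'n::finite. v (k, i))"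
  unfolding continuous_map_def
proof (intro conjI allI impI)
  fix U :: "(real^'n) set" assume "openin euclidean U"
  hence U: "open U" by simp
  show "openin (vec_space (stack_index N)) {v \<in> topspace (vec_space (stack_index N)). (\<chi> i :: 'n. v (k, i)) \<in> U}"
    unfolding openin_vec_space[OF finite_stack_index]
  proof (intro conjI ballI)
    fix v assume "v \<in> {v \<in> topspace (vec_space (stack_index N)). (\<chi> i :: 'n. v (k, i)) \<in> U}"
    then obtain e where e: "e > 0" "\<And>y. dist y (\<chi> i :: 'n. v (k, i)) < e \<Longrightarrow> y \<in> U"
      using U unfolding open_dist by blast
    \<comment> \<open>The norm is at most the sum of the absolute coordinates, so each may
      contribute \<open>e\<close> divided by the dimension.\<close>
    let ?d = "e / real CARD('n)"
    show "\<exists>d>0. \<forall>w\<in>extensional (stack_index N). (\<forall>c\<in>stack_index N. \<bar>w c - v c\<bar> < d) \<longrightarrow>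
        w \<in> {v \<in> topspace (vec_space (stack_index N)). (\<chi> i :: 'n. v (k, i)) \<in> U}"
    proof (intro exI[of _ ?d] conjI ballI impI)
      show "?d > 0" using e by simp
      fix w assume w: "w \<in> extensional (stack_index N)" "\<forall>c\<in>stack_index N. \<bar>w c - v c\<bar> < ?d"
      have "dist (\<chi> i :: 'n. w (k, i)) (\<chi> i :: 'n. v (k, i)) \<le> (\<Sum>i\<in>UNIV. \<bar>w (k, i) - v (k, i)\<bar>)"
        unfolding dist_norm by (rule order_trans[OF norm_le_l1_cart]) simp
      also have "\<dots> < (\<Sum>i\<in>(UNIV :: 'n set). ?d)"
        using w(2) assms by (intro sum_strict_mono) auto
      also have "\<dots> = e" by simp
      finally show "w \<in> {v \<in> topspace (vec_space (stack_index N)). (\<chi> i :: 'n. v (k, i)) \<in> U}"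
        using w e by simp
    qed
  qed auto
qed auto

lemma block_product_INT:
  assumes "N \<ge> 1"
  shows "block_product N B = (\<Inter>k\<in>{1..N}. {v \<in> topspace (vec_space (stack_index N)). (\<chi> i. v (k, i)) \<in> B k})"
  using assms by (auto simp: block_product_def)

lemma block_product_closedin:
  assumes "N \<ge> 1" "\<And>k. k \<in> {1..N} \<Longrightarrow> closed (B k)"
  shows "closedin (vec_space (stack_index N)) (block_product N B)"
  unfolding block_product_INT[OF assms(1)]
  using assms by (intro closedin_INT closedin_continuous_map_preimage[OF continuous_map_block]) auto

lemma block_product_openin:
  assumes "N \<ge> 1" "\<And>k. k \<in> {1..N} \<Longrightarrow> open (B k)"
  shows "openin (vec_space (stack_index N)) (block_product N B)"
  unfolding block_product_INT[OF assms(1)]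
  using assms by (intro openin_INT2 openin_continuous_map_preimage[OF continuous_map_block]) auto

lemma block_product_mono: "(\<And>k. k \<in> {1..N} \<Longrightarrow> A k \<subseteq> B k) \<Longrightarrow> block_product N A \<subseteq> block_product N B"
  unfolding block_product_def by blast

text \<open>The factors need not be Borel, so the product is enclosed between the products of
  interiors and of closures, whose volumes agree.\<close>

lemma continuity_set_block_product:
  fixes B :: "nat \<Rightarrow> (real^'n) set"
  assumes N: "N \<ge> 1" and B: "\<And>k. k \<in> {1..N} \<Longrightarrow> continuity_set euclidean lborel (B k)"
  shows "continuity_set (vec_space (stack_index N)) (PiM (stack_index N) (\<lambda>_. lborel)) (block_product N B)"
    and "emeasure (mes (stack_index N)) (block_product N B) = (\<Prod>k=1..N. emeasure lebesgue (B k))"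
proof -
  let ?X = "vec_space (stack_index N) :: (nat \<times> 'n \<Rightarrow> real) topology"
  let ?M = "PiM (stack_index N) (\<lambda>_. lborel) :: (nat \<times> 'n \<Rightarrow> real) measure"
  interpret borel_topology ?X ?M by (rule borel_topology_vec_space) simp
  interpret E: borel_topology "euclidean :: (real^'n) topology" lborel by (rule borel_topology_euclidean)
  have "continuity_set ?X ?M {v \<in> topspace ?X. (\<chi> i. v (k, i)) \<in> B k}" if k: "k \<in> {1..N}" for k
  proof (rule continuity_set_vimage[OF continuous_map_block[OF k] B[OF k]])
    fix F :: "(real^'n) set" assume F: "closedin euclidean F" "F \<in> null_sets (completion lborel)"
    \<comment> \<open>The cylinder over \<open>F\<close> as a block product. Its volume is 0
      although the other factors are infinite, since 0 times infinity is 0 in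
      \<open>ennreal\<close>.\<close>
    let ?A = "\<lambda>j. if j = k then F else UNIV"
    have cl: "closedin ?X (block_product N ?A)" using F by (intro block_product_closedin N) auto
    have "emeasure ?M (block_product N ?A) = (\<Prod>j=1..N. emeasure lborel (?A j))"
      using F by (intro emeasure_block_product closedin_sets cl) auto
    also have "\<dots> = 0"
    proof (rule prod_zero)
      have "F \<in> sets lborel" using F by simp
      thus "\<exists>j\<in>{1..N}. emeasure lborel (?A j) = 0" using F k by (intro bexI[of _ k]) auto
    qed simp
    finally have "block_product N ?A \<in> null_sets ?M" using closedin_sets[OF cl] by auto
    moreover have "block_product N ?A = {v \<in> topspace ?X. (\<chi> i. v (k, i)) \<in> F}"
      using k by (auto simp: block_product_def)
    ultimately show "{v \<in> topspace ?X. (\<chi> i. v (k, i)) \<in> F} \<in> null_sets (completion ?M)"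
      by (simp add: null_sets_completionI)
  qed
  thus c: "continuity_set ?X ?M (block_product N B)"
    unfolding block_product_INT[OF N] using N by (intro continuity_set_INT) auto
  have "emeasure (completion ?M) (block_product N B) \<le> emeasure (completion ?M) (block_product N (\<lambda>k. closure (B k)))"
    using closedin_sets[OF block_product_closedin[OF N, of "\<lambda>k. closure (B k)"]]
    by (intro emeasure_mono block_product_mono closure_subset) auto
  also have "\<dots> = emeasure ?M (block_product N (\<lambda>k. closure (B k)))"
    using closedin_sets[OF block_product_closedin[OF N, of "\<lambda>k. closure (B k)"]]
    by (intro emeasure_completion_sets) auto
  also have "\<dots> = (\<Prod>k=1..N. emeasure lborel (closure (B k)))"
    using closedin_sets[OF block_product_closedin[OF N, of "\<lambda>k. closure (B k)"]]
    by (intro emeasure_block_product) auto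
  also have "\<dots> = (\<Prod>k=1..N. emeasure lebesgue (B k))"
    using E.emeasure_closure[OF B] by (intro prod.cong) auto
  finally have le: "emeasure (completion ?M) (block_product N B) \<le> (\<Prod>k=1..N. emeasure lebesgue (B k))" .
  have "(\<Prod>k=1..N. emeasure lebesgue (B k)) = (\<Prod>k=1..N. emeasure lborel (interior (B k)))"
    using E.emeasure_interior[OF B] by (intro prod.cong) auto
  also have "\<dots> = emeasure ?M (block_product N (\<lambda>k. interior (B k)))"
    using openin_sets[OF block_product_openin[OF N, of "\<lambda>k. interior (B k)"]]
    by (intro emeasure_block_product[symmetric]) auto
  also have "\<dots> = emeasure (completion ?M) (block_product N (\<lambda>k. interior (B k)))"
    using openin_sets[OF block_product_openin[OF N, of "\<lambda>k. interior (B k)"]]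
    by (intro emeasure_completion_sets[symmetric]) auto
  also have "\<dots> \<le> emeasure (completion ?M) (block_product N B)"
    by (intro emeasure_mono block_product_mono interior_subset continuity_set_sets[OF c])
  finally show "emeasure (mes (stack_index N)) (block_product N B) = (\<Prod>k=1..N. emeasure lebesgue (B k))"
    using le by (simp add: mes_def)
qed

section \<open>The triangular change of variables\<close>

text \<open>\<open>backward_rows\<close> stacks the powers from \<open>-N\<close> to
  \<open>-1\<close>. After reversal block \<open>k\<close> belongs to the power \<open>-k\<close>,
  so blocks are in the order of time.\<close>

definition reverse_blocks :: "nat \<Rightarrow> (nat \<times> 'n \<Rightarrow> real) \<Rightarrow> nat \<times> 'n \<Rightarrow> real" where
  "reverse_blocks N v = (\<lambda>c\<in>stack_index N. v (N + 1 - fst c, snd c))"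

text \<open>The passage from \<open>u k\<close> to \<open>u k - A u (k - 1)\<close> with
  \<open>u 0 = 0\<close>, written as identity plus a term in the preceding block to fit
  \<open>volume_preserving_triangular\<close>.\<close>

definition block_diff :: "real^'n^'n \<Rightarrow> nat \<Rightarrow> (nat \<times> 'n \<Rightarrow> real) \<Rightarrow> nat \<times> 'n \<Rightarrow> real" where
  "block_diff A N v = (\<lambda>c\<in>stack_index N.
     v c + (if fst c = 1 then 0 else - (A *v (\<chi> l. v (fst c - 1, l))) $ snd c))"

text \<open>The vectors \<open>u k\<close> recovered from the errors \<open>e\<close>; this inverts
  \<open>block_diff\<close>.\<close>

fun accum :: "real^'n^'n \<Rightarrow> (nat \<times> 'n \<Rightarrow> real) \<Rightarrow> nat \<Rightarrow> real^'n" where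
  "accum A e 0 = 0"
| "accum A e (Suc k) = (\<chi> i. e (Suc k, i)) + A *v accum A e k"

text \<open>Block \<open>k\<close> equals \<open>accum A e k\<close>; splitting off
  \<open>e c\<close> leaves a term in the earlier blocks, so that the map is visibly
  triangular.\<close>

definition block_sum :: "real^'n^'n \<Rightarrow> nat \<Rightarrow> (nat \<times> 'n \<Rightarrow> real) \<Rightarrow> nat \<times> 'n \<Rightarrow> real" where
  "block_sum A N e = (\<lambda>c\<in>stack_index N. e c + (A *v accum A e (fst c - 1)) $ snd c)"

lemma volume_preserving_reverse_blocks:
  "volume_preserving (stack_index N :: (nat \<times> 'n::finite) set) (reverse_blocks N)"
proof -
  have "bij_betw (\<lambda>c. (N + 1 - fst c, snd c)) (stack_index N :: (nat \<times> 'n) set) (stack_index N)"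
    by (rule bij_betw_byWitness[where f' = "\<lambda>c. (N + 1 - fst c, snd c)"]) auto
  from volume_preserving_permute[OF finite_stack_index this]
  show ?thesis by (simp add: reverse_blocks_def[abs_def])
qed

lemma continuous_map_matrix_vector:
  assumes "\<And>l. continuous_map X euclideanreal (\<lambda>v. f v $ l)"
  shows "continuous_map X euclideanreal (\<lambda>v. (A *v f v) $ i)"
  unfolding matrix_vector_mult_def
  using assms by (auto intro!: continuous_map_sum continuous_map_real_mult_left)

lemma volume_preserving_block_diff:
  fixes A :: "real^'n^'n"
  shows "volume_preserving (stack_index N) (block_diff A N)"
  unfolding block_diff_def[abs_def]
proof (rule volume_preserving_triangular[where rank = fst])
  fix c :: "nat \<times> 'n" assume c: "c \<in> stack_index N"
  show "continuous_map (vec_space (stack_index N)) euclideanreal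
      (\<lambda>v. if fst c = 1 then 0 else - (A *v (\<chi> l. v (fst c - 1, l))) $ snd c)"
  proof (cases "fst c = 1")
    case False
    have "continuous_map (vec_space (stack_index N)) euclideanreal (\<lambda>v. (A *v (\<chi> l. v (fst c - 1, l))) $ snd c)"
      using c False by (intro continuous_map_matrix_vector)
        (auto simp: stack_index_def intro!: continuous_map_coordinate)
    thus ?thesis using False by (simp add: continuous_map_minus)
  qed simp
  fix v w :: "nat \<times> 'n \<Rightarrow> real"
  assume "\<And>d. d \<in> stack_index N \<Longrightarrow> fst d < fst c \<Longrightarrow> v d = w d"
  hence "v (fst c - 1, l) = w (fst c - 1, l)" if "fst c \<noteq> 1" for l
    using that c by (auto simp: stack_index_def)
  thus "(if fst c = 1 then 0 else - (A *v (\<chi> l. v (fst c - 1, l))) $ snd c)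
      = (if fst c = 1 then 0 else - (A *v (\<chi> l. w (fst c - 1, l))) $ snd c)" by simp
qed simp

lemma continuous_map_accum:
  fixes A :: "real^'n^'n"
  assumes "k \<le> N"
  shows "continuous_map (vec_space (stack_index N)) euclideanreal (\<lambda>e. accum A e k $ i)"
  using assms
proof (induction k arbitrary: i)
  case (Suc k)
  have "continuous_map (vec_space (stack_index N)) euclideanreal (\<lambda>e. e (Suc k, i) + (A *v accum A e k) $ i)"
    using Suc by (intro continuous_map_add continuous_map_coordinate continuous_map_matrix_vector) auto
  thus ?case by simp
qed simp

lemma accum_cong:
  assumes "\<And>d. d \<in> stack_index N \<Longrightarrow> fst d \<le> k \<Longrightarrow> v d = w d" "k \<le> N"
  shows "accum A v k = accum A w k"
  using assms
proof (induction k)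
  case (Suc k)
  have "accum A v k = accum A w k" using Suc by auto
  moreover have "(\<chi> i. v (Suc k, i)) = (\<chi> i. w (Suc k, i))" using Suc.prems by simp
  ultimately show ?case by simp
qed simp

lemma volume_preserving_block_sum:
  fixes A :: "real^'n^'n"
  shows "volume_preserving (stack_index N) (block_sum A N)"
  unfolding block_sum_def[abs_def]
proof (rule volume_preserving_triangular[where rank = fst])
  fix c :: "nat \<times> 'n" assume c: "c \<in> stack_index N"
  show "continuous_map (vec_space (stack_index N)) euclideanreal (\<lambda>v. (A *v accum A v (fst c - 1)) $ snd c)"
    using c by (intro continuous_map_matrix_vector continuous_map_accum) (auto simp: stack_index_def)
  fix v w :: "nat \<times> 'n \<Rightarrow> real"
  assume *: "\<And>d. d \<in> stack_index N \<Longrightarrow> fst d < fst c \<Longrightarrow> v d = w d"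
  have "accum A v (fst c - 1) = accum A w (fst c - 1)"
    using c by (intro accum_cong[of N] *) (auto simp: stack_index_def)
  thus "(A *v accum A v (fst c - 1)) $ snd c = (A *v accum A w (fst c - 1)) $ snd c" by simp
qed simp

lemma reverse_blocks_involution: "v \<in> extensional (stack_index N) \<Longrightarrow> reverse_blocks N (reverse_blocks N v) = v"
  by (auto simp: reverse_blocks_def fun_eq_iff extensional_def)

lemma block_sum_eq_accum: "1 \<le> k \<Longrightarrow> k \<le> N \<Longrightarrow> block_sum A N e (k, i) = accum A e k $ i"
  by (cases k) (auto simp: block_sum_def)

lemma block_diff_block_sum:
  fixes A :: "real^'n^'n"
  shows "e \<in> extensional (stack_index N) \<Longrightarrow> block_diff A N (block_sum A N e) = e"
proof
  fix c :: "nat \<times> 'n" assume e: "e \<in> extensional (stack_index N)"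
  obtain k i where c: "c = (k, i)" by (cases c)
  show "block_diff A N (block_sum A N e) c = e c"
  proof (cases "1 \<le> k \<and> k \<le> N")
    case True
    hence "(\<chi> l. block_sum A N e (k - 1, l)) = accum A e (k - 1)" if "k \<noteq> 1"
      using that by (subst block_sum_eq_accum) auto
    thus ?thesis using True c by (auto simp: block_diff_def block_sum_def)
  next
    case False
    thus ?thesis using e c by (auto simp: block_diff_def extensional_def)
  qed
qed

lemma accum_block_diff: "k \<ge> 1 \<Longrightarrow> k \<le> N \<Longrightarrow> accum A (block_diff A N v) k = (\<chi> l. v (k, l))"
proof (induction k)
  case (Suc k)
  show ?case
  proof (cases "k = 0")
    case True
    thus ?thesis using Suc by (simp add: block_diff_def)
  next
    case False
    hence "accum A (block_diff A N v) k = (\<chi> l. v (k, l))" using Suc by auto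
    hence "accum A (block_diff A N v) (Suc k)
        = (\<chi> i. block_diff A N v (Suc k, i)) + A *v (\<chi> l. v (k, l))" by simp
    also have "(\<chi> i. block_diff A N v (Suc k, i)) = (\<chi> i. v (Suc k, i) - (A *v (\<chi> l. v (k, l))) $ i)"
      using Suc.prems False by (simp add: block_diff_def)
    also have "\<dots> + A *v (\<chi> l. v (k, l)) = (\<chi> l. v (Suc k, l))" by (simp add: vec_eq_iff)
    finally show ?thesis .
  qed
qed simp

lemma block_sum_block_diff:
  fixes A :: "real^'n^'n"
  shows "v \<in> extensional (stack_index N) \<Longrightarrow> block_sum A N (block_diff A N v) = v"
proof
  fix c :: "nat \<times> 'n" assume v: "v \<in> extensional (stack_index N)"
  obtain k i where c: "c = (k, i)" by (cases c)
  show "block_sum A N (block_diff A N v) c = v c"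
  proof (cases "1 \<le> k \<and> k \<le> N")
    case True
    thus ?thesis using c by (simp add: block_sum_eq_accum accum_block_diff)
  next
    case False
    thus ?thesis using v c by (auto simp: block_sum_def extensional_def)
  qed
qed

text \<open>From lifted torus points to candidate error vectors. The explicit inverse
  \<open>encode\<close> yields boundedness of preimages and one of the inclusions between the
  algebras.\<close>

definition decode :: "real^'n^'n \<Rightarrow> nat \<Rightarrow> (nat \<times> 'n \<Rightarrow> real) \<Rightarrow> nat \<times> 'n \<Rightarrow> real" where
  "decode A N = block_diff A N \<circ> reverse_blocks N"

definition encode :: "real^'n^'n \<Rightarrow> nat \<Rightarrow> (nat \<times> 'n \<Rightarrow> real) \<Rightarrow> nat \<times> 'n \<Rightarrow> real" where
  "encode A N = reverse_blocks N \<circ> block_sum A N"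

lemma volume_preserving_decode: "volume_preserving (stack_index N) (decode A N)"
  unfolding decode_def
  by (intro volume_preserving_comp volume_preserving_block_diff volume_preserving_reverse_blocks)

lemma volume_preserving_encode: "volume_preserving (stack_index N) (encode A N)"
  unfolding encode_def
  by (intro volume_preserving_comp volume_preserving_block_sum volume_preserving_reverse_blocks)

lemma decode_extensional [simp]: "decode A N v \<in> extensional (stack_index N)"
  by (simp add: decode_def block_diff_def)

lemma encode_extensional [simp]: "encode A N v \<in> extensional (stack_index N)"
  by (simp add: encode_def reverse_blocks_def)

lemma decode_encode [simp]: "e \<in> extensional (stack_index N) \<Longrightarrow> decode A N (encode A N e) = e"
proof -
  have "block_sum A N e \<in> extensional (stack_index N)" by (simp add: block_sum_def)
  thus "e \<in> extensional (stack_index N) \<Longrightarrow> ?thesis"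
    by (simp add: decode_def encode_def reverse_blocks_involution block_diff_block_sum)
qed

lemma encode_decode [simp]: "v \<in> extensional (stack_index N) \<Longrightarrow> encode A N (decode A N v) = v"
proof -
  have "reverse_blocks N v \<in> extensional (stack_index N)" by (simp add: reverse_blocks_def)
  thus "v \<in> extensional (stack_index N) \<Longrightarrow> ?thesis"
    by (simp add: decode_def encode_def reverse_blocks_involution block_sum_block_diff)
qed

text \<open>A bounded set lies in a closed cube, which is compact.\<close>

lemma bounded_continuous_image:
  assumes I: "finite I" and T: "continuous_map (vec_space I) (vec_space I) T"
    and B: "B \<subseteq> extensional I" "\<forall>v\<in>B. \<forall>i\<in>I. \<bar>v i\<bar> \<le> r"
  shows "\<exists>s. \<forall>v\<in>B. \<forall>i\<in>I. \<bar>T v i\<bar> \<le> s"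
proof -
  let ?K = "\<Pi>\<^sub>E i\<in>I. {- r..r}"
  have BK: "B \<subseteq> ?K"
  proof
    fix v assume v: "v \<in> B"
    have "- r \<le> v i \<and> v i \<le> r" if "i \<in> I" for i
      using B(2)[rule_format, OF v that] by (auto simp: abs_le_iff)
    thus "v \<in> ?K" using B(1) v by (auto simp: PiE_iff)
  qed
  have K: "compactin (vec_space I) ?K" by (simp add: vec_space_def compactin_PiE)
  have "\<exists>s. \<forall>v\<in>?K. \<bar>T v i\<bar> \<le> s" if i: "i \<in> I" for i
  proof -
    have "continuous_map (vec_space I) euclideanreal (\<lambda>v. T v i)"
      using T i by (auto simp: continuous_map_vec_space)
    from image_compactin[OF K this] have "bounded ((\<lambda>v. T v i) ` ?K)"
      by (simp add: compact_imp_bounded)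
    thus ?thesis unfolding bounded_iff by auto
  qed
  then obtain s where s: "\<And>i v. i \<in> I \<Longrightarrow> v \<in> ?K \<Longrightarrow> \<bar>T v i\<bar> \<le> s i" by metis
  have "\<bar>T v i\<bar> \<le> (\<Sum>j\<in>I. \<bar>s j\<bar>)" if "v \<in> B" "i \<in> I" for v i
  proof -
    have "\<bar>T v i\<bar> \<le> \<bar>s i\<bar>" using s[OF that(2), of v] that(1) BK by fastforce
    also have "\<dots> \<le> (\<Sum>j\<in>I. \<bar>s j\<bar>)" using I that by (intro member_le_sum) auto
    finally show ?thesis .
  qed
  thus ?thesis by blast
qed

text \<open>The frontier is handled by volume preservation of \<open>decode\<close>; boundedness
  holds because the preimage is the image of \<open>B\<close> under the continuous map
  \<open>encode\<close>.\<close>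

lemma jordan_measurable_decode_vimage:
  fixes A :: "real^'n^'n"
  assumes B: "jordan_measurable_on (stack_index N) B"
  shows "jordan_measurable_on (stack_index N) {u \<in> extensional (stack_index N). decode A N u \<in> B}"
  unfolding jordan_measurable_on_iff
proof
  show "continuity_set (vec_space (stack_index N)) (PiM (stack_index N) (\<lambda>_. lborel))
      {u \<in> extensional (stack_index N). decode A N u \<in> B}"
    using B by (intro volume_preserving_vimage(1) volume_preserving_decode) (auto simp: jordan_measurable_on_iff)
  obtain r where r: "\<forall>g\<in>B. \<forall>i\<in>stack_index N. \<bar>g i\<bar> \<le> r" using B by (auto simp: jordan_measurable_on_iff)
  have "B \<subseteq> extensional (stack_index N)" using B by (auto simp: jordan_measurable_on_def)
  then obtain s where s: "\<forall>v\<in>B. \<forall>i\<in>stack_index N. \<bar>encode A N v i\<bar> \<le> s"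
    using bounded_continuous_image[OF finite_stack_index _ _ r, of "encode A N"] volume_preserving_encode
    unfolding volume_preserving_def by blast
  show "\<exists>r. \<forall>g\<in>{u \<in> extensional (stack_index N). decode A N u \<in> B}. \<forall>i\<in>stack_index N. \<bar>g i\<bar> \<le> r"
  proof (intro exI[of _ s] ballI)
    fix g and i :: "nat \<times> 'n" assume "g \<in> {u \<in> extensional (stack_index N). decode A N u \<in> B}" "i \<in> stack_index N"
    thus "\<bar>g i\<bar> \<le> s" using s[rule_format, of "decode A N g" i] by simp
  qed
qed

section \<open>The compensating system\<close>

lemma real_vec_minus: "real_vec (- a) = - real_vec a"
  by (simp add: real_vec_def vec_eq_iff)

lemma nonresonant_reindex:
  fixes \<Lambda> :: "'i \<Rightarrow> real^'n" and \<Lambda>' :: "'j \<Rightarrow> real^'n"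
  assumes f: "bij_betw f I J" "finite I" and eq: "\<And>i. i \<in> I \<Longrightarrow> \<Lambda> i = \<Lambda>' (f i)" and nr: "nonresonant J \<Lambda>'"
  shows "nonresonant I \<Lambda>"
  unfolding nonresonant_def rat_independent_def
proof (intro allI impI ballI)
  fix c :: "'n + 'i \<Rightarrow> rat" and s :: "'n + 'i"
  assume sum0: "(\<Sum>s\<in>UNIV <+> I. of_rat (c s) *\<^sub>R case_sum (\<lambda>i. row i (mat 1)) \<Lambda> s) = 0" and s: "s \<in> UNIV <+> I"
  have J: "finite J" using f bij_betw_finite by blast
  define c' :: "'n + 'j \<Rightarrow> rat" where "c' = case_sum (\<lambda>k. c (Inl k)) (\<lambda>j. c (Inr (the_inv_into I f j)))"
  have c': "c' (Inr (f i)) = c (Inr i)" if "i \<in> I" for i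
    using f that by (simp add: c'_def bij_betw_def the_inv_into_f_f)
  have "(\<Sum>s\<in>UNIV <+> J. of_rat (c' s) *\<^sub>R case_sum (\<lambda>i. row i (mat 1)) \<Lambda>' s)
      = (\<Sum>i\<in>UNIV. of_rat (c (Inl i)) *\<^sub>R row i (mat 1)) + (\<Sum>j\<in>J. of_rat (c' (Inr j)) *\<^sub>R \<Lambda>' j)"
    by (subst sum.Plus[OF _ J]) (simp_all add: c'_def)
  also have "(\<Sum>j\<in>J. of_rat (c' (Inr j)) *\<^sub>R \<Lambda>' j) = (\<Sum>i\<in>I. of_rat (c (Inr i)) *\<^sub>R \<Lambda> i)"
    by (subst sum.reindex_bij_betw[OF f(1), symmetric]) (simp add: c' eq)
  also have "(\<Sum>i\<in>UNIV. of_rat (c (Inl i)) *\<^sub>R row i (mat 1)) + (\<Sum>i\<in>I. of_rat (c (Inr i)) *\<^sub>R \<Lambda> i) = 0"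
    using sum0 by (subst (asm) sum.Plus[OF _ f(2)]) simp_all
  finally have *: "\<forall>s\<in>UNIV <+> J. c' s = 0"
    using nr unfolding nonresonant_def rat_independent_def by blast
  from s show "c s = 0"
  proof
    fix k assume "s = Inl k"
    thus ?thesis using bspec[OF * InlI[OF UNIV_I[of k]]] by (simp add: c'_def)
  next
    fix i assume i: "i \<in> I" "s = Inr i"
    hence "f i \<in> J" using f by (auto simp: bij_betw_def)
    thus ?thesis using bspec[OF *, of "Inr (f i)"] c'[OF i(1)] i by auto
  qed
qed

text \<open>Block \<open>j\<close> carries the power \<open>j - N - 1\<close>. These run through
  \<open>-N\<close> to \<open>-1\<close>, so the stack is a finite submatrix of the nonzero
  powers.\<close>

lemma nonresonant_backward_rows:
  fixes L :: "real^'n^'n"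
  assumes "iteratively_nonresonant L"
  shows "nonresonant (stack_index N) (backward_rows L N)"
proof (rule nonresonant_reindex)
  let ?f = "\<lambda>c :: nat \<times> 'n. (int (fst c) - int N - 1, snd c)"
  let ?J = "{- int N..- 1} \<times> (UNIV :: 'n set)"
  show "bij_betw ?f (stack_index N) ?J"
  proof (rule bij_betw_byWitness[where f' = "\<lambda>d. (nat (fst d + int N + 1), snd d)"])
    show "?f ` stack_index N \<subseteq> ?J" by (fastforce simp: stack_index_def)
    show "(\<lambda>d. (nat (fst d + int N + 1), snd d)) ` ?J \<subseteq> stack_index N"
    proof
      fix c assume "c \<in> (\<lambda>d. (nat (fst d + int N + 1), snd d)) ` ?J"
      then obtain d :: "int \<times> 'n" where d: "c = (nat (fst d + int N + 1), snd d)" "- int N \<le> fst d" "fst d \<le> - 1"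
        by auto
      hence "1 \<le> nat (fst d + int N + 1)" "nat (fst d + int N + 1) \<le> N" by linarith+
      thus "c \<in> stack_index N" unfolding d(1) by simp
    qed
  qed simp_all
  show "nonresonant ?J (\<lambda>(k, i). row i (matrix_powi L k))"
    by (rule assms[unfolded iteratively_nonresonant_def, rule_format]) auto
qed (auto simp: backward_rows_def)

definition back_vec :: "real^'n^'n \<Rightarrow> nat \<Rightarrow> int^'n \<Rightarrow> real^'n" where
  "back_vec L k x = ((**) (matrix_inv L) ^^ k) (mat 1) *v real_vec x"

lemma back_vec_0 [simp]: "back_vec L 0 x = real_vec x"
  by (simp add: back_vec_def)

lemma back_vec_Suc [simp]: "back_vec L (Suc k) x = matrix_inv L *v back_vec L k x"
  by (simp add: back_vec_def matrix_vector_mul_assoc)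

lemma row_inner: "row i (A :: real^'n^'m) \<bullet> v = (A *v v) $ i"
  by (simp add: row_def inner_vec_def matrix_vector_mult_def)

lemma backward_rows_inner:
  assumes "1 \<le> j" "j \<le> N"
  shows "backward_rows L N (j, i) \<bullet> real_vec x = back_vec L (N + 1 - j) x $ i"
proof -
  have "\<not> 0 \<le> int j - int N - 1" "nat (- (int j - int N - 1)) = N + 1 - j" using assms by auto
  thus ?thesis by (simp add: backward_rows_def row_inner matrix_powi_def back_vec_def)
qed

text \<open>Extensionality determines \<open>g\<close> by its values on \<open>I\<close>, so the
  condition becomes membership of an integer shift, with the sign of \<open>z\<close>
  reversed.\<close>

lemma Q_set_iff:
  assumes "G \<subseteq> extensional I"
  shows "x \<in> Q_set I G \<Lambda> \<longleftrightarrow> (\<exists>z :: 'i \<Rightarrow> int. (\<lambda>i\<in>I. \<Lambda> i \<bullet> real_vec x + of_int (z i)) \<in> G)"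
proof
  assume "x \<in> Q_set I G \<Lambda>"
  then obtain g and z :: "'i \<Rightarrow> int" where g: "g \<in> G" "\<And>i. i \<in> I \<Longrightarrow> \<Lambda> i \<bullet> real_vec x = g i + of_int (z i)"
    by (auto simp: Q_set_def)
  have "(\<lambda>i\<in>I. \<Lambda> i \<bullet> real_vec x + of_int (- z i)) = g"
    using g assms by (auto simp: fun_eq_iff extensional_def subset_iff)
  thus "\<exists>z :: 'i \<Rightarrow> int. (\<lambda>i\<in>I. \<Lambda> i \<bullet> real_vec x + of_int (z i)) \<in> G" using g(1) by metis
next
  assume "\<exists>z :: 'i \<Rightarrow> int. (\<lambda>i\<in>I. \<Lambda> i \<bullet> real_vec x + of_int (z i)) \<in> G"
  then obtain z :: "'i \<Rightarrow> int" where "(\<lambda>i\<in>I. \<Lambda> i \<bullet> real_vec x + of_int (z i)) \<in> G" by blast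
  thus "x \<in> Q_set I G \<Lambda>" unfolding Q_set_def
    by (intro CollectI bexI[of _ "\<lambda>i\<in>I. \<Lambda> i \<bullet> real_vec x + of_int (z i)"] exI[of _ "\<lambda>i. - z i"]) auto
qed

locale quantized_system =
  fixes R :: "real^'n \<Rightarrow> int^'n" and L :: "real^'n^'n"
  assumes R: "quantizer R" and nr: "iteratively_nonresonant L"
begin

abbreviation "q \<equiv> comp_quantizer R L"
abbreviation "C \<equiv> comp_cell R L"
abbreviation "T \<equiv> comp_trans R L"
abbreviation "E \<equiv> comp_err R L"
abbreviation "EE \<equiv> comp_err_stack R L"
abbreviation "A \<equiv> matrix_inv L"
abbreviation "\<Lambda> \<equiv> backward_rows L"
abbreviation "X N \<equiv> vec_space (stack_index N :: (nat \<times> 'n) set)"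
abbreviation "V N \<equiv> PiM (stack_index N :: (nat \<times> 'n) set) (\<lambda>_. lborel :: real measure)"

lemma q_shift: "q (u + real_vec z) = q u + z"
proof -
  let ?c = "(mat 1 + A) *v cell_mean R"
  have "R ((u + ?c) + real_vec z) = R (u + ?c) + z" using R by (simp add: quantizer_def)
  thus ?thesis by (simp add: comp_quantizer_def algebra_simps)
qed

lemma mem_C: "u \<in> C \<longleftrightarrow> q u = 0" by (simp add: comp_cell_def)

lemma err_Suc: "E (Suc k) x = A *v real_vec ((T ^^ k) x) - real_vec ((T ^^ Suc k) x)"
  by (simp add: comp_err_def comp_err1_def)

lemma err_in_cell: "E k x \<in> C"
proof -
  have "comp_err1 R L y \<in> C" for y
    using q_shift[of "A *v real_vec y" "- T y"]
    by (simp add: mem_C comp_err1_def real_vec_minus) (simp add: comp_trans_def)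
  thus ?thesis by (simp add: comp_err_def)
qed

text \<open>The compensating cell is a translate of the original one, and translations are measure
  preserving homeomorphisms.\<close>

lemma cell_bounded: "bounded C" and cell_continuity: "continuity_set euclidean lborel C"
proof -
  let ?c = "(mat 1 + A) *v cell_mean R"
  have C: "C = {u \<in> topspace euclidean. u + ?c \<in> R -` {0}}"
    by (auto simp: comp_cell_def comp_quantizer_def)
  have "bounded ((\<lambda>u. u - ?c) ` (R -` {0}))"
    using R by (intro bounded_translation_minus) (simp add: quantizer_def jordan_measurable_def)
  moreover have "C \<subseteq> (\<lambda>u. u - ?c) ` (R -` {0})"
  proof
    fix u assume "u \<in> C"
    thus "u \<in> (\<lambda>u. u - ?c) ` (R -` {0})" unfolding C by (intro image_eqI[of _ _ "u + ?c"]) auto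
  qed
  ultimately show "bounded C" by (rule bounded_subset)
  have "(\<lambda>u. u + ?c) = (+) ?c" by (auto simp: add.commute)
  hence "distr lborel lborel (\<lambda>u. u + ?c) = lborel"
    using lborel_distr_plus[of ?c] distr_cong[of lborel lborel lborel borel "(+) ?c" "(+) ?c"] by simp
  moreover have "continuity_set euclidean lborel (R -` {0})"
    using R by (simp add: quantizer_def jordan_measurable_def continuity_set_def)
  moreover have "continuous_map euclidean euclidean (\<lambda>u. u + ?c)" by (simp add: continuous_intros)
  ultimately show "continuity_set euclidean lborel C"
    unfolding C
    by (intro borel_topology.emeasure_vimage(1)[OF borel_topology_euclidean borel_topology_euclidean]) auto
qed

lemma power_continuity: "N \<ge> 1 \<Longrightarrow> continuity_set (X N) (V N) (set_power C N)"
  unfolding set_power_eq by (intro continuity_set_block_product cell_continuity)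

lemma power_subset: "set_power C N \<subseteq> extensional (stack_index N)"
  by (auto simp: set_power_def)

lemma jordan_in_power:
  assumes "B \<subseteq> set_power C N" "continuity_set (X N) (V N) B"
  shows "jordan_measurable_on (stack_index N) B"
  unfolding jordan_measurable_on_iff
proof
  obtain r where r: "\<And>u. u \<in> C \<Longrightarrow> norm u \<le> r" using cell_bounded by (auto simp: bounded_iff)
  have "\<bar>g (k, i)\<bar> \<le> r" if g: "g \<in> B" "(k, i) \<in> stack_index N" for g k i
  proof -
    have "(\<chi> i. g (k, i)) \<in> C" using g assms(1) by (auto simp: set_power_def)
    from order_trans[OF component_le_norm_cart r[OF this], of i] show ?thesis by simp
  qed
  thus "\<exists>r. \<forall>g\<in>B. \<forall>c\<in>stack_index N. \<bar>g c\<bar> \<le> r" by (metis surj_pair)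
qed (rule assms)

lemma err_stack_in_power: "EE N x \<in> set_power C N"
  unfolding set_power_def comp_err_stack_def
  using err_in_cell by (auto simp: vec_lambda_eta)

lemma err_stack_block: "1 \<le> k \<Longrightarrow> k \<le> N \<Longrightarrow> (\<chi> i. EE N x (k, i)) = E k x"
  by (simp add: comp_err_stack_def vec_lambda_eta)

section \<open>Integer lifts of the torus point and their relation to the errors\<close>

definition lift :: "nat \<Rightarrow> int^'n \<Rightarrow> (nat \<times> 'n \<Rightarrow> int) \<Rightarrow> nat \<times> 'n \<Rightarrow> real" where
  "lift N x z = (\<lambda>c\<in>stack_index N. \<Lambda> N c \<bullet> real_vec x + of_int (z c))"

text \<open>Blocks in the order of time. The value \<open>- x\<close> at time 0 continues the
  pattern of the correct shifts, which are minus the states, and makes \<open>u 0\<close>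
  vanish.\<close>

definition lift_block :: "nat \<Rightarrow> int^'n \<Rightarrow> (nat \<times> 'n \<Rightarrow> int) \<Rightarrow> nat \<Rightarrow> int^'n" where
  "lift_block N x z k = (if k = 0 then - x else (\<chi> i. z (N + 1 - k, i)))"

text \<open>Position \<open>fst c\<close> in the stack belongs to time \<open>N + 1 - fst c\<close>;
  the shift is minus the state at that time.\<close>

definition err_shift :: "nat \<Rightarrow> int^'n \<Rightarrow> nat \<times> 'n \<Rightarrow> int" where
  "err_shift N x c = - ((T ^^ (N + 1 - fst c)) x $ snd c)"

lemma lift_extensional [simp]: "lift N x z \<in> extensional (stack_index N)"
  by (simp add: lift_def)

text \<open>The powers of \<open>L\<close> cancel, leaving the recursion that defines the errors.\<close>

lemma decode_lift_block:
  assumes k: "1 \<le> k" "k \<le> N"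
  shows "(\<chi> i. decode A N (lift N x z) (k, i)) = real_vec (lift_block N x z k) - A *v real_vec (lift_block N x z (k - 1))"
proof -
  have rev: "(\<chi> i. reverse_blocks N (lift N x z) (j, i)) = back_vec L j x + real_vec (lift_block N x z j)"
    if "1 \<le> j" "j \<le> N" for j
  proof -
    have 1: "1 \<le> N + 1 - j" "N + 1 - j \<le> N" "N + 1 - (N + 1 - j) = j" using that by auto
    have "reverse_blocks N (lift N x z) (j, i) = back_vec L j x $ i + of_int (z (N + 1 - j, i))" for i
      using that 1 backward_rows_inner[OF 1(1,2), of L i x] by (simp add: reverse_blocks_def lift_def)
    thus ?thesis using that by (simp add: vec_eq_iff lift_block_def real_vec_def)
  qed
  have "(\<chi> i. decode A N (lift N x z) (k, i)) = (\<chi> i. reverse_blocks N (lift N x z) (k, i))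
      - (if k = 1 then 0 else A *v (\<chi> i. reverse_blocks N (lift N x z) (k - 1, i)))"
    using k by (auto simp: vec_eq_iff decode_def block_diff_def)
  \<comment> \<open>For \<open>k = 1\<close> nothing is subtracted on the left, and
    \<open>back_vec L 1 x\<close> is exactly what the block \<open>- x\<close> at time 0 contributes
    on the right.\<close>
  also have "\<dots> = real_vec (lift_block N x z k) - A *v real_vec (lift_block N x z (k - 1))"
  proof (cases "k = 1")
    case True
    have "real_vec (lift_block N x z 0) = - real_vec x" by (simp add: lift_block_def real_vec_minus)
    moreover have "A *v - real_vec x = - (A *v real_vec x)"
      using matrix_vector_mult_diff_distrib[of A 0 "real_vec x"] by simp
    ultimately show ?thesis using True k rev[of 1] by simp
  next
    case False
    have "back_vec L k x = A *v back_vec L (k - 1) x" using k by (cases k) auto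
    thus ?thesis using False k rev[of k] rev[of "k - 1"]
      by (simp add: matrix_vector_right_distrib)
  qed
  finally show ?thesis .
qed

lemma lift_block_err_shift: "k \<le> N \<Longrightarrow> lift_block N x (err_shift N x) k = - ((T ^^ k) x)"
  by (auto simp: lift_block_def err_shift_def vec_eq_iff)

lemma decode_lift_err_shift: "decode A N (lift N x (err_shift N x)) = EE N x"
proof
  fix c :: "nat \<times> 'n" obtain k i where c: "c = (k, i)" by (cases c)
  show "decode A N (lift N x (err_shift N x)) c = EE N x c"
  proof (cases "1 \<le> k \<and> k \<le> N")
    case True
    then obtain j where j: "k = Suc j" by (cases k) auto
    have "A *v real_vec (- ((T ^^ j) x)) = - (A *v real_vec ((T ^^ j) x))"
      using matrix_vector_mult_diff_distrib[of A 0 "real_vec ((T ^^ j) x)"] by (simp add: real_vec_minus)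
    hence "(\<chi> i. decode A N (lift N x (err_shift N x)) (k, i)) = E k x"
      using decode_lift_block[of k N x "err_shift N x"] True j
      by (simp add: lift_block_err_shift err_Suc real_vec_minus del: funpow.simps)
    hence "(\<chi> i. decode A N (lift N x (err_shift N x)) (k, i)) $ i = E k x $ i" by simp
    thus ?thesis using True c by (simp add: comp_err_stack_def)
  next
    case False
    thus ?thesis using c decode_extensional[of A N] by (auto simp: comp_err_stack_def extensional_def)
  qed
qed

text \<open>Induction on time: once the block at time \<open>k\<close> is minus the state
  \<open>y\<close>, membership in the cell at time \<open>k + 1\<close> says that \<open>q\<close>
  vanishes at \<open>A y\<close> plus the next integer block, and covariance of \<open>q\<close>
  under integer shifts determines that block.\<close>

lemma lift_block_unique:
  assumes "decode A N (lift N x z) \<in> set_power C N" "k \<le> N"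
  shows "lift_block N x z k = - ((T ^^ k) x)"
  using assms(2)
proof (induction k)
  case 0
  show ?case by (simp add: lift_block_def)
next
  case (Suc k)
  have IH: "lift_block N x z k = - ((T ^^ k) x)" using Suc by simp
  have "(\<chi> i. decode A N (lift N x z) (Suc k, i)) \<in> C"
    using assms(1) Suc.prems by (auto simp: set_power_def)
  hence "real_vec (lift_block N x z (Suc k)) - A *v real_vec (- ((T ^^ k) x)) \<in> C"
    using decode_lift_block[of "Suc k" N x z] Suc.prems IH by simp
  moreover have "A *v real_vec (- ((T ^^ k) x)) = - (A *v real_vec ((T ^^ k) x))"
    using matrix_vector_mult_diff_distrib[of A 0 "real_vec ((T ^^ k) x)"] by (simp add: real_vec_minus)
  ultimately have "q (A *v real_vec ((T ^^ k) x) + real_vec (lift_block N x z (Suc k))) = 0"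
    by (simp add: mem_C add.commute)
  hence "T ((T ^^ k) x) + lift_block N x z (Suc k) = 0" unfolding q_shift by (simp add: comp_trans_def)
  thus ?case by (simp add: eq_neg_iff_add_eq_0 add.commute)
qed

lemma lift_unique:
  assumes "decode A N (lift N x z) \<in> set_power C N" "c \<in> stack_index N"
  shows "z c = err_shift N x c"
proof -
  obtain j i where c: "c = (j, i)" "1 \<le> j" "j \<le> N" using assms(2) by (cases c) auto
  have "lift_block N x z (N + 1 - j) $ i = - ((T ^^ (N + 1 - j)) x) $ i"
    using lift_block_unique[OF assms(1), of "N + 1 - j"] c by simp
  moreover have "lift_block N x z (N + 1 - j) $ i = z (j, i)" using c by (simp add: lift_block_def)
  ultimately show ?thesis using c by (simp add: err_shift_def)
qed

lemma lift_mem_iff: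
  assumes "B \<subseteq> set_power C N"
  shows "(\<exists>z. decode A N (lift N x z) \<in> B) \<longleftrightarrow> EE N x \<in> B"
proof
  assume "\<exists>z. decode A N (lift N x z) \<in> B"
  then obtain z where z: "decode A N (lift N x z) \<in> B" by blast
  hence *: "decode A N (lift N x z) \<in> set_power C N" using assms by blast
  have "lift N x z = lift N x (err_shift N x)"
    unfolding lift_def by (rule restrict_ext) (simp only: lift_unique[OF *])
  thus "EE N x \<in> B" using z decode_lift_err_shift by metis
next
  assume "EE N x \<in> B"
  thus "\<exists>z. decode A N (lift N x z) \<in> B" using decode_lift_err_shift by metis
qed

text \<open>Uniqueness of the shift turns the count into an indicator, so frequencies of error
  events become means of lattice counts.\<close>

lemma lattice_count_err:
  assumes B: "B \<subseteq> set_power C N"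
  shows "lattice_count (stack_index N) {u \<in> extensional (stack_index N). decode A N u \<in> B} (\<lambda>c. \<Lambda> N c \<bullet> real_vec x)
       = (if EE N x \<in> B then 1 else 0)"
proof -
  let ?Z = "{z \<in> stack_index N \<rightarrow>\<^sub>E UNIV. decode A N (lift N x z) \<in> B}"
  have eq: "{z \<in> stack_index N \<rightarrow>\<^sub>E UNIV. (\<lambda>i\<in>stack_index N. \<Lambda> N i \<bullet> real_vec x + of_int (z i))
      \<in> {u \<in> extensional (stack_index N). decode A N u \<in> B}} = ?Z"
    by (auto simp: lift_def)
  show ?thesis
  proof (cases "EE N x \<in> B")
    case True
    let ?z = "restrict (err_shift N x) (stack_index N)"
    have "lift N x ?z = lift N x (err_shift N x)" by (auto simp: lift_def)
    hence "?z \<in> ?Z" using True decode_lift_err_shift[of N x] by (auto simp: restrict_PiE_iff)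
    moreover have "z = ?z" if z: "z \<in> ?Z" for z
    proof
      fix c show "z c = ?z c"
      proof (cases "c \<in> stack_index N")
        case True
        have "decode A N (lift N x z) \<in> set_power C N" using z B by blast
        from lift_unique[OF this True] True show ?thesis by simp
      next
        case False
        hence "z c = undefined" using z by (intro PiE_arb[of z "stack_index N" "\<lambda>_. UNIV"]) auto
        thus ?thesis using False by (simp add: restrict_def)
      qed
    qed
    ultimately have "?Z = {?z}" by blast
    thus ?thesis unfolding lattice_count_def eq using True by simp
  next
    case False
    hence Z: "?Z = {}" using lift_mem_iff[OF B, of x] by blast
    show ?thesis unfolding lattice_count_def eq Z using False by simp
  qed
qed

section \<open>Frequencies of error events and the volume of the cell\<close>

lemma err_mean:
  assumes B: "B \<subseteq> set_power C N" "continuity_set (X N) (V N) B"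
  shows "upper_mean_le (indicator (EE N -` B)) (measure (mes (stack_index N)) B)"
    and "upper_mean_le (\<lambda>x. - indicator (EE N -` B) x) (- measure (mes (stack_index N)) B)"
proof -
  let ?P = "{u \<in> extensional (stack_index N). decode A N u \<in> B}"
  have P: "jordan_measurable_on (stack_index N) ?P"
    by (rule jordan_measurable_decode_vimage[OF jordan_in_power[OF B]])
  have m: "measure (mes (stack_index N)) ?P = measure (mes (stack_index N)) B"
    by (rule volume_preserving_vimage(2)[OF finite_stack_index volume_preserving_decode B(2)])
  have *: "real (lattice_count (stack_index N) ?P (\<lambda>c. \<Lambda> N c \<bullet> real_vec x)) = indicator (EE N -` B) x" for x
    unfolding lattice_count_err[OF B(1)] by (simp add: indicator_def)
  show "upper_mean_le (indicator (EE N -` B)) (measure (mes (stack_index N)) B)"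
    "upper_mean_le (\<lambda>x. - indicator (EE N -` B) x) (- measure (mes (stack_index N)) B)"
    using jordan_upper_mean[OF finite_stack_index nonresonant_backward_rows[OF nr] P] unfolding * m by auto
qed

lemma err_freq:
  assumes B: "B \<subseteq> set_power C N" "continuity_set (X N) (V N) B"
  shows "freq_measurable (EE N -` B) \<and> freq (EE N -` B) = measure (mes (stack_index N)) B"
  by (rule freq_eqI[OF err_mean[OF B]])

text \<open>For the full product the event is the whole lattice, so the mean of the constant 1 has
  to equal the volume.\<close>

lemma emeasure_power:
  assumes N: "N \<ge> 1"
  shows "emeasure (mes (stack_index N)) (set_power C N) = 1"
proof -
  have U: "EE N -` set_power C N = UNIV" using err_stack_in_power by auto
  have i: "indicator UNIV = (\<lambda>_ :: int^'n. 1 :: real)" by (auto simp: fun_eq_iff)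
  have "1 \<le> measure (mes (stack_index N)) (set_power C N)"
    using err_mean(1)[OF order_refl power_continuity[OF N]] unfolding U i upper_mean_le_const_iff .
  moreover have "- 1 \<le> - measure (mes (stack_index N)) (set_power C N)"
    using err_mean(2)[OF order_refl power_continuity[OF N]] unfolding U i upper_mean_le_const_iff .
  ultimately have m: "measure (mes (stack_index N)) (set_power C N) = 1" by linarith
  \<comment> \<open>\<open>measure\<close> is 0 on sets of infinite measure, so the value 1 excludes
    that case.\<close>
  hence "emeasure (mes (stack_index N)) (set_power C N) \<noteq> \<infinity>" by (auto simp: measure_def)
  thus ?thesis using m by (simp add: emeasure_eq_ennreal_measure)
qed

lemma emeasure_cell: "emeasure lebesgue C = 1"
  using continuity_set_block_product(2)[of 1 "\<lambda>_. C"] emeasure_power[of 1] cell_continuity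
  by (simp add: set_power_eq)

end

text \<open>Available only at this point, since the unit mass of the cell was obtained from the mean
  values of the counts.\<close>

sublocale quantized_system \<subseteq> cell: borel_cell euclidean lborel "comp_cell R L"
  using borel_topology_euclidean cell_continuity emeasure_cell
  by (intro borel_cell.intro borel_cell_axioms.intro) (auto intro: metrizable_imp_t1_space[OF metrizable_space_euclidean])

context quantized_system
begin

lemma metrizable_vec_space: "metrizable_space (X N)"
  by (simp add: vec_space_def metrizable_space_product_topology metrizable_space_euclidean)

lemma power_cell: "N \<ge> 1 \<Longrightarrow> borel_cell (X N) (V N) (set_power C N)"
  using borel_topology_vec_space[OF finite_stack_index, of N] power_continuity emeasure_power[of N]
  by (intro borel_cell.intro borel_cell_axioms.intro metrizable_imp_t1_space metrizable_vec_space)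
     (auto simp: mes_def)

lemma err_algebra_eq: "err_algebra R L k = {E k -` B | B. B \<subseteq> C \<and> continuity_set euclidean lborel B}"
  unfolding err_algebra_def cell_top_def cell_mes_def
  using cell.generated_algebra_eq[of "E k"] by simp

lemma err_stack_algebra_eq:
  "N \<ge> 1 \<Longrightarrow> err_stack_algebra R L N = {EE N -` B | B. B \<subseteq> set_power C N \<and> continuity_set (X N) (V N) B}"
  unfolding err_stack_algebra_def cell_power_top_def cell_power_mes_def mes_def
  using borel_cell.generated_algebra_eq[OF power_cell] .

lemma distributed_stack:
  assumes "N \<ge> 1"
  shows "distributed_map (cell_power_top C N) (cell_power_mes C N) (EE N)"
proof -
  interpret S: borel_cell "X N" "V N" "set_power C N" by (rule power_cell[OF assms])
  show ?thesis unfolding cell_power_top_def cell_power_mes_def mes_def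
    using S.distributed_mapI[OF metrizable_vec_space, of "EE N"] err_stack_in_power err_freq
    by (auto simp: mes_def)
qed

text \<open>A joint event of single errors is an event of the stack with a product set;
  multiplicativity of volume is then independence.\<close>

lemma err_product:
  assumes N: "N \<ge> 1" and B: "\<And>k. k \<in> {1..N} \<Longrightarrow> B k \<subseteq> C \<and> continuity_set euclidean lborel (B k)"
  shows "(\<Inter>k\<in>{1..N}. E k -` B k) = EE N -` block_product N B"
    and "block_product N B \<subseteq> set_power C N"
    and "continuity_set (X N) (V N) (block_product N B)"
    and "measure (mes (stack_index N)) (block_product N B) = (\<Prod>k=1..N. measure lebesgue (B k))"
proof -
  have "EE N x \<in> extensional (stack_index N)" for x by (simp add: comp_err_stack_def)
  thus "(\<Inter>k\<in>{1..N}. E k -` B k) = EE N -` block_product N B"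
    by (auto simp: block_product_def err_stack_block)
  show "block_product N B \<subseteq> set_power C N"
    unfolding set_power_eq using B by (intro block_product_mono) auto
  show "continuity_set (X N) (V N) (block_product N B)"
    using B by (intro continuity_set_block_product N) auto
  have "emeasure (mes (stack_index N)) (block_product N B) = (\<Prod>k=1..N. emeasure lebesgue (B k))"
    using B by (intro continuity_set_block_product N) auto
  also have "\<dots> = (\<Prod>k=1..N. ennreal (measure lebesgue (B k)))"
  proof (rule prod.cong)
    fix k assume k: "k \<in> {1..N}"
    have "emeasure lebesgue (B k) \<le> emeasure lebesgue C"
      using B[OF k] by (intro emeasure_mono cell.continuity_set_sets[OF cell_continuity]) auto
    hence "emeasure lebesgue (B k) \<noteq> \<infinity>" using emeasure_cell by (auto simp: top_unique)
    thus "emeasure lebesgue (B k) = ennreal (measure lebesgue (B k))"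
      by (simp add: emeasure_eq_ennreal_measure)
  qed simp
  also have "\<dots> = ennreal (\<Prod>k=1..N. measure lebesgue (B k))" by (simp add: prod_ennreal)
  finally show "measure (mes (stack_index N)) (block_product N B) = (\<Prod>k=1..N. measure lebesgue (B k))"
    by (simp add: measure_def prod_nonneg)
qed

text \<open>The blocks before \<open>k\<close> are filled with the full cell, which has mass 1 and
  imposes no condition.\<close>

lemma err_single:
  assumes k: "k \<ge> 1" and B: "B \<subseteq> C" "continuity_set euclidean lborel B"
  defines "B' \<equiv> block_product k (\<lambda>j. if j = k then B else C)"
  shows "E k -` B = EE k -` B'" "B' \<subseteq> set_power C k" "continuity_set (X k) (V k) B'"
    and "measure (mes (stack_index k)) B' = measure lebesgue B"
proof -
  have *: "(if j = k then B else C) \<subseteq> C \<and> continuity_set euclidean lborel (if j = k then B else C)" for j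
    using B cell_continuity by auto
  note P = err_product[where B = "\<lambda>j. if j = k then B else C", OF k *, folded B'_def]
  have "(\<Inter>j\<in>{1..k}. E j -` (if j = k then B else C)) = E k -` B"
    using k err_in_cell by (auto split: if_splits)
  thus "E k -` B = EE k -` B'" using P(1) by simp
  show "B' \<subseteq> set_power C k" "continuity_set (X k) (V k) B'" by (rule P(2,3))+
  have "measure (mes (stack_index k)) B' = (\<Prod>j=1..k. if j = k then measure lebesgue B else 1)"
    unfolding P(4) using emeasure_cell by (intro prod.cong) (auto simp: measure_def)
  thus "measure (mes (stack_index k)) B' = measure lebesgue B" using k by simp
qed

lemma err_single_freq:
  assumes k: "k \<ge> 1" and B: "B \<subseteq> C" "continuity_set euclidean lborel B"
  shows "freq_measurable (E k -` B) \<and> freq (E k -` B) = measure lebesgue B"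
  using err_freq[OF err_single(2,3)[OF assms]] err_single(1,4)[OF assms] by simp

lemma distributed_err:
  assumes "k \<ge> 1"
  shows "distributed_map (cell_top C) (cell_mes C) (E k)"
  unfolding cell_top_def cell_mes_def
  using err_in_cell err_single_freq[OF assms] by (intro cell.distributed_mapI) (auto simp: metrizable_space_euclidean)

lemma independent_err: "mutually_independent (err_algebra R L)"
  unfolding mutually_independent_def
proof (intro conjI allI impI ballI)
  fix k :: nat assume k: "1 \<le> k"
  show "algebra UNIV (err_algebra R L k)"
    unfolding err_algebra_def cell_top_def cell_mes_def
    using err_in_cell by (intro cell.algebra_generated) auto
  show "freq_measurable S" if "S \<in> err_algebra R L k" for S
    using that err_single_freq[OF k] unfolding err_algebra_eq by blast
next
  fix N :: nat and S assume N: "1 \<le> N" and S: "\<forall>k\<in>{1..N}. S k \<in> err_algebra R L k"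
  then obtain B where B: "\<And>k. k \<in> {1..N} \<Longrightarrow> S k = E k -` B k \<and> B k \<subseteq> C \<and> continuity_set euclidean lborel (B k)"
    unfolding err_algebra_eq mem_Collect_eq by metis
  have BC: "B k \<subseteq> C \<and> continuity_set euclidean lborel (B k)" if "k \<in> {1..N}" for k using B[OF that] by blast
  have "(\<Inter>k\<in>{1..N}. S k) = (\<Inter>k\<in>{1..N}. E k -` B k)" using B by (intro INF_cong) auto
  also have "\<dots> = EE N -` block_product N B" by (rule err_product(1)[OF N BC])
  finally have I: "(\<Inter>k\<in>{1..N}. S k) = EE N -` block_product N B" .
  note f = err_freq[OF err_product(2,3)[where B = B, OF N BC]]
  show "freq_measurable (\<Inter>k\<in>{1..N}. S k)" unfolding I using f by blast
  have "freq (S k) = measure lebesgue (B k)" if "k \<in> {1..N}" for k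
    using B[OF that] err_single_freq[of k "B k"] that by auto
  thus "freq (\<Inter>k\<in>{1..N}. S k) = (\<Prod>k=1..N. freq (S k))"
    unfolding I using f err_product(4)[OF N BC] by simp
qed

section \<open>Comparison with the backward algebra\<close>

text \<open>For every \<open>x\<close>, the half-open unit cube and the preimage of the cell product
  under \<open>decode\<close> each contain exactly one lift. Integer translations carry Jordan sets
  from one domain to the other.\<close>

lemma err_stack_algebra_eq_backward:
  assumes N: "N \<ge> 1"
  shows "err_stack_algebra R L N = backward_class L N"
proof
  let ?I = "stack_index N :: (nat \<times> 'n) set"
  have cube: "jordan_measurable_on ?I (\<Pi>\<^sub>E i\<in>?I. {0..<1})" by (rule jordan_measurable_cube) auto
  show "err_stack_algebra R L N \<subseteq> backward_class L N"
  proof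
    fix S assume "S \<in> err_stack_algebra R L N"
    then obtain B where S: "S = EE N -` B" and B: "B \<subseteq> set_power C N" "continuity_set (X N) (V N) B"
      unfolding err_stack_algebra_eq[OF N] by blast
    let ?P = "{u \<in> extensional ?I. decode A N u \<in> B}"
    \<comment> \<open>The reduction of \<open>?P\<close> modulo integer vectors into the unit
      cube.\<close>
    define G where "G = {g \<in> \<Pi>\<^sub>E i\<in>?I. {0..<1}. \<exists>z :: nat \<times> 'n \<Rightarrow> int. (\<lambda>i\<in>?I. g i + of_int (z i)) \<in> ?P}"
    have G: "jordan_measurable_on ?I G" unfolding G_def
      by (intro jordan_measurable_translates cube jordan_measurable_decode_vimage jordan_in_power B) simp
    have Gsub: "G \<subseteq> (\<Pi>\<^sub>E i\<in>?I. {0..<1})" by (auto simp: G_def)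
    have Ge: "G \<subseteq> extensional ?I" using Gsub by (auto simp: PiE_def)
    have "S = Q_set ?I G (\<Lambda> N)"
    proof (rule set_eqI)
      fix x
      show "x \<in> S \<longleftrightarrow> x \<in> Q_set ?I G (\<Lambda> N)"
      proof
        assume "x \<in> S"
        then obtain z where z: "decode A N (lift N x z) \<in> B" using S lift_mem_iff[OF B(1), of x] by auto
        let ?u = "lift N x z"
        \<comment> \<open>Removing the integer parts moves the lift \<open>?u\<close> into the unit
          cube.\<close>
        let ?w = "\<lambda>c. \<lfloor>?u c\<rfloor>"
        let ?g = "lift N x (\<lambda>c. z c - ?w c)"
        have 1: "(\<lambda>c\<in>?I. ?g c + of_int (?w c)) = ?u" by (auto simp: lift_def)
        have "?g c = ?u c - of_int \<lfloor>?u c\<rfloor>" if "c \<in> ?I" for c using that by (simp add: lift_def)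
        hence "0 \<le> ?g c \<and> ?g c < 1" if "c \<in> ?I" for c using that by simp linarith
        hence 2: "?g \<in> (\<Pi>\<^sub>E i\<in>?I. {0..<1})" using lift_extensional by (auto simp: PiE_iff)
        have 3: "(\<lambda>c\<in>?I. ?g c + of_int (?w c)) \<in> ?P" unfolding 1 using z by simp
        have "?g \<in> G" unfolding G_def by (rule CollectI, rule conjI, rule 2, rule exI[of _ ?w], rule 3)
        hence "\<exists>z. lift N x z \<in> G" by (rule exI[where P = "\<lambda>z. lift N x z \<in> G"])
        thus "x \<in> Q_set ?I G (\<Lambda> N)" unfolding Q_set_iff[OF Ge] lift_def .
      next
        assume "x \<in> Q_set ?I G (\<Lambda> N)"
        then obtain z where "lift N x z \<in> G" unfolding Q_set_iff[OF Ge] lift_def by blast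
        then obtain w :: "nat \<times> 'n \<Rightarrow> int" where w: "(\<lambda>c\<in>?I. lift N x z c + of_int (w c)) \<in> ?P" unfolding G_def by blast
        have "(\<lambda>c\<in>?I. lift N x z c + of_int (w c)) = lift N x (\<lambda>c. z c + w c)" by (auto simp: lift_def)
        hence "decode A N (lift N x (\<lambda>c. z c + w c)) \<in> B" using w by simp
        thus "x \<in> S" using S lift_mem_iff[OF B(1), of x] by auto
      qed
    qed
    thus "S \<in> backward_class L N" unfolding backward_class_def Q_class_def using Gsub G by blast
  qed
  show "backward_class L N \<subseteq> err_stack_algebra R L N"
  proof
    fix S assume "S \<in> backward_class L N"
    then obtain G where S: "S = Q_set ?I G (\<Lambda> N)" and G: "jordan_measurable_on ?I G"
      unfolding backward_class_def Q_class_def by blast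
    have Ge: "G \<subseteq> extensional ?I" using G by (auto simp: jordan_measurable_on_def)
    define H where "H = {u \<in> extensional ?I. decode A N u \<in> set_power C N}"
    \<comment> \<open>The part of \<open>H\<close> congruent to \<open>G\<close>. The set
      \<open>B\<close> below is its image under \<open>decode\<close>, written as a preimage under
      \<open>encode\<close> so that \<open>volume_preserving_vimage\<close> applies.\<close>
    define W where "W = {h \<in> H. \<exists>z :: nat \<times> 'n \<Rightarrow> int. (\<lambda>i\<in>?I. h i + of_int (z i)) \<in> G}"
    define B where "B = {e \<in> extensional ?I. encode A N e \<in> W}"
    have "jordan_measurable_on ?I W" unfolding W_def H_def
      by (intro jordan_measurable_translates G jordan_measurable_decode_vimage jordan_in_power
          power_continuity N order_refl) simp
    hence cB: "continuity_set (X N) (V N) B" unfolding B_def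
      by (intro volume_preserving_vimage(1) volume_preserving_encode) (auto simp: jordan_measurable_on_iff)
    have B: "B \<subseteq> set_power C N" by (auto simp: B_def W_def H_def)
    have "EE N x \<in> B \<longleftrightarrow> x \<in> S" for x
    proof -
      let ?u = "lift N x (err_shift N x)"
      have d: "decode A N ?u = EE N x" by (rule decode_lift_err_shift)
      hence u: "encode A N (EE N x) = ?u" by (metis encode_decode lift_extensional)
      have "EE N x \<in> B \<longleftrightarrow> ?u \<in> W" using u err_stack_in_power[of N x] power_subset by (auto simp: B_def)
      also have "\<dots> \<longleftrightarrow> (\<exists>z :: nat \<times> 'n \<Rightarrow> int. (\<lambda>i\<in>?I. ?u i + of_int (z i)) \<in> G)"
        using d err_stack_in_power by (simp add: W_def H_def)
      also have "\<dots> \<longleftrightarrow> (\<exists>z. lift N x z \<in> G)"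
      proof
        assume "\<exists>z :: nat \<times> 'n \<Rightarrow> int. (\<lambda>i\<in>?I. ?u i + of_int (z i)) \<in> G"
        then obtain z :: "nat \<times> 'n \<Rightarrow> int" where z: "(\<lambda>i\<in>?I. ?u i + of_int (z i)) \<in> G" by blast
        have "(\<lambda>i\<in>?I. ?u i + of_int (z i)) = lift N x (\<lambda>c. err_shift N x c + z c)" by (auto simp: lift_def)
        thus "\<exists>z. lift N x z \<in> G" using z by metis
      next
        assume "\<exists>z. lift N x z \<in> G"
        then obtain z where z: "lift N x z \<in> G" by blast
        have "(\<lambda>i\<in>?I. ?u i + of_int (z i - err_shift N x i)) = lift N x z" by (auto simp: lift_def)
        thus "\<exists>z :: nat \<times> 'n \<Rightarrow> int. (\<lambda>i\<in>?I. ?u i + of_int (z i)) \<in> G"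
          using z by (intro exI[of _ "\<lambda>c. z c - err_shift N x c"]) simp
      qed
      also have "\<dots> \<longleftrightarrow> x \<in> S" unfolding S Q_set_iff[OF Ge] lift_def ..
      finally show ?thesis .
    qed
    hence "S = EE N -` B" by auto
    thus "S \<in> err_stack_algebra R L N" unfolding err_stack_algebra_eq[OF N] using B cB by blast
  qed
qed

lemma err_algebra_subset_backward:
  assumes "k \<ge> 1"
  shows "err_algebra R L k \<subseteq> backward_class L k"
proof
  fix S assume "S \<in> err_algebra R L k"
  then obtain B where S: "S = E k -` B" and B: "B \<subseteq> C" "continuity_set euclidean lborel B"
    unfolding err_algebra_eq by blast
  have "S \<in> err_stack_algebra R L k"
    unfolding err_stack_algebra_eq[OF assms] S
    by (rule CollectI, rule exI, intro conjI) (rule err_single(1-3)[OF assms B])+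
  thus "S \<in> backward_class L k" unfolding err_stack_algebra_eq_backward[OF assms] .
qed

text \<open>For the inclusion from right to left, a stack with a single block is
  \<open>real^'n\<close> in other coordinates, and continuity sets are transported along this
  identification.\<close>

lemma err_algebra_1: "err_algebra R L 1 = backward_class L 1"
proof
  show "err_algebra R L 1 \<subseteq> backward_class L 1" by (rule err_algebra_subset_backward) simp
  let ?f = "\<lambda>w :: real^'n. \<lambda>c\<in>stack_index 1. w $ snd c"
  have f: "continuous_map euclidean (X 1) ?f"
    unfolding continuous_map_vec_space by (auto intro!: continuous_intros)
  interpret S: borel_topology "X 1" "V 1" by (rule borel_topology_vec_space) simp
  show "backward_class L 1 \<subseteq> err_algebra R L 1"
  proof
    fix S assume "S \<in> backward_class L 1"
    then obtain B where S: "S = EE 1 -` B" and B: "B \<subseteq> set_power C 1" "continuity_set (X 1) (V 1) B"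
      using err_stack_algebra_eq_backward[of 1] err_stack_algebra_eq[of 1] by auto
    have c: "continuity_set euclidean lborel {w \<in> topspace euclidean. ?f w \<in> B}"
    proof (rule continuity_set_vimage[OF f B(2)])
      fix F assume F: "closedin (X 1) F" "F \<in> null_sets (completion (V 1))"
      let ?D = "{w \<in> topspace euclidean. ?f w \<in> F}"
      have D: "closed ?D" using closedin_continuous_map_preimage[OF f F(1)] by simp
      have Fe: "F \<subseteq> extensional (stack_index 1)" using closedin_subset[OF F(1)] by simp
      have "?f (\<chi> i. v (1, i)) = v" if "v \<in> extensional (stack_index 1)" for v
        using that by (auto simp: fun_eq_iff extensional_def stack_index_def)
      \<comment> \<open>A closed set of one-block vectors is a product with the single factor
        \<open>?D\<close>, so \<open>emeasure_block_product\<close> gives the volume of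
        \<open>?D\<close>.\<close>
      hence bF: "block_product 1 (\<lambda>_. ?D) = F" using Fe by (auto simp: block_product_def)
      have "block_product 1 (\<lambda>_. ?D) \<in> sets (V 1)" unfolding bF by (rule S.closedin_sets[OF F(1)])
      from emeasure_block_product[OF _ this] D
      have "emeasure lborel ?D = emeasure (V 1) (block_product 1 (\<lambda>_. ?D))" by simp
      also have "\<dots> = 0" unfolding bF using F(2) S.closedin_sets[OF F(1)] by (auto simp: null_sets_completion_iff)
      finally show "?D \<in> null_sets (completion lborel)" using D by (intro null_sets_completionI) auto
    qed
    have "EE 1 x = ?f (E 1 x)" for x by (auto simp: comp_err_stack_def fun_eq_iff stack_index_def)
    hence "S = E 1 -` ({w \<in> topspace euclidean. ?f w \<in> B} \<inter> C)"
      unfolding S using err_in_cell by auto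
    moreover have "continuity_set euclidean lborel ({w \<in> topspace euclidean. ?f w \<in> B} \<inter> C)"
      by (intro continuity_set_Int c cell_continuity)
    ultimately show "S \<in> err_algebra R L 1" unfolding err_algebra_eq by blast
  qed
qed

text \<open>\<open>E k\<close> is \<open>E 1\<close> after \<open>k - 1\<close> steps of
  \<open>T\<close>, so the identity for the first error is pulled back.\<close>

lemma err_algebra_preimages:
  assumes "k \<ge> 1"
  shows "err_algebra R L k = preimages T (k - 1) (backward_class L 1)"
proof -
  have "E k -` B = (T ^^ (k - 1)) -` (E 1 -` B)" for B by (auto simp: comp_err_def)
  thus ?thesis unfolding preimages_def err_algebra_1[symmetric] err_algebra_eq by auto
qed

end

theorem theorem12:
  fixes R :: "real^'n \<Rightarrow> int^'n" and L :: "real^'n^'n"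
  assumes "quantizer R"
    and "invertible L"
    and "iteratively_nonresonant L"
  shows
    "(mutually_independent (err_algebra R L) \<and>
      (\<forall>k\<ge>1. distributed_map (cell_top (comp_cell R L)) (cell_mes (comp_cell R L)) (comp_err R L k)) \<and>
      (\<forall>k\<ge>1. err_algebra R L k \<subseteq> backward_algebra L) \<and>
      (\<forall>N\<ge>1. distributed_map (cell_power_top (comp_cell R L) N) (cell_power_mes (comp_cell R L) N)
                (comp_err_stack R L N) \<and>
              err_stack_algebra R L N = backward_class L N)) \<and>
     ((\<forall>k\<ge>1. err_algebra R L k = preimages (comp_trans R L) (k - 1) (backward_class L 1) \<and>
              preimages (comp_trans R L) (k - 1) (backward_class L 1) \<subseteq> backward_class L k) \<and>
      mutually_independent (err_algebra R L))"
proof -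
  interpret quantized_system R L by (rule quantized_system.intro[OF assms(1,3)])
  have "err_algebra R L k \<subseteq> backward_algebra L" if "k \<ge> 1" for k
    using err_algebra_subset_backward[OF that] that unfolding backward_algebra_def by auto
  moreover have "preimages (comp_trans R L) (k - 1) (backward_class L 1) \<subseteq> backward_class L k" if "k \<ge> 1" for k
    using err_algebra_subset_backward[OF that] err_algebra_preimages[OF that] by simp
  ultimately show ?thesis
    using independent_err distributed_err distributed_stack err_stack_algebra_eq_backward err_algebra_preimages
    by blast
qed

end
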